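(* Let $\phi\in L^2(\mathbb{R})\setminus\{0\}$ be a window function, $f\in L^2(\mathbb{R})$, and let $T,U$ be two subsets of $\mathbb{R}$ with finite measure. Then there exists a constant $C>0$ such that $$\|\phi\|^{2}\int_{\mathbb{R}}|f(t)|^{2}\,dt\ \leq\ Ce^{C|T||U|}\left(\|\phi\|^{2}\int_{\mathbb{R}\setminus T}|f(t)|^{2}\,dt+\int_{\mathbb{R}}\int_{\mathbb{R}\setminus (Ub)}|V_{\phi}^{A}f(u,w)|^{2}\,du\,dw\right).$$
   Context: Let $A=(a,b,c,d,u_{0},w_{0})$ with $a,b,c,d,u_0,w_0\in\mathbb{R}$, $ad-bc=1$ and $b\neq 0$. The offset linear canonical transform kernel is $$K_{A}(t,u)=\frac{1}{\sqrt{i2\pi b}}\,e^{i\frac{a}{2b}t^{2}-i\frac{1}{b}t(u-u_{0})-i\frac{1}{b}u(du_{0}-bw_{0})+i\frac{d}{2b}(u^{2}+u_{0}^{2})}.$$ For a window function $\phi\in L^2(\mathbb{R})\setminus\{0\}$, the windowed offset linear canonical transform (WOLCT) of $f\in L^2(\mathbb{R})$ is $$V^{A}_{\phi}f(u,w)=\int_{\mathbb{R}}f(t)\,\overline{\phi(t-w)}\,K_{A}(t,u)\,dt,\qquad (u,w)\in\mathbb{R}^2 .$$ $\|\cdot\|$ denotes the $L^2(\mathbb{R})$ norm, $|T|$ and $|U|$ denote Lebesgue measures (the sets being measurable), and $Ub=\{ub: u\in U\}$. *)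

theory Defs
  imports "HOL-Analysis.Analysis"
begin

definition square_integrable :: "(real \<Rightarrow> complex) \<Rightarrow> bool" where
  "square_integrable f \<longleftrightarrow>
     f \<in> borel_measurable lebesgue \<and> integrable lebesgue (\<lambda>t. (cmod (f t))\<^sup>2)"

definition L2_norm :: "(real \<Rightarrow> complex) \<Rightarrow> real" where
  "L2_norm f = sqrt (LINT t|lebesgue. (cmod (f t))\<^sup>2)"

text \<open>The parameter tuple is \<open>A = (a, b, c, d, u\<^sub>0, w\<^sub>0)\<close>; the entry \<open>c\<close> matters only through
  the side condition \<open>a * d - b * c = 1\<close>. The square root is the principal branch.\<close>

type_synonym olct_param = "real \<times> real \<times> real \<times> real \<times> real \<times> real"

fun olct_kernel :: "olct_param \<Rightarrow> real \<Rightarrow> real \<Rightarrow> complex" where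
  "olct_kernel (a, b, c, d, u0, w0) t u =
     1 / csqrt (\<i> * of_real (2 * pi * b)) *
     exp (\<i> * of_real (a / (2 * b) * t\<^sup>2)
        - \<i> * of_real (1 / b * t * (u - u0))
        - \<i> * of_real (1 / b * u * (d * u0 - b * w0))
        + \<i> * of_real (d / (2 * b) * (u\<^sup>2 + u0\<^sup>2)))"

definition wolct ::
    "olct_param \<Rightarrow> (real \<Rightarrow> complex) \<Rightarrow> (real \<Rightarrow> complex) \<Rightarrow> real \<Rightarrow> real \<Rightarrow> complex" where
  "wolct A \<phi> f u w = (LINT t|lebesgue. f t * cnj (\<phi> (t - w)) * olct_kernel A t u)"

end

theory Submission
  imports Defs "HOL-Complex_Analysis.Complex_Analysis" "HOL-Computational_Algebra.Fundamental_Theorem_Algebra"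
begin

text \<open>For a fixed \<open>w\<close> the transform of \<open>f\<close> is, up to the scaling \<open>u = 2\<pi>b x\<close> and a factor whose modulus is constant, the
Fourier transform of the integrable function \<open>g\<^sub>w(t) = f(t) cnj (\<phi>(t - w)) e(t)\<close>, where \<open>e\<close> is a
chirp with \<open>|e| = 1\<close> (\<open>cmod_wolct\<close>). By Tonelli, integrating \<open>\<parallel>g\<^sub>w\<parallel>\<^sup>2\<close> over all \<open>w\<close> gives \<open>\<parallel>\<phi>\<parallel>\<^sup>2 \<parallel>f\<parallel>\<^sup>2\<close>, and
likewise outside \<open>T\<close>. So the claim is Nazarov's uncertainty principle
\<open>\<parallel>g\<parallel>\<^sup>2 \<le> C exp(C|T||U|) (\<integral>|g|\<^sup>2 outside T + \<integral>|g^|\<^sup>2 outside U)\<close>, where \<open>g^\<close> denotes the Fourier transform,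
applied to almost every \<open>g\<^sub>w\<close> and integrated over \<open>w\<close>. All the depth is in this principle, whose point is the
absolute constant with exponent linear in \<open>|T||U|\<close>.

Let \<open>h\<close> live on \<open>T\<close>. Periodize a dilate \<open>h(t/w)\<close> with period 1, where \<open>w\<close> is about \<open>1/|T|\<close>: the resulting
function \<open>\<Gamma>\<close> on the circle vanishes on a set \<open>E\<close> of measure at least one half, and its Fourier
coefficients are \<open>w h^(mw)\<close>. Averaging over \<open>w\<close> (\<open>exists_good_dilation\<close>) yields a \<open>w\<close> for which only \<open>O(1 + |T||U|)\<close> of
the points \<open>mw\<close> with \<open>m \<noteq> 0\<close> lie in \<open>U\<close>, while the coefficients at all other \<open>m \<noteq> 0\<close> are controlled by
\<open>\<integral>|h^|\<^sup>2\<close> over the complement of \<open>U\<close>. Split \<open>\<Gamma> = P + R\<close> into these few frequencies, together with 0, and the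
remaining ones. On \<open>E\<close> one has \<open>P = - R\<close>, hence by Parseval \<open>\<integral>|P|\<^sup>2\<close> over \<open>E\<close> is at most the small number \<open>\<parallel>R\<parallel>\<^sup>2\<close>.
A trigonometric polynomial with \<open>k\<close> frequencies cannot be small on such a large set: each
coefficient is at most \<open>C\<^sup>k\<close> times its \<open>L\<^sup>2\<close> norm on \<open>E\<close> (\<open>turan_large_set\<close>). This bounds
\<open>h^(0)\<close>, and by modulation \<open>h^\<close> at every point (\<open>fourier_pointwise_estimate\<close>);
integration over \<open>U\<close> and Plancherel's theorem give the uncertainty principle.

The inequality for few frequencies rests on Mahler measures. For a polynomial \<open>p\<close> with \<open>k\<close> terms whose
coefficients have absolute sum 1, the mean of \<open>ln |p|\<close> over the circle is at least \<open>- k ln 2\<close>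
(\<open>log_mean_lower_bound\<close>, which avoids zeros by varying the radius). Since \<open>ln |p| \<le> 0\<close> there, Markov's inequality makes \<open>|p| < 1/16\<^sup>k\<close> possible
only on a set of measure at most one quarter (\<open>measure_small_values\<close>). The lower bound is an induction on
the degree: the first or the last term of \<open>p\<close> is removed by one of the operators \<open>z p'\<close> and \<open>N p - z p'\<close>, \<open>N = deg p\<close>,
which add up to \<open>N p\<close>, so that one of them keeps half of the absolute sum; and neither increases the
Mahler measure by more than the factor \<open>N\<close> (\<open>mean_ln_norm_derivative_le\<close>).\<close>

section \<open>Logarithmic means of polynomials with few terms\<close>

text \<open>The principal logarithm of \<open>H\<close> is holomorphic because \<open>H\<close> avoids the negative real axis; the
claim is the real part of its mean value property.\<close>

lemma mean_ln_norm_positive_real_part: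
  assumes cont: "continuous_on (cball 0 1) H" and hol: "H holomorphic_on ball 0 1"
    and pos: "\<And>z. cmod z \<le> 1 \<Longrightarrow> Re (H z) > 0"
  shows "((\<lambda>t. ln (cmod (H (cis (2 * pi * t))))) has_integral ln (cmod (H 0))) {0..1}"
proof -
  define f where "f = (\<lambda>z. Ln (H z))"
  have nonneg: "H z \<notin> \<real>\<^sub>\<le>\<^sub>0" if "cmod z \<le> 1" for z
    using pos[OF that] by (auto simp: complex_nonpos_Reals_iff)
  have "continuous_on (cball 0 1) f"
    unfolding f_def by (intro continuous_on_Ln' cont) (use nonneg in auto)
  moreover have "f holomorphic_on ball 0 1"
    unfolding f_def by (intro holomorphic_on_Ln' hol) (use nonneg in auto)
  ultimately have "((\<lambda>u. f u / (u - 0)) has_contour_integral (2 * of_real pi * \<i> * f 0)) (circlepath 0 1)"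
    by (intro Cauchy_integral_circlepath) auto
  then have "((\<lambda>x. f (circlepath 0 1 x) / (circlepath 0 1 x - 0) *
       vector_derivative (circlepath 0 1) (at x within {0..1})) has_integral (2 * of_real pi * \<i> * f 0)) {0..1}"
    unfolding has_contour_integral_def .
  then have "((\<lambda>t. 2 * of_real pi * \<i> * f (cis (2 * pi * t))) has_integral (2 * of_real pi * \<i> * f 0)) {0..1}"
  proof (rule has_integral_eq[rotated])
    fix t :: real assume "t \<in> {0..1}"
    moreover have "circlepath 0 1 t = cis (2 * pi * t)"
      by (simp add: circlepath cis_conv_exp mult_ac)
    moreover have "exp (2 * of_real pi * \<i> * of_real t) = cis (2 * pi * t)"
      by (simp add: cis_conv_exp mult_ac)
    ultimately show "f (circlepath 0 1 t) / (circlepath 0 1 t - 0) *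
       vector_derivative (circlepath 0 1) (at t within {0..1}) = 2 * of_real pi * \<i> * f (cis (2 * pi * t))"
      by (simp add: vector_derivative_circlepath01)
  qed
  then have "((\<lambda>t. inverse (2 * of_real pi * \<i>) * (2 * of_real pi * \<i> * f (cis (2 * pi * t)))) has_integral
               inverse (2 * of_real pi * \<i>) * (2 * of_real pi * \<i> * f 0)) {0..1}"
    by (rule has_integral_mult_right)
  then have "((\<lambda>t. f (cis (2 * pi * t))) has_integral f 0) {0..1}"
    by (simp add: field_simps)
  from has_integral_linear[OF this bounded_linear_Re]
  have "((\<lambda>t. Re (f (cis (2 * pi * t)))) has_integral Re (f 0)) {0..1}"
    by (simp add: o_def)
  moreover have "Re (f z) = ln (cmod (H z))" if "cmod z \<le> 1" for z
    using pos[OF that] unfolding f_def by (subst Re_Ln) auto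
  ultimately show ?thesis by simp
qed

text \<open>With \<open>N = degree g\<close> and roots \<open>z\<^sub>i\<close>, the quotient \<open>z g'(z) / (N g(z))\<close> is the average of the numbers
\<open>z / (z - z\<^sub>i)\<close>. For \<open>|z| = 1\<close> such a number lies to the right of the line \<open>Re = 1/2\<close> if the root is inside the
disc and to the left of it if the root is outside. Reflecting the latter in this line moves all numbers to one side,
which can only increase the modulus of the average, and this remains true for \<open>1 - z g'(z) / (N g(z))\<close>, whose
summands are obtained by a point reflection in \<open>1/2\<close>. The reflected average is the complex conjugate of a function
that extends holomorphically to the disc, with real part at least \<open>1/2\<close> and value 1 at the origin.\<close>

lemma logarithmic_derivative_majorant:
  fixes g :: "complex poly"
  assumes deg: "degree g > 0" and nz: "\<And>z. cmod z = 1 \<Longrightarrow> poly g z \<noteq> 0"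
  obtains H where "continuous_on (cball 0 1) H" "H holomorphic_on ball 0 1"
    "\<And>z. cmod z \<le> 1 \<Longrightarrow> Re (H z) > 0" "H 0 = 1"
    "\<And>z. cmod z = 1 \<Longrightarrow> cmod (z * poly (pderiv g) z) \<le> degree g * cmod (poly g z) * cmod (H z)"
    "\<And>z. cmod z = 1 \<Longrightarrow> cmod (of_nat (degree g) * poly g z - z * poly (pderiv g) z)
       \<le> degree g * cmod (poly g z) * cmod (H z)"
proof -
  define N where "N = degree g"
  obtain root where root: "smult (lead_coeff g) (\<Prod>i<N. [:-root i, 1:]) = g"
    unfolding N_def by (rule complex_poly_decompose')
  have N: "N > 0" using deg by (simp add: N_def)
  have g0: "g \<noteq> 0" using deg by auto
  have poly_g: "poly g z = lead_coeff g * (\<Prod>i<N. (z - root i))" for z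
    by (subst root[symmetric]) (simp add: poly_prod)
  have root1: "cmod (root i) \<noteq> 1" if "i < N" for i
    using nz[of "root i"] that by (auto simp: poly_g)
  define w where "w = (\<lambda>i z. z / (z - root i))"
  have poly_g': "z * poly (pderiv g) z = poly g z * (\<Sum>i<N. w i z)" if z: "cmod z = 1" for z
  proof -
    have "poly (pderiv g) z = lead_coeff g * (\<Sum>i<N. \<Prod>j\<in>{..<N}-{i}. (z - root j))"
      by (subst root[symmetric]) (simp add: pderiv_smult pderiv_prod poly_sum poly_prod pderiv_pCons)
    also have "\<dots> = lead_coeff g * (\<Sum>i<N. (\<Prod>j<N. (z - root j)) / (z - root i))"
    proof -
      have "(\<Prod>j\<in>{..<N}-{i}. (z - root j)) = (\<Prod>j<N. (z - root j)) / (z - root i)" if "i < N" for i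
      proof -
        have "z - root i \<noteq> 0" using root1[OF that] z by auto
        then show ?thesis using that by (subst prod.remove[of "{..<N}" i]) auto
      qed
      then show ?thesis by simp
    qed
    finally show ?thesis by (simp add: poly_g w_def sum_distrib_left sum_distrib_right mult_ac)
  qed
  define \<beta> where "\<beta> = (\<lambda>i. if cmod (root i) < 1 then cnj (root i) else 1 / root i)"
  define h where "h = (\<lambda>i z. 1 / (1 - \<beta> i * z))"
  define H where "H = (\<lambda>z. (\<Sum>i<N. h i z) / of_nat N)"
  have \<beta>: "cmod (\<beta> i) < 1" if "i < N" for i
  proof (cases "cmod (root i) < 1")
    case False
    then have "cmod (root i) > 1" using root1[OF that] by linarith
    then show ?thesis by (simp add: \<beta>_def norm_divide divide_less_eq)
  qed (simp add: \<beta>_def)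
  have bz: "cmod (\<beta> i * z) < 1" if "i < N" "cmod z \<le> 1" for i z
  proof -
    have "cmod (\<beta> i * z) \<le> cmod (\<beta> i) * 1"
      unfolding norm_mult by (intro mult_left_mono that) auto
    then show ?thesis using \<beta>[OF that(1)] by simp
  qed
  have bz1: "1 - \<beta> i * z \<noteq> 0" if "i < N" "cmod z \<le> 1" for i z
    using bz[OF that] by (metis eq_iff_diff_eq_0 less_irrefl norm_one)
  have Re_inv: "Re (1 / (1 - u)) \<ge> 1 / 2" if "cmod u < 1" for u
  proof -
    have u: "(Re u)\<^sup>2 + (Im u)\<^sup>2 < 1"
      using that by (metis abs_norm_cancel abs_square_less_1 cmod_power2)
    have ne: "1 - u \<noteq> 0" using that by auto
    have d: "(1 - Re u)\<^sup>2 + (Im u)\<^sup>2 > 0"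
      using ne by (metis cmod_power2 minus_complex.sel one_complex.sel zero_less_norm_iff diff_0 power2_minus zero_less_power)
    have "Re (1 / (1 - u)) = (1 - Re u) / ((1 - Re u)\<^sup>2 + (Im u)\<^sup>2)"
      by (simp add: Re_divide)
    moreover have "1 / 2 * ((1 - Re u)\<^sup>2 + (Im u)\<^sup>2) \<le> 1 - Re u"
      using u by (simp add: power2_eq_square algebra_simps)
    ultimately show ?thesis using d by (simp only: pos_le_divide_eq)
  qed
  have Re_h: "Re (h i z) \<ge> 1 / 2" if "i < N" "cmod z \<le> 1" for i z
    unfolding h_def by (rule Re_inv[OF bz[OF that]])
  have Re_H: "Re (H z) \<ge> 1 / 2" if "cmod z \<le> 1" for z
  proof -
    have "(\<Sum>i<N. Re (h i z)) \<ge> (\<Sum>i<N. 1 / 2)"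
      by (intro sum_mono Re_h) (use that in auto)
    moreover have "Re (H z) = (\<Sum>i<N. Re (h i z)) / N" by (simp add: H_def)
    ultimately show ?thesis using N by (simp add: pos_le_divide_eq)
  qed
  \<comment> \<open>On the circle, \<open>w i\<close> is the conjugate of \<open>h i\<close> for a root inside the disc and
      \<open>1 - h i\<close>, the reflection of this conjugate in the line \<open>Re = 1/2\<close>, for a root outside.\<close>
  have w_eq: "Im (w i z) = - Im (h i z) \<and> \<bar>Re (w i z) - 1/2\<bar> = Re (h i z) - 1/2"
    if i: "i < N" and z: "cmod z = 1" for i z
  proof (cases "cmod (root i) < 1")
    case True
    have zz: "z * cnj z = 1" using z by (simp add: complex_norm_square[symmetric])
    have "z - root i = z * (1 - root i * cnj z)"
      using zz by (simp add: algebra_simps)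
    moreover have "z \<noteq> 0" using z by auto
    ultimately have "w i z = cnj (h i z)"
      using True by (simp add: w_def h_def \<beta>_def)
    then show ?thesis using Re_h[OF i, of z] z by auto
  next
    case False
    then have r: "root i \<noteq> 0" "z - root i \<noteq> 0" using root1[OF i] z by auto
    have "w i z = 1 - h i z"
      using False r by (simp add: w_def h_def \<beta>_def field_simps)
    then show ?thesis using Re_h[OF i, of z] z by auto
  qed
  have key: "cmod ((\<Sum>i<N. w i z)) \<le> N * cmod (H z)" "cmod (of_nat N - (\<Sum>i<N. w i z)) \<le> N * cmod (H z)"
    if z: "cmod z = 1" for z
  proof -
    define x where "x = (\<Sum>i<N. Re (w i z) - 1/2)"
    define X where "X = (\<Sum>i<N. Re (h i z) - 1/2)"
    define y where "y = (\<Sum>i<N. Im (h i z))"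
    have "\<bar>x\<bar> \<le> (\<Sum>i<N. \<bar>Re (w i z) - 1/2\<bar>)" unfolding x_def by (rule sum_abs)
    also have "\<dots> = X" unfolding X_def by (intro sum.cong refl) (use w_eq z in auto)
    finally have xX: "\<bar>x\<bar> \<le> X" .
    have H: "of_nat N * H z = Complex (N / 2 + X) y"
      using N by (simp add: H_def complex_eq_iff X_def y_def sum_subtractf)
    have W: "(\<Sum>i<N. w i z) = Complex (N / 2 + x) (- y)"
      using w_eq[OF _ z] by (simp add: complex_eq_iff x_def y_def sum_subtractf sum_negf)
    have bd: "(N / 2 + s)\<^sup>2 \<le> (N / 2 + X)\<^sup>2" if "\<bar>s\<bar> \<le> X" for s
      by (rule abs_le_square_iff[THEN iffD1]) (use that in auto)
    have NH: "N * cmod (H z) = sqrt ((N / 2 + X)\<^sup>2 + y\<^sup>2)"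
      using arg_cong[OF H, of cmod] by (simp add: norm_mult complex_norm)
    show "cmod ((\<Sum>i<N. w i z)) \<le> N * cmod (H z)"
      unfolding NH W complex_norm using bd[OF xX] by simp
    have "of_nat N - (\<Sum>i<N. w i z) = Complex (N / 2 + - x) y"
      unfolding W by (simp add: complex_eq_iff)
    then show "cmod (of_nat N - (\<Sum>i<N. w i z)) \<le> N * cmod (H z)"
      unfolding NH using bd[of "- x"] xX by (simp add: complex_norm)
  qed
  show thesis
  proof
    have "continuous_on (cball 0 1) H" unfolding H_def h_def
      by (intro continuous_intros) (use bz1 N in auto)
    then show "continuous_on (cball 0 1) H" .
    show "H holomorphic_on ball 0 1" unfolding H_def h_def
      by (intro holomorphic_intros) (use bz1 N in auto)
    show "Re (H z) > 0" if "cmod z \<le> 1" for z using Re_H[OF that] by simp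
    show "H 0 = 1" using N by (simp add: H_def h_def)
    show "cmod (z * poly (pderiv g) z) \<le> degree g * cmod (poly g z) * cmod (H z)" if z: "cmod z = 1" for z
      unfolding poly_g'[OF z] norm_mult N_def[symmetric]
      using mult_left_mono[OF key(1)[OF z], of "cmod (poly g z)"] by (simp add: mult_ac)
    show "cmod (of_nat (degree g) * poly g z - z * poly (pderiv g) z)
       \<le> degree g * cmod (poly g z) * cmod (H z)" if z: "cmod z = 1" for z
    proof -
      have "of_nat (degree g) * poly g z - z * poly (pderiv g) z = poly g z * (of_nat N - (\<Sum>i<N. w i z))"
        unfolding poly_g'[OF z] N_def[symmetric] by (simp add: algebra_simps)
      then show ?thesis
        using mult_left_mono[OF key(2)[OF z], of "cmod (poly g z)"] by (simp add: norm_mult N_def mult_ac)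
    qed
  qed
qed

text \<open>Bernstein's inequality for the Mahler measure: the mean of \<open>ln |H|\<close> for the majorant \<open>H\<close>
vanishes, so passing from \<open>g\<close> to \<open>z g'\<close> or to \<open>N g - z g'\<close> costs only \<open>ln N\<close>.\<close>

lemma mean_ln_norm_derivative_le:
  fixes g :: "complex poly"
  assumes deg: "degree g > 0" and nz: "\<And>z. cmod z = 1 \<Longrightarrow> poly g z \<noteq> 0"
    and contq: "continuous_on (sphere 0 1) q" and nzq: "\<And>z. cmod z = 1 \<Longrightarrow> q z \<noteq> 0"
    and q: "\<And>z. cmod z = 1 \<Longrightarrow> q z = z * poly (pderiv g) z \<or> q z = of_nat (degree g) * poly g z - z * poly (pderiv g) z"
  shows "integral {0..1} (\<lambda>t. ln (cmod (q (cis (2 * pi * t)))))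
       \<le> ln (degree g) + integral {0..1} (\<lambda>t. ln (cmod (poly g (cis (2 * pi * t)))))"
proof -
  obtain H where H: "continuous_on (cball 0 1) H" "H holomorphic_on ball 0 1"
    "\<And>z. cmod z \<le> 1 \<Longrightarrow> Re (H z) > 0" "H 0 = 1"
    "\<And>z. cmod z = 1 \<Longrightarrow> cmod (z * poly (pderiv g) z) \<le> degree g * cmod (poly g z) * cmod (H z)"
    "\<And>z. cmod z = 1 \<Longrightarrow> cmod (of_nat (degree g) * poly g z - z * poly (pderiv g) z)
       \<le> degree g * cmod (poly g z) * cmod (H z)"
    using logarithmic_derivative_majorant[OF deg nz] by blast
  have intH: "((\<lambda>t. ln (cmod (H (cis (2 * pi * t))))) has_integral 0) {0..1}"
    using mean_ln_norm_positive_real_part[OF H(1-3)] H(4) by simp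
  have contc: "continuous_on {0..1::real} (\<lambda>t. cis (2 * pi * t))"
    by (intro continuous_intros)
  have contqc: "continuous_on {0..1::real} (\<lambda>t. q (cis (2 * pi * t)))"
    by (rule continuous_on_compose2[OF contq contc]) auto
  have intq: "(\<lambda>t. ln (cmod (q (cis (2 * pi * t))))) integrable_on {0..1}"
    by (intro integrable_continuous_real continuous_intros contqc) (use nzq in auto)
  have intg: "(\<lambda>t. ln (cmod (poly g (cis (2 * pi * t))))) integrable_on {0..1}"
    by (intro integrable_continuous_real continuous_intros) (use nz in auto)
  have "integral {0..1} (\<lambda>t. ln (cmod (q (cis (2 * pi * t)))))
     \<le> integral {0..1} (\<lambda>t. ln (degree g) + ln (cmod (poly g (cis (2 * pi * t)))) + ln (cmod (H (cis (2 * pi * t)))))"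
  proof (rule integral_le)
    show "(\<lambda>t. ln (degree g) + ln (cmod (poly g (cis (2 * pi * t)))) + ln (cmod (H (cis (2 * pi * t))))) integrable_on {0..1}"
      using intg intH by (intro integrable_add) (auto simp: integrable_on_def)
  next
    fix t :: real
    let ?z = "cis (2 * pi * t)"
    have H0: "H ?z \<noteq> 0" using H(3)[of ?z] by auto
    have "cmod (q ?z) \<le> degree g * cmod (poly g ?z) * cmod (H ?z)"
      using H(5)[of ?z] H(6)[of ?z] q[of ?z] by auto
    then have "ln (cmod (q ?z)) \<le> ln (degree g * cmod (poly g ?z) * cmod (H ?z))"
      by (intro ln_mono) (use nzq[of ?z] in auto)
    also have "\<dots> = ln (degree g) + ln (cmod (poly g ?z)) + ln (cmod (H ?z))"
      using deg nz[of ?z] H0 by (simp add: ln_mult)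
    finally show "ln (cmod (q ?z)) \<le> ln (degree g) + ln (cmod (poly g ?z)) + ln (cmod (H ?z))" .
  qed (rule intq)
  also have "\<dots> = ln (degree g) + integral {0..1} (\<lambda>t. ln (cmod (poly g (cis (2 * pi * t)))))"
  proof (rule integral_unique)
    have "((\<lambda>t. ln (degree g) + ln (cmod (poly g (cis (2 * pi * t)))) + ln (cmod (H (cis (2 * pi * t))))) has_integral
       (ln (degree g) + integral {0..1} (\<lambda>t. ln (cmod (poly g (cis (2 * pi * t))))) + 0)) {0..1}"
      using has_integral_const_real[of "ln (degree g)" 0 1]
      by (intro has_integral_add intH integrable_integral intg) auto
    then show "((\<lambda>t. ln (degree g) + ln (cmod (poly g (cis (2 * pi * t)))) + ln (cmod (H (cis (2 * pi * t))))) has_integral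
       (ln (degree g) + integral {0..1} (\<lambda>t. ln (cmod (poly g (cis (2 * pi * t))))))) {0..1}" by simp
  qed
  finally show ?thesis .
qed

text \<open>The radius \<open>r\<close> is carried along so that circles through zeros of \<open>p\<close>, where \<open>ln |p|\<close> is unbounded,
can be avoided.\<close>

definition coeff_sum :: "real \<Rightarrow> complex poly \<Rightarrow> real" where
  "coeff_sum r p = (\<Sum>k\<le>degree p. cmod (coeff p k) * r ^ k)"

definition log_mean :: "real \<Rightarrow> complex poly \<Rightarrow> real" where
  "log_mean r p = integral {0..1} (\<lambda>t. ln (cmod (poly p (of_real r * cis (2 * pi * t)))))"

lemma coeff_sum_eq:
  assumes "degree p \<le> n" shows "coeff_sum r p = (\<Sum>k\<le>n. cmod (coeff p k) * r ^ k)"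
  unfolding coeff_sum_def using assms
  by (intro sum.mono_neutral_left) (auto simp: coeff_eq_0)

lemma coeff_sum_pCons_0: "coeff_sum r (pCons 0 p) = r * coeff_sum r p"
proof -
  have "coeff_sum r (pCons 0 p) = (\<Sum>k\<le>Suc (degree p). cmod (coeff (pCons 0 p) k) * r ^ k)"
    by (rule coeff_sum_eq) (rule degree_pCons_le)
  also have "\<dots> = r * coeff_sum r p"
    by (subst sum.atMost_Suc_shift) (simp add: coeff_sum_def sum_distrib_left mult_ac)
  finally show ?thesis .
qed

lemma coeff_sum_pos:
  assumes "p \<noteq> 0" "r > 0" shows "coeff_sum r p > 0"
  unfolding coeff_sum_def
  by (rule sum_pos2[of _ "degree p"]) (use assms in auto)

lemma log_mean_pCons_0:
  assumes "r > 0" and nz: "\<And>z. cmod z = 1 \<Longrightarrow> poly p (of_real r * z) \<noteq> 0"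
  shows "log_mean r (pCons 0 p) = ln r + log_mean r p"
proof -
  have int: "(\<lambda>t. ln (cmod (poly p (of_real r * cis (2 * pi * t))))) integrable_on {0..1}"
    by (intro integrable_continuous_real continuous_intros) (use nz in auto)
  have "log_mean r (pCons 0 p) = integral {0..1} (\<lambda>t. ln r + ln (cmod (poly p (of_real r * cis (2 * pi * t)))))"
    unfolding log_mean_def
  proof (rule integral_cong)
    fix t :: real
    show "ln (cmod (poly (pCons 0 p) (of_real r * cis (2 * pi * t))))
       = ln r + ln (cmod (poly p (of_real r * cis (2 * pi * t))))"
      using assms(1) nz[of "cis (2 * pi * t)"] by (simp add: norm_mult ln_mult)
  qed
  also have "\<dots> = ln r + log_mean r p"
    using integral_add[OF integrable_const_ivl[of "ln r" 0 1] int] by (simp add: log_mean_def)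
  finally show ?thesis .
qed

text \<open>At \<open>z\<^sup>k\<close> the two operators multiply the coefficient by \<open>k\<close> and by \<open>N - k\<close>, two nonnegative numbers
with sum \<open>N\<close>; so the absolute values add up without loss.\<close>

lemma coeff_sum_derivative_split:
  fixes p :: "complex poly"
  shows "coeff_sum r (pCons 0 (pderiv p)) + coeff_sum r (smult (of_nat (degree p)) p - pCons 0 (pderiv p))
     = degree p * coeff_sum r p"
proof -
  let ?N = "degree p"
  let ?Q = "smult (of_nat ?N) p - pCons 0 (pderiv p)"
  have c1: "coeff (pCons 0 (pderiv p)) k = of_nat k * coeff p k" for k
    by (cases k) (auto simp: coeff_pderiv)
  have c2: "coeff ?Q k = of_nat ?N * coeff p k - of_nat k * coeff p k" for k
    unfolding coeff_diff c1 by simp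
  have d1: "degree (pCons 0 (pderiv p)) \<le> ?N"
    by (rule degree_le) (unfold c1, simp add: coeff_eq_0)
  have d2: "degree ?Q \<le> ?N"
    by (rule degree_le) (unfold c2, simp add: coeff_eq_0)
  have "cmod (coeff (pCons 0 (pderiv p)) k) + cmod (coeff ?Q k) = ?N * cmod (coeff p k)" if "k \<le> ?N" for k
  proof -
    have "coeff ?Q k = of_nat (?N - k) * coeff p k"
      unfolding c2 using that by (simp add: of_nat_diff algebra_simps)
    then have "cmod (coeff ?Q k) = (?N - k) * cmod (coeff p k)" by (simp only: norm_mult norm_of_nat)
    then show ?thesis
      unfolding c1 norm_mult using that by (simp only: norm_of_nat) (simp add: of_nat_diff algebra_simps)
  qed
  then have "(\<Sum>k\<le>?N. cmod (coeff (pCons 0 (pderiv p)) k) * r ^ k + cmod (coeff ?Q k) * r ^ k)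
     = (\<Sum>k\<le>?N. ?N * (cmod (coeff p k) * r ^ k))"
    by (intro sum.cong refl) (simp flip: distrib_right)
  then show ?thesis
    unfolding coeff_sum_eq[OF d1] coeff_sum_eq[OF d2] coeff_sum_def[of r p]
    by (simp add: sum.distrib sum_distrib_left)
qed

abbreviation support_card :: "complex poly \<Rightarrow> nat" where
  "support_card p \<equiv> card {k. coeff p k \<noteq> 0}"

lemma finite_support: "finite {k. coeff (p :: complex poly) k \<noteq> 0}"
  by (rule finite_subset[of _ "{..degree p}"]) (auto intro: le_degree)

text \<open>Induction on the degree. A vanishing constant term is divided out. Otherwise \<open>z p'\<close> loses
the constant term and \<open>N p - z p'\<close> loses the leading one, and by \<open>coeff_sum_derivative_split\<close> one of the
two keeps at least half of \<open>N coeff_sum r p\<close>; dividing \<open>z p'\<close> by \<open>z\<close>, both have smaller degree. The finite set \<open>F\<close>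
collects the moduli of the zeros of all polynomials met on the way.\<close>

lemma log_mean_lower_bound:
  fixes p :: "complex poly"
  assumes "p \<noteq> 0"
  shows "\<exists>F. finite F \<and> (\<forall>r>0. r \<notin> F \<longrightarrow> (\<forall>z. cmod z = 1 \<longrightarrow> poly p (of_real r * z) \<noteq> 0) \<and>
            ln (coeff_sum r p) - support_card p * ln 2 \<le> log_mean r p)"
  using assms
proof (induction "degree p" arbitrary: p rule: less_induct)
  case less
  consider "degree p = 0" | "degree p > 0" "coeff p 0 = 0" | "degree p > 0" "coeff p 0 \<noteq> 0" by auto
  then show ?case
  proof cases
    case 1
    then obtain c where p: "p = [:c:]" by (auto elim: degree_eq_zeroE)
    have "c \<noteq> 0" using less.prems p by auto
    then show ?thesis
      by (intro exI[of _ "{}"]) (auto simp: p coeff_sum_def log_mean_def)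
  next
    case 2
    obtain a p' where p: "p = pCons a p'" by (rule pCons_cases)
    have a: "a = 0" using 2 p by simp
    have p': "p' \<noteq> 0" using less.prems p a by auto
    have "degree p' < degree p" using p p' by simp
    from less.hyps[OF this p'] obtain F where F: "finite F"
      "\<And>r z. r > 0 \<Longrightarrow> r \<notin> F \<Longrightarrow> cmod z = 1 \<Longrightarrow> poly p' (of_real r * z) \<noteq> 0"
      "\<And>r. r > 0 \<Longrightarrow> r \<notin> F \<Longrightarrow> ln (coeff_sum r p') - support_card p' * ln 2 \<le> log_mean r p'"
      by blast
    have "{k. coeff p k \<noteq> 0} = Suc ` {k. coeff p' k \<noteq> 0}"
      by (auto simp: p a coeff_pCons image_iff gr0_conv_Suc split: nat.splits)
    then have card: "support_card p = support_card p'"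
      by (simp add: card_image)
    show ?thesis
    proof (intro exI[of _ F] conjI allI impI)
      fix r :: real assume r: "r > 0" "r \<notin> F"
      show "poly p (of_real r * z) \<noteq> 0" if "cmod z = 1" for z
        using F(2)[OF r that] that r by (auto simp: p a)
      have "ln (coeff_sum r p) = ln r + ln (coeff_sum r p')"
        unfolding p a coeff_sum_pCons_0 using coeff_sum_pos[OF p' r(1)] r by (simp add: ln_mult)
      moreover have "log_mean r p = ln r + log_mean r p'"
        unfolding p a by (rule log_mean_pCons_0) (use r F in auto)
      ultimately show "ln (coeff_sum r p) - support_card p * ln 2 \<le> log_mean r p"
        using F(3)[OF r] card by simp
    qed (rule F)
  next
    case 3
    define N where "N = degree p"
    define Q1 where "Q1 = pderiv p"
    define Q2 where "Q2 = smult (of_nat N) p - pCons 0 (pderiv p)"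
    have N: "N > 0" using 3 N_def by simp
    have c2: "coeff Q2 k = (of_nat N - of_nat k) * coeff p k" for k
      unfolding Q2_def by (cases k) (auto simp: coeff_pderiv algebra_simps)
    have Q1: "Q1 \<noteq> 0" unfolding Q1_def using 3 by (auto simp: pderiv_eq_0_iff)
    have "coeff Q2 0 \<noteq> 0" unfolding c2 using 3 N by simp
    then have Q2: "Q2 \<noteq> 0" by auto
    have d1: "degree Q1 < degree p" unfolding Q1_def degree_pderiv using 3 by simp
    have d2: "degree Q2 < degree p"
    proof (rule degree_lessI)
      show "\<forall>k\<ge>degree p. coeff Q2 k = 0"
        unfolding c2 by (auto simp: N_def coeff_eq_0 le_less)
    qed (use Q2 in auto)
    have "{k. coeff p k \<noteq> 0} - {0} = Suc ` {k. coeff Q1 k \<noteq> 0}"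
    proof -
      have "coeff Q1 k \<noteq> 0 \<longleftrightarrow> coeff p (Suc k) \<noteq> 0" for k
        unfolding Q1_def coeff_pderiv by (simp del: of_nat_Suc)
      then have "{k. coeff p k \<noteq> 0} - {0} = Suc ` {k. coeff p (Suc k) \<noteq> 0}"
        by (auto simp: image_iff) (metis not0_implies_Suc)
      then show ?thesis using \<open>\<And>k. coeff Q1 k \<noteq> 0 \<longleftrightarrow> coeff p (Suc k) \<noteq> 0\<close> by simp
    qed
    then have "support_card Q1 = card ({k. coeff p k \<noteq> 0} - {0})"
      by (simp add: card_image)
    then have card1: "support_card p = Suc (support_card Q1)"
      by (simp only:) (rule card.remove[OF finite_support], use 3 in simp)
    have "{k. coeff Q2 k \<noteq> 0} = {k. coeff p k \<noteq> 0} - {N}"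
      unfolding c2 by auto
    moreover have "coeff p N \<noteq> 0" using less.prems by (simp add: N_def)
    ultimately have card2: "support_card p = Suc (support_card Q2)"
      by (simp only:) (rule card.remove[OF finite_support], simp)
    obtain F1 where F1: "finite F1"
      "\<And>r z. r > 0 \<Longrightarrow> r \<notin> F1 \<Longrightarrow> cmod z = 1 \<Longrightarrow> poly Q1 (of_real r * z) \<noteq> 0"
      "\<And>r. r > 0 \<Longrightarrow> r \<notin> F1 \<Longrightarrow> ln (coeff_sum r Q1) - support_card Q1 * ln 2 \<le> log_mean r Q1"
      using less.hyps[OF d1 Q1] by blast
    obtain F2 where F2: "finite F2"
      "\<And>r z. r > 0 \<Longrightarrow> r \<notin> F2 \<Longrightarrow> cmod z = 1 \<Longrightarrow> poly Q2 (of_real r * z) \<noteq> 0"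
      "\<And>r. r > 0 \<Longrightarrow> r \<notin> F2 \<Longrightarrow> ln (coeff_sum r Q2) - support_card Q2 * ln 2 \<le> log_mean r Q2"
      using less.hyps[OF d2 Q2] by blast
    define F where "F = F1 \<union> F2 \<union> cmod ` {z. poly p z = 0}"
    show ?thesis
    proof (intro exI[of _ F] conjI allI impI)
      show "finite F" unfolding F_def using F1 F2 poly_roots_finite[OF less.prems] by simp
    next
      fix r :: real and z assume r: "r > 0" "r \<notin> F" and z: "cmod z = 1"
      have "cmod (of_real r * z) = r" using r z by (simp add: norm_mult)
      then show "poly p (of_real r * z) \<noteq> 0" using r by (force simp: F_def)
    next
      fix r :: real assume r: "r > 0" "r \<notin> F"
      have nzp: "poly p (of_real r * z) \<noteq> 0" if "cmod z = 1" for z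
      proof -
        have "cmod (of_real r * z) = r" using r that by (simp add: norm_mult)
        then show ?thesis using r by (force simp: F_def)
      qed
      define g where "g = pcompose p [:0, of_real r:]"
      have degg: "degree g = N" using r by (simp add: g_def N_def degree_pcompose)
      have g: "poly g z = poly p (of_real r * z)" for z by (simp add: g_def poly_pcompose mult_ac)
      have g': "z * poly (pderiv g) z = of_real r * z * poly Q1 (of_real r * z)" for z
        by (simp add: g_def pderiv_pcompose poly_pcompose pderiv_pCons Q1_def mult_ac)
      have LQ: "log_mean r q \<le> ln N + log_mean r p"
        if q: "\<And>z. cmod z = 1 \<Longrightarrow> poly q (of_real r * z) \<noteq> 0" and "q = pCons 0 Q1 \<or> q = Q2" for q
      proof -
        have "integral {0..1} (\<lambda>t. ln (cmod (poly q (of_real r * cis (2 * pi * t)))))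
          \<le> ln (degree g) + integral {0..1} (\<lambda>t. ln (cmod (poly g (cis (2 * pi * t)))))"
          by (rule mean_ln_norm_derivative_le)
             (use degg N q nzp that(2) in \<open>auto intro!: continuous_intros simp: g g' Q1_def Q2_def mult_ac\<close>)
        then show ?thesis by (simp add: log_mean_def g degg)
      qed
      have split: "r * coeff_sum r Q1 + coeff_sum r Q2 = N * coeff_sum r p"
        using coeff_sum_derivative_split[of r p]
        unfolding Q1_def Q2_def N_def by (simp add: coeff_sum_pCons_0)
      have lnp: "ln (N * coeff_sum r p / 2) = ln N + ln (coeff_sum r p) - ln 2"
        using N coeff_sum_pos[OF less.prems r(1)] by (simp add: ln_mult ln_div)
      have pos: "N * coeff_sum r p / 2 > 0" using N coeff_sum_pos[OF less.prems r(1)] by simp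
      have nz1: "poly Q1 (of_real r * z) \<noteq> 0" if "cmod z = 1" for z
        using F1(2) r that by (auto simp: F_def)
      have nz2: "poly Q2 (of_real r * z) \<noteq> 0" if "cmod z = 1" for z
        using F2(2) r that by (auto simp: F_def)
      consider "N * coeff_sum r p / 2 \<le> r * coeff_sum r Q1" | "N * coeff_sum r p / 2 \<le> coeff_sum r Q2"
        using split by linarith
      then show "ln (coeff_sum r p) - support_card p * ln 2 \<le> log_mean r p"
      proof cases
        case 1
        have "ln (N * coeff_sum r p / 2) \<le> ln (r * coeff_sum r Q1)"
          by (rule ln_mono) (use 1 pos in linarith)+
        also have "\<dots> = ln r + ln (coeff_sum r Q1)"
          using r coeff_sum_pos[OF Q1 r(1)] by (simp add: ln_mult)
        also have "ln (coeff_sum r Q1) \<le> log_mean r Q1 + support_card Q1 * ln 2"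
          using F1(3)[of r] r by (simp add: F_def)
        finally have "ln (N * coeff_sum r p / 2) \<le> ln r + log_mean r Q1 + support_card Q1 * ln 2" by simp
        moreover have "ln r + log_mean r Q1 \<le> ln N + log_mean r p"
          using LQ[of "pCons 0 Q1"] log_mean_pCons_0[OF r(1), of Q1] nz1 r by fastforce
        ultimately show ?thesis unfolding lnp card1 by (simp add: algebra_simps)
      next
        case 2
        have "ln (N * coeff_sum r p / 2) \<le> ln (coeff_sum r Q2)"
          by (rule ln_mono) (use 2 pos in linarith)+
        also have "ln (coeff_sum r Q2) \<le> log_mean r Q2 + support_card Q2 * ln 2"
          using F2(3)[of r] r by (simp add: F_def)
        finally have "ln (N * coeff_sum r p / 2) \<le> log_mean r Q2 + support_card Q2 * ln 2" by simp
        moreover have "log_mean r Q2 \<le> ln N + log_mean r p"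
          using LQ[of Q2] nz2 by simp
        ultimately show ?thesis unfolding lnp card2 by (simp add: algebra_simps)
      qed
    qed
  qed
qed

section \<open>Turan's inequality on large sets\<close>

lemma borel_measurable_poly_circle [measurable]:
  "(\<lambda>t. poly p (of_real r * cis (2 * pi * t))) \<in> borel_measurable borel"
  "(\<lambda>t. poly p (cis (2 * pi * t))) \<in> borel_measurable borel"
  by (intro borel_measurable_continuous_onI continuous_intros)+

text \<open>The function \<open>f = ln (coeff_sum r p) - ln |p|\<close> is nonnegative with mean at most \<open>k ln 2\<close>, and the set in question
is contained in \<open>{f \<ge> 4 k ln 2}\<close>; this is Markov's inequality.\<close>

lemma measure_small_values_at_radius:
  fixes p :: "complex poly"
  assumes p: "p \<noteq> 0" and r: "r > 0" and nz: "\<And>z. cmod z = 1 \<Longrightarrow> poly p (of_real r * z) \<noteq> 0"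
    and lower: "ln (coeff_sum r p) - support_card p * ln 2 \<le> log_mean r p"
  shows "emeasure lborel {t\<in>{0..1}. cmod (poly p (of_real r * cis (2 * pi * t))) < coeff_sum r p / 16 ^ support_card p}
     \<le> ennreal (1 / 4)"
proof -
  let ?P = "\<lambda>t. poly p (of_real r * cis (2 * pi * t))"
  let ?k = "support_card p"
  define f where "f = (\<lambda>t. ln (coeff_sum r p) - ln (cmod (?P t)))"
  define S where "S = {t\<in>{0..1}. cmod (?P t) < coeff_sum r p / 16 ^ ?k}"
  have k: "?k > 0"
    using p by (auto simp: card_gt_0_iff finite_support intro!: exI[of _ "degree p"])
  have cs: "coeff_sum r p > 0" by (rule coeff_sum_pos[OF p r])
  have S: "S \<in> sets lborel" unfolding S_def by measurable
  have le_cs: "cmod (?P t) \<le> coeff_sum r p" for t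
    unfolding poly_altdef coeff_sum_def
    by (rule order.trans[OF norm_sum]) (use r in \<open>simp add: norm_mult norm_power\<close>)
  have f0: "f t \<ge> 0" for t
    unfolding f_def using le_cs[of t] nz[of "cis (2 * pi * t)"] by (simp add: ln_mono)
  have int_ln: "(\<lambda>t. ln (cmod (?P t))) integrable_on {0..1}"
    by (intro integrable_continuous_real continuous_intros) (use nz in auto)
  have "(f has_integral (ln (coeff_sum r p) - log_mean r p)) {0..1}"
    unfolding f_def log_mean_def
    using has_integral_const_real[of "ln (coeff_sum r p)" 0 1]
    by (intro has_integral_diff integrable_integral int_ln) auto
  then have I: "(\<integral>\<^sup>+ t. ennreal (f t) * indicator {0..1} t \<partial>lborel) = ennreal (ln (coeff_sum r p) - log_mean r p)"
    by (rule nn_integral_has_integral_lebesgue'[rotated]) (rule f0)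
  have "ennreal (4 * ?k * ln 2) * emeasure lborel S = (\<integral>\<^sup>+ t. ennreal (4 * ?k * ln 2) * indicator S t \<partial>lborel)"
    using S by (simp add: nn_integral_cmult_indicator)
  also have "\<dots> \<le> (\<integral>\<^sup>+ t. ennreal (f t) * indicator {0..1} t \<partial>lborel)"
  proof (rule nn_integral_mono)
    fix t
    have "4 * ?k * ln 2 \<le> f t" if "t \<in> S"
    proof -
      have "ln (cmod (?P t)) \<le> ln (coeff_sum r p / 16 ^ ?k)"
        using that nz[of "cis (2 * pi * t)"] cs unfolding S_def by (intro ln_mono) auto
      also have "\<dots> = ln (coeff_sum r p) - ?k * ln (2 ^ 4)"
        using cs by (simp add: ln_div ln_realpow)
      finally show ?thesis unfolding f_def by (subst (asm) ln_realpow) auto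
    qed
    then show "ennreal (4 * ?k * ln 2) * indicator S t \<le> ennreal (f t) * indicator {0..1} t"
      by (cases "t \<in> S") (auto simp: S_def intro: ennreal_leI)
  qed
  also have "\<dots> \<le> ennreal (?k * ln 2)"
    unfolding I by (rule ennreal_leI) (use lower in linarith)
  finally have *: "ennreal (4 * ?k * ln 2) * emeasure lborel S \<le> ennreal (?k * ln 2)" .
  have "ennreal (4 * ?k * ln 2) * (emeasure lborel S) \<le> ennreal (4 * ?k * ln 2) * ennreal (1 / 4)"
    using * by (simp flip: ennreal_mult')
  moreover have "ennreal (4 * ?k * ln 2) \<noteq> 0" using k by (simp add: ennreal_eq_0_iff not_le)
  ultimately show ?thesis
    unfolding S_def[symmetric] by (subst (asm) ennreal_mult_le_mult_iff) auto
qed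

text \<open>The unit circle may contain zeros of \<open>p\<close>, so it is approached through good radii \<open>r > 1\<close>. The sets are
defined by a strict inequality that is continuous in \<open>r\<close>, and Fatou's lemma for their indicators
preserves the bound.\<close>

lemma measure_small_values:
  fixes p :: "complex poly"
  assumes p: "p \<noteq> 0"
  shows "emeasure lborel {t\<in>{0..1}. cmod (poly p (cis (2 * pi * t))) < coeff_sum 1 p / 16 ^ support_card p}
     \<le> ennreal (1 / 4)"
proof -
  define S where "S = (\<lambda>r. {t\<in>{0..1}. cmod (poly p (of_real r * cis (2 * pi * t))) < coeff_sum r p / 16 ^ support_card p})"
  have S: "S r \<in> sets lborel" for r unfolding S_def by measurable
  obtain F where F: "finite F" "\<And>r. r > 0 \<Longrightarrow> r \<notin> F \<Longrightarrow> emeasure lborel (S r) \<le> ennreal (1 / 4)"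
    using log_mean_lower_bound[OF p] measure_small_values_at_radius[OF p] unfolding S_def by blast
  define X where "X = (\<lambda>n. 1 + inverse (real (Suc n)))"
  have X1: "X \<longlonglongrightarrow> 1"
    unfolding X_def using tendsto_add[OF tendsto_const[of "1::real"] LIMSEQ_inverse_real_of_nat] by simp
  have X: "filterlim X (at_right 1) sequentially"
    using X1 by (intro tendsto_imp_filterlim_at_right) (auto simp: X_def)
  have "\<forall>\<^sub>F r in at_right 1. \<forall>y\<in>F. r \<noteq> y"
    using F(1) by (intro eventually_ball_finite ballI eventually_neq_at_within)
  then have "\<forall>\<^sub>F n in sequentially. \<forall>y\<in>F. X n \<noteq> y"
    by (rule eventually_compose_filterlim[OF _ X])
  then have ev: "\<forall>\<^sub>F n in sequentially. emeasure lborel (S (X n)) \<le> ennreal (1 / 4)"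
    by eventually_elim (rule F(2), auto simp: X_def add_pos_pos)
  have ptw: "\<forall>\<^sub>F n in sequentially. t \<in> S (X n)" if t: "t \<in> S 1" for t
  proof -
    have "(\<lambda>n. coeff_sum (X n) p / 16 ^ support_card p - cmod (poly p (of_real (X n) * cis (2 * pi * t))))
      \<longlonglongrightarrow> coeff_sum 1 p / 16 ^ support_card p - cmod (poly p (of_real 1 * cis (2 * pi * t)))"
      unfolding coeff_sum_def poly_altdef by (intro tendsto_intros X1) auto
    moreover have "0 < coeff_sum 1 p / 16 ^ support_card p - cmod (poly p (of_real 1 * cis (2 * pi * t)))"
      using t by (simp add: S_def)
    ultimately have "\<forall>\<^sub>F n in sequentially. 0 < coeff_sum (X n) p / 16 ^ support_card p - cmod (poly p (of_real (X n) * cis (2 * pi * t)))"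
      by (rule order_tendstoD)
    then show ?thesis by eventually_elim (use t in \<open>auto simp: S_def\<close>)
  qed
  have "emeasure lborel (S 1) = (\<integral>\<^sup>+ t. indicator (S 1) t \<partial>lborel)"
    using S by simp
  also have "\<dots> \<le> (\<integral>\<^sup>+ t. liminf (\<lambda>n. indicator (S (X n)) t) \<partial>lborel)"
  proof (rule nn_integral_mono)
    fix t
    show "(indicator (S 1) t :: ennreal) \<le> liminf (\<lambda>n. indicator (S (X n)) t)"
    proof (cases "t \<in> S 1")
      case True
      then show ?thesis
        by (intro Liminf_bounded) (use ptw[OF True] in \<open>auto elim: eventually_mono\<close>)
    qed auto
  qed
  also have "\<dots> \<le> liminf (\<lambda>n. \<integral>\<^sup>+ t. indicator (S (X n)) t \<partial>lborel)"
    by (rule nn_integral_liminf) (use S in measurable)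
  also have "\<dots> = liminf (\<lambda>n. emeasure lborel (S (X n)))" using S by simp
  also have "\<dots> \<le> liminf (\<lambda>n. ennreal (1 / 4))" by (rule Liminf_mono) (rule ev)
  also have "\<dots> = ennreal (1 / 4)" by (simp add: Liminf_const)
  finally show ?thesis by (simp add: S_def)
qed

lemma coeff_sum_square_le_integral:
  fixes p :: "complex poly"
  assumes p: "p \<noteq> 0" and E: "E \<in> sets borel" "E \<subseteq> {0..1}" "ennreal (1 / 2) \<le> emeasure lborel E"
  shows "ennreal ((coeff_sum 1 p)\<^sup>2) \<le> ennreal (4 * 256 ^ support_card p) *
     (\<integral>\<^sup>+ t\<in>E. ennreal ((cmod (poly p (cis (2 * pi * t))))\<^sup>2) \<partial>lborel)"
proof -
  let ?k = "support_card p"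
  define S where "S = {t\<in>{0..1}. cmod (poly p (cis (2 * pi * t))) < coeff_sum 1 p / 16 ^ ?k}"
  have S: "S \<in> sets lborel" unfolding S_def by measurable
  have cs: "coeff_sum 1 p > 0" by (rule coeff_sum_pos[OF p]) simp
  have "ennreal (1 / 4) + ennreal (1 / 4) = ennreal (1 / 2)" by (simp flip: ennreal_plus)
  also have "\<dots> \<le> emeasure lborel ((E - S) \<union> S)"
    by (rule order.trans[OF E(3) emeasure_mono]) (use E S in auto)
  also have "\<dots> \<le> emeasure lborel (E - S) + emeasure lborel S"
    by (rule emeasure_subadditive) (use E S in auto)
  also have "emeasure lborel S \<le> ennreal (1 / 4)"
    unfolding S_def by (rule measure_small_values[OF p])
  finally have *: "ennreal (1 / 4) \<le> emeasure lborel (E - S)"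
    by (simp add: ennreal_add_left_cancel_le add.commute)
  have "ennreal ((coeff_sum 1 p)\<^sup>2) = ennreal (4 * 256 ^ ?k) * (ennreal ((coeff_sum 1 p / 16 ^ ?k)\<^sup>2) * ennreal (1 / 4))"
    using cs by (simp flip: ennreal_mult add: power_divide power2_eq_square power_mult_distrib[symmetric])
  also have "\<dots> \<le> ennreal (4 * 256 ^ ?k) * (ennreal ((coeff_sum 1 p / 16 ^ ?k)\<^sup>2) * emeasure lborel (E - S))"
    by (intro mult_left_mono *) auto
  also have "ennreal ((coeff_sum 1 p / 16 ^ ?k)\<^sup>2) * emeasure lborel (E - S)
     = (\<integral>\<^sup>+ t. ennreal ((coeff_sum 1 p / 16 ^ ?k)\<^sup>2) * indicator (E - S) t \<partial>lborel)"
    by (subst nn_integral_cmult_indicator) (use E S in auto)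
  also have "\<dots> \<le> (\<integral>\<^sup>+ t\<in>E. ennreal ((cmod (poly p (cis (2 * pi * t))))\<^sup>2) \<partial>lborel)"
  proof (rule nn_integral_mono)
    fix t
    have "(coeff_sum 1 p / 16 ^ ?k)\<^sup>2 \<le> (cmod (poly p (cis (2 * pi * t))))\<^sup>2" if "t \<in> E - S"
      by (rule power_mono) (use that E(2) cs in \<open>auto simp: S_def not_less\<close>)
    then show "ennreal ((coeff_sum 1 p / 16 ^ ?k)\<^sup>2) * indicator (E - S) t
       \<le> ennreal ((cmod (poly p (cis (2 * pi * t))))\<^sup>2) * indicator E t"
      by (auto simp: indicator_def intro: ennreal_leI)
  qed
  finally show ?thesis by (simp add: mult_left_mono)
qed

text \<open>Multiplying by a monomial turns the trigonometric sum into a polynomial with at most \<open>card S\<close> terms without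
changing moduli on the circle. The exponential dependence on the number of frequencies, independent of their
position, is what makes the exponent of the uncertainty principle linear in \<open>|T||U|\<close>.\<close>

theorem turan_large_set:
  fixes c :: "int \<Rightarrow> complex"
  assumes S: "finite S" "m \<in> S"
    and E: "E \<in> sets borel" "E \<subseteq> {0..1}" "ennreal (1 / 2) \<le> emeasure lborel E"
  shows "ennreal ((cmod (c m))\<^sup>2) \<le> ennreal (4 * 256 ^ card S) *
     (\<integral>\<^sup>+ t\<in>E. ennreal ((cmod (\<Sum>j\<in>S. c j * cis (2 * pi * (of_int j * t))))\<^sup>2) \<partial>lborel)"
proof -
  define M where "M = Min S"
  have M: "M \<le> j" if "j \<in> S" for j unfolding M_def by (rule Min_le) (use S that in auto)
  define idx where "idx = (\<lambda>j. nat (j - M))"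
  have inj: "idx i = idx j \<longleftrightarrow> i = j" if "i \<in> S" "j \<in> S" for i j
    unfolding idx_def using M[OF that(1)] M[OF that(2)] by auto
  define p where "p = (\<Sum>j\<in>S. monom (c j) (idx j))"
  have cp: "coeff p (idx j) = c j" if "j \<in> S" for j
    unfolding p_def coeff_sum coeff_monom using that S inj by (simp add: sum.delta cong: sum.cong)
  have cp0: "coeff p k = 0" if "k \<notin> idx ` S" for k
    unfolding p_def coeff_sum coeff_monom using that by (intro sum.neutral) auto
  have poly: "cmod (poly p (cis (2 * pi * t))) = cmod (\<Sum>j\<in>S. c j * cis (2 * pi * (of_int j * t)))" for t
  proof -
    have "(\<Sum>j\<in>S. c j * cis (2 * pi * (of_int j * t))) = (\<Sum>j\<in>S. cis (2 * pi * (of_int M * t)) * (c j * cis (2 * pi * t) ^ idx j))"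
    proof (rule sum.cong)
      fix j assume "j \<in> S"
      have "cis (2 * pi * t) ^ idx j = cis (real (idx j) * (2 * pi * t))" by (rule Complex.DeMoivre)
      moreover have "real (idx j) = of_int j - of_int M"
        using M[OF \<open>j \<in> S\<close>] by (simp add: idx_def)
      ultimately show "c j * cis (2 * pi * (of_int j * t)) = cis (2 * pi * (of_int M * t)) * (c j * cis (2 * pi * t) ^ idx j)"
        by (simp add: cis_mult algebra_simps)
    qed simp
    also have "\<dots> = cis (2 * pi * (of_int M * t)) * poly p (cis (2 * pi * t))"
      by (simp add: p_def poly_sum poly_monom sum_distrib_left)
    finally show ?thesis by (simp add: norm_mult)
  qed
  have "ennreal ((cmod (c m))\<^sup>2) \<le> ennreal (4 * 256 ^ support_card p) *
     (\<integral>\<^sup>+ t\<in>E. ennreal ((cmod (poly p (cis (2 * pi * t))))\<^sup>2) \<partial>lborel)"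
  proof (cases "p = 0")
    case True
    then have "c m = 0" using cp[OF S(2)] by simp
    then show ?thesis by simp
  next
    case False
    have "cmod (c m) \<le> coeff_sum 1 p"
    proof (cases "idx m \<le> degree p")
      case True
      then show ?thesis
        using member_le_sum[of "idx m" "{..degree p}" "\<lambda>k. cmod (coeff p k)"] cp[OF S(2)] by (simp add: coeff_sum_def)
    next
      case False
      then have "c m = 0" using cp[OF S(2)] by (simp add: coeff_eq_0)
      then show ?thesis using coeff_sum_pos[OF \<open>p \<noteq> 0\<close>, of 1] by simp
    qed
    then have "ennreal ((cmod (c m))\<^sup>2) \<le> ennreal ((coeff_sum 1 p)\<^sup>2)"
      by (intro ennreal_leI power_mono) auto
    also note coeff_sum_square_le_integral[OF False E]
    finally show ?thesis .
  qed
  also have "\<dots> \<le> ennreal (4 * 256 ^ card S) *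
     (\<integral>\<^sup>+ t\<in>E. ennreal ((cmod (poly p (cis (2 * pi * t))))\<^sup>2) \<partial>lborel)"
  proof (intro mult_right_mono ennreal_leI mult_left_mono power_increasing)
    have "{k. coeff p k \<noteq> 0} \<subseteq> idx ` S" using cp0 by blast
    then show "support_card p \<le> card S" using S by (meson card_image_le card_mono finite_imageI le_trans)
  qed auto
  finally show ?thesis by (simp only: poly)
qed

section \<open>Parseval's identity on the unit interval\<close>

abbreviation unit_interval :: "real measure" where
  "unit_interval \<equiv> restrict_space lborel {0..1}"

definition trig_sum :: "int set \<Rightarrow> (int \<Rightarrow> complex) \<Rightarrow> real \<Rightarrow> complex" where
  "trig_sum S c t = (\<Sum>m\<in>S. c m * cis (2 * pi * (of_int m * t)))"

definition fourier_coeff :: "(real \<Rightarrow> complex) \<Rightarrow> int \<Rightarrow> complex" where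
  "fourier_coeff f m = (LINT t|unit_interval. f t * cis (- (2 * pi * (of_int m * t))))"

lemma cmod_add_square_le: "(cmod (x + y))\<^sup>2 \<le> 2 * (cmod x)\<^sup>2 + 2 * (cmod y)\<^sup>2"
proof -
  have "(cmod (x + y))\<^sup>2 \<le> (cmod x + cmod y)\<^sup>2" by (intro power_mono norm_triangle_ineq) auto
  also have "\<dots> \<le> 2 * (cmod x)\<^sup>2 + 2 * (cmod y)\<^sup>2"
    using zero_le_power2[of "cmod x - cmod y"] by (simp add: power2_eq_square algebra_simps)
  finally show ?thesis .
qed

lemma cmod_diff_square:
  "(cmod (x - y))\<^sup>2 = (cmod x)\<^sup>2 - 2 * Re (x * cnj y) + Re (y * cnj y)"
  by (simp only: cmod_power2) (simp add: power2_eq_square algebra_simps)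

lemma borel_measurable_cis [measurable (raw)]:
  "f \<in> borel_measurable M \<Longrightarrow> (\<lambda>x. cis (f x)) \<in> borel_measurable M"
  by (rule borel_measurable_continuous_on[of cis]) (auto intro: continuous_intros)

lemma borel_measurable_cnj [measurable (raw)]:
  "f \<in> borel_measurable M \<Longrightarrow> (\<lambda>x. cnj (f x)) \<in> borel_measurable M"
  by (rule borel_measurable_continuous_on[of cnj]) (auto intro: continuous_intros)

lemma borel_measurable_trig_sum [measurable]: "trig_sum S c \<in> borel_measurable borel"
  unfolding trig_sum_def by measurable

inductive trig_poly :: "(real \<Rightarrow> complex) \<Rightarrow> bool" where
  mono: "trig_poly (\<lambda>t. c * cis (2 * pi * (of_int m * t)))"
| add: "trig_poly f \<Longrightarrow> trig_poly g \<Longrightarrow> trig_poly (\<lambda>t. f t + g t)"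

lemma trig_poly_imp_trig_sum: "trig_poly f \<Longrightarrow> \<exists>S c. finite S \<and> f = trig_sum S c"
proof (induction rule: trig_poly.induct)
  case (mono c m)
  show ?case by (rule exI[of _ "{m}"], rule exI[of _ "\<lambda>_. c"]) (auto simp: trig_sum_def)
next
  case (add f g)
  then obtain S c S' c' where *: "finite S" "f = trig_sum S c" "finite S'" "g = trig_sum S' c'" by auto
  define d where "d = (\<lambda>m. (if m \<in> S then c m else 0) + (if m \<in> S' then c' m else 0))"
  have "trig_sum S c t + trig_sum S' c' t = trig_sum (S \<union> S') d t" for t
  proof -
    have "trig_sum S c t = (\<Sum>m\<in>S \<union> S'. (if m \<in> S then c m else 0) * cis (2 * pi * (of_int m * t)))"
      unfolding trig_sum_def by (intro sum.mono_neutral_cong_left) (use * in auto)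
    moreover have "trig_sum S' c' t = (\<Sum>m\<in>S \<union> S'. (if m \<in> S' then c' m else 0) * cis (2 * pi * (of_int m * t)))"
      unfolding trig_sum_def by (intro sum.mono_neutral_cong_left) (use * in auto)
    ultimately show ?thesis
      unfolding d_def trig_sum_def[of "S \<union> S'"] by (simp only: sum.distrib[symmetric] distrib_right)
  qed
  then show ?case using * by (intro exI[of _ "S \<union> S'"] exI[of _ d]) auto
qed

lemma trig_poly_const: "trig_poly (\<lambda>t. c)"
  using trig_poly.mono[of c 0] by simp

lemma trig_poly_mult_mono: "trig_poly g \<Longrightarrow> trig_poly (\<lambda>t. c * cis (2 * pi * (of_int m * t)) * g t)"
proof (induction rule: trig_poly.induct)
  case (mono d n)
  have "(\<lambda>t. c * cis (2 * pi * (of_int m * t)) * (d * cis (2 * pi * (of_int n * t))))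
     = (\<lambda>t. (c * d) * cis (2 * pi * (of_int (m + n) * t)))"
  proof
    fix t
    show "c * cis (2 * pi * (of_int m * t)) * (d * cis (2 * pi * (of_int n * t)))
       = (c * d) * cis (2 * pi * (of_int (m + n) * t))"
      using cis_mult[of "2 * pi * (of_int m * t)" "2 * pi * (of_int n * t)"]
      by (simp add: algebra_simps)
  qed
  then show ?case using trig_poly.mono[of "c * d" "m + n"] by simp
next
  case (add f g)
  then show ?case using trig_poly.add[OF add.IH] by (simp add: algebra_simps)
qed

lemma trig_poly_mult: "trig_poly f \<Longrightarrow> trig_poly g \<Longrightarrow> trig_poly (\<lambda>t. f t * g t)"
proof (induction rule: trig_poly.induct)
  case (mono c m)
  then show ?case by (rule trig_poly_mult_mono)
next
  case (add f f')
  then have "trig_poly (\<lambda>t. f t * g t + f' t * g t)" by (intro trig_poly.add) auto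
  then show ?case by (simp add: algebra_simps)
qed

lemma trig_poly_real_polynomial:
  fixes p :: "complex \<Rightarrow> real"
  assumes "real_polynomial_function p"
  shows "trig_poly (\<lambda>t. of_real (p (cis (2 * pi * t))))"
  using assms
proof (induction rule: real_polynomial_function.induct)
  case (linear p)
  then interpret bounded_linear p .
  define a where "a = complex_of_real (p 1)"
  define b where "b = complex_of_real (p \<i>)"
  have p: "p z = Re z * p 1 + Im z * p \<i>" for z
  proof -
    have "z = Re z *\<^sub>R 1 + Im z *\<^sub>R \<i>" by (simp add: complex_eq_iff)
    then have "p z = p (Re z *\<^sub>R 1 + Im z *\<^sub>R \<i>)" by simp
    then show ?thesis by (simp add: add scaleR)
  qed
  have "(\<lambda>t. of_real (p (cis (2 * pi * t)))) = (\<lambda>t. (a / 2 + b / (2 * \<i>)) * cis (2 * pi * (of_int 1 * t))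
     + (a / 2 - b / (2 * \<i>)) * cis (2 * pi * (of_int (-1) * t)))"
    by (rule ext, subst p) (simp add: a_def b_def complex_eq_iff algebra_simps Re_divide Im_divide)
  then show ?case by (simp only:) (intro trig_poly.add trig_poly.mono)
next
  case (const c)
  show ?case by (rule trig_poly_const)
next
  case (add f g)
  then show ?case using trig_poly.add[OF add.IH] by simp
next
  case (mult f g)
  then show ?case using trig_poly_mult[OF mult.IH] by simp
qed

text \<open>Transported to the circle, \<open>v\<close> becomes a continuous function of \<open>Arg2pi z\<close>: continuity at 1 comes from
\<open>v 0 = v 1\<close> and is obtained by regarding \<open>v\<close> as a loop homotopic to itself. The Stone-Weierstrass
theorem then provides a polynomial in the real and imaginary part of \<open>z = cis (2 * pi * t)\<close>.\<close>

lemma trig_sum_uniform_approx: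
  fixes v :: "real \<Rightarrow> complex"
  assumes v: "continuous_on {0..1} v" "v 0 = v 1" and e: "e > 0"
  obtains S c where "finite S" "\<And>t. t \<in> {0..1} \<Longrightarrow> cmod (v t - trig_sum S c t) < e"
proof -
  have "homotopic_loops UNIV v v"
    unfolding homotopic_loops_refl using v by (auto simp: path_def pathfinish_def pathstart_def)
  from homotopic_with_imp_continuous[OF homotopic_loops_imp_homotopic_circlemaps[OF this]]
  have cont: "continuous_on (sphere 0 1) (v \<circ> (\<lambda>z. Arg2pi z / (2 * pi)))" by (rule conjunct1)
  from Stone_Weierstrass_polynomial_function[OF compact_sphere cont e] obtain g where g: "polynomial_function g"
    "\<And>z. z \<in> sphere (0::complex) 1 \<Longrightarrow> cmod ((v \<circ> (\<lambda>z. Arg2pi z / (2 * pi))) z - g z) < e"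
    by (elim exE conjE) (rule that, auto)
  have "real_polynomial_function (Re \<circ> g)" "real_polynomial_function (Im \<circ> g)"
    using g(1) bounded_linear_Re bounded_linear_Im by (auto simp: polynomial_function_def)
  then have "trig_poly (\<lambda>t. of_real ((Re \<circ> g) (cis (2 * pi * t))) + \<i> * of_real ((Im \<circ> g) (cis (2 * pi * t))))"
    by (intro trig_poly.add trig_poly_mult trig_poly_const trig_poly_real_polynomial)
  moreover have "(\<lambda>t. of_real ((Re \<circ> g) (cis (2 * pi * t))) + \<i> * of_real ((Im \<circ> g) (cis (2 * pi * t))))
      = (\<lambda>t. g (cis (2 * pi * t)))"
    by (rule ext) (simp add: complex_eq_iff)
  ultimately have "trig_poly (\<lambda>t. g (cis (2 * pi * t)))" by metis
  then obtain S c where Sc: "finite S" "(\<lambda>t. g (cis (2 * pi * t))) = trig_sum S c"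
    using trig_poly_imp_trig_sum by blast
  have "cmod (v t - trig_sum S c t) < e" if t: "t \<in> {0..1}" for t
  proof -
    have "v (Arg2pi (cis (2 * pi * t)) / (2 * pi)) = v t"
    proof (cases "t = 1")
      case True
      then show ?thesis using v(2) Arg2pi_of_real[of 1] by (simp add: cis_2pi)
    next
      case False
      then have "2 * pi * t < 2 * pi" using t by simp
      then have "Arg2pi (cis (2 * pi * t)) = 2 * pi * t"
        using t by (intro Arg2pi_unique[of 1]) (auto simp: cis_conv_exp)
      then show ?thesis by simp
    qed
    then show ?thesis
      using g(2)[of "cis (2 * pi * t)"] fun_cong[OF Sc(2), of t] by simp
  qed
  then show thesis using that Sc(1) by blast
qed

definition trig_approximable :: "(real \<Rightarrow> complex) \<Rightarrow> bool" where
  "trig_approximable f \<longleftrightarrow> (\<forall>e>0. \<exists>S c. finite S \<and>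
     (\<integral>\<^sup>+ t. ennreal ((cmod (f t - trig_sum S c t))\<^sup>2) \<partial>unit_interval) \<le> ennreal e)"

lemma emeasure_unit_interval: "emeasure unit_interval (space unit_interval) = 1"
  by (simp add: emeasure_restrict_space space_restrict_space)

lemma finite_measure_unit_interval: "finite_measure unit_interval"
  by (rule finite_measureI) (simp only: emeasure_unit_interval, simp)

lemma borel_measurable_unit_interval: "f \<in> borel_measurable borel \<Longrightarrow> f \<in> borel_measurable unit_interval"
  by (rule measurable_restrict_space1) simp

lemma trig_approximable_limit:
  assumes [measurable]: "f \<in> borel_measurable borel" "\<And>n. g n \<in> borel_measurable borel"
    and g: "\<And>n. trig_approximable (g n)"
    and lim: "(\<lambda>n. \<integral>\<^sup>+ t. ennreal ((cmod (f t - g n t))\<^sup>2) \<partial>unit_interval) \<longlonglongrightarrow> 0"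
  shows "trig_approximable f"
  unfolding trig_approximable_def
proof (intro allI impI)
  fix e :: real assume e: "e > 0"
  then have "\<forall>\<^sub>F n in sequentially. (\<integral>\<^sup>+ t. ennreal ((cmod (f t - g n t))\<^sup>2) \<partial>unit_interval) < ennreal (e / 4)"
    by (intro order_tendstoD[OF lim]) simp
  then obtain n where n: "(\<integral>\<^sup>+ t. ennreal ((cmod (f t - g n t))\<^sup>2) \<partial>unit_interval) < ennreal (e / 4)"
    by (auto simp: eventually_sequentially)
  obtain S c where Sc: "finite S" "(\<integral>\<^sup>+ t. ennreal ((cmod (g n t - trig_sum S c t))\<^sup>2) \<partial>unit_interval) \<le> ennreal (e / 4)"
    using g[of n] e unfolding trig_approximable_def by (meson divide_pos_pos zero_less_numeral)
  have "(\<integral>\<^sup>+ t. ennreal ((cmod (f t - trig_sum S c t))\<^sup>2) \<partial>unit_interval)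
    \<le> (\<integral>\<^sup>+ t. 2 * ennreal ((cmod (f t - g n t))\<^sup>2) + 2 * ennreal ((cmod (g n t - trig_sum S c t))\<^sup>2) \<partial>unit_interval)"
  proof (rule nn_integral_mono)
    fix t
    have "ennreal ((cmod (f t - trig_sum S c t))\<^sup>2) \<le> ennreal (2 * (cmod (f t - g n t))\<^sup>2 + 2 * (cmod (g n t - trig_sum S c t))\<^sup>2)"
      using cmod_add_square_le[of "f t - g n t" "g n t - trig_sum S c t"] by (intro ennreal_leI) simp
    also have "\<dots> = 2 * ennreal ((cmod (f t - g n t))\<^sup>2) + 2 * ennreal ((cmod (g n t - trig_sum S c t))\<^sup>2)"
      by (simp add: ennreal_mult)
    finally show "ennreal ((cmod (f t - trig_sum S c t))\<^sup>2)
      \<le> 2 * ennreal ((cmod (f t - g n t))\<^sup>2) + 2 * ennreal ((cmod (g n t - trig_sum S c t))\<^sup>2)" .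
  qed
  also have "\<dots> = 2 * (\<integral>\<^sup>+ t. ennreal ((cmod (f t - g n t))\<^sup>2) \<partial>unit_interval)
     + 2 * (\<integral>\<^sup>+ t. ennreal ((cmod (g n t - trig_sum S c t))\<^sup>2) \<partial>unit_interval)"
  proof -
    have m: "(\<lambda>t. ennreal ((cmod (f t - g n t))\<^sup>2)) \<in> borel_measurable unit_interval"
      "(\<lambda>t. ennreal ((cmod (g n t - trig_sum S c t))\<^sup>2)) \<in> borel_measurable unit_interval"
      by (auto intro!: borel_measurable_unit_interval)
    show ?thesis using m by (simp add: nn_integral_add nn_integral_cmult)
  qed
  also have "\<dots> \<le> 2 * ennreal (e / 4) + 2 * ennreal (e / 4)"
    by (intro add_mono mult_left_mono less_imp_le[OF n] Sc) auto
  also have "\<dots> = ennreal e"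
  proof -
    have "2 * ennreal (e / 4) = ennreal (e / 2)"
      using e ennreal_mult[of 2 "e / 4"] by simp
    then show ?thesis using e by (simp flip: ennreal_plus)
  qed
  finally show "\<exists>S c. finite S \<and> (\<integral>\<^sup>+ t. ennreal ((cmod (f t - trig_sum S c t))\<^sup>2) \<partial>unit_interval) \<le> ennreal e"
    using Sc(1) by blast
qed

lemma trig_approximable_continuous:
  assumes v: "continuous_on UNIV v" "v 0 = v 1"
  shows "trig_approximable v"
  unfolding trig_approximable_def
proof (intro allI impI)
  fix e :: real assume e: "e > 0"
  obtain S c where Sc: "finite S" "\<And>t. t \<in> {0..1} \<Longrightarrow> cmod (v t - trig_sum S c t) < sqrt e"
    using trig_sum_uniform_approx[OF continuous_on_subset[OF v(1)] v(2), of "sqrt e"] e by auto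
  have "(\<integral>\<^sup>+ t. ennreal ((cmod (v t - trig_sum S c t))\<^sup>2) \<partial>unit_interval) \<le> (\<integral>\<^sup>+ t. ennreal e \<partial>unit_interval)"
  proof (rule nn_integral_mono)
    fix t assume "t \<in> space unit_interval"
    then have "(cmod (v t - trig_sum S c t))\<^sup>2 \<le> (sqrt e)\<^sup>2"
      by (intro power_mono less_imp_le[OF Sc(2)]) (auto simp: space_restrict_space)
    then show "ennreal ((cmod (v t - trig_sum S c t))\<^sup>2) \<le> ennreal e" using e by (simp add: ennreal_leI)
  qed
  also have "\<dots> = ennreal e" using emeasure_unit_interval by simp
  finally show "\<exists>S c. finite S \<and> (\<integral>\<^sup>+ t. ennreal ((cmod (v t - trig_sum S c t))\<^sup>2) \<partial>unit_interval) \<le> ennreal e"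
    using Sc(1) by blast
qed

text \<open>A measurable function is almost everywhere a limit of continuous functions \<open>g n\<close>. Radially clipping them
to a disc that contains the range of \<open>u\<close> permits dominated convergence, and multiplying them by
a cut-off makes both end values equal to 0, as periodicity demands; neither changes the limit in the open interval.\<close>

lemma trig_approximable_bounded:
  assumes u [measurable]: "u \<in> borel_measurable borel" and B: "\<And>t. cmod (u t) \<le> B"
  shows "trig_approximable u"
proof -
  have "u \<in> borel_measurable lebesgue" by (rule measurable_completion) (simp add: u)
  then have "u measurable_on UNIV"
    by (intro lebesgue_measurable_imp_measurable_on) auto
  then obtain N g where N: "negligible N" and g: "\<And>n. continuous_on UNIV (g n)"
    "\<And>t. t \<notin> N \<Longrightarrow> (\<lambda>n. g n t) \<longlonglongrightarrow> u t"
    by (auto simp: measurable_on_def)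
  define B1 where "B1 = max B 1"
  have B1: "B1 > 0" "\<And>t. cmod (u t) \<le> B1"
    using B unfolding B1_def by (auto simp: le_max_iff_disj)
  define clip where "clip = (\<lambda>z::complex. z /\<^sub>R max 1 (cmod z / B1))"
  have clip_le: "cmod (clip z) \<le> B1" for z
  proof -
    have "cmod z \<le> B1 * max 1 (cmod z / B1)"
      using B1(1) by (simp add: max_def field_simps)
    then show ?thesis unfolding clip_def by (simp add: field_simps max_def split: if_splits)
  qed
  have clip_id: "clip z = z" if "cmod z \<le> B1" for z
    using that B1(1) by (simp add: clip_def max_def field_simps)
  have clip_cont: "continuous_on UNIV clip" unfolding clip_def
    by (intro continuous_intros) (use B1(1) in \<open>auto simp: max_def\<close>)
  define cut where "cut = (\<lambda>n t. max 0 (min 1 (real n * min t (1 - t))))"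
  have cut_cont: "continuous_on UNIV (cut n)" for n unfolding cut_def by (intro continuous_intros)
  have cut01: "cut n 0 = 0" "cut n 1 = 0" "0 \<le> cut n t" "cut n t \<le> 1" for n t by (auto simp: cut_def)
  have cut_lim: "(\<lambda>n. cut n t) \<longlonglongrightarrow> 1" if "0 < t" "t < 1" for t
  proof -
    define d where "d = min t (1 - t)"
    have d: "d > 0" using that by (simp add: d_def)
    have "\<forall>\<^sub>F n in sequentially. cut n t = 1"
      unfolding eventually_sequentially
    proof (intro exI[of _ "nat \<lceil>1 / d\<rceil>"] allI impI)
      fix n assume "nat \<lceil>1 / d\<rceil> \<le> n"
      then have "1 / d \<le> real n" by linarith
      then have "1 \<le> real n * d" using d by (simp add: field_simps)
      then show "cut n t = 1" by (simp add: cut_def d_def)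
    qed
    then show ?thesis by (rule tendsto_eventually)
  qed
  define v where "v = (\<lambda>n t. cut n t *\<^sub>R clip (g n t))"
  have v_cont: "continuous_on UNIV (v n)" for n unfolding v_def
    by (intro continuous_intros cut_cont continuous_on_compose2[OF clip_cont g(1)]) auto
  have v_meas [measurable]: "v n \<in> borel_measurable borel" for n
    by (rule borel_measurable_continuous_onI[OF v_cont])
  have v_le: "cmod (v n t) \<le> B1" for n t
  proof -
    have "cmod (v n t) \<le> 1 * B1" unfolding v_def norm_scaleR
      by (rule mult_mono) (use cut01 clip_le in auto)
    then show ?thesis by simp
  qed
  have v_lim: "(\<lambda>n. v n t) \<longlonglongrightarrow> u t" if "t \<notin> N" "0 < t" "t < 1" for t
  proof -
    have "isCont clip (u t)" using clip_cont by (simp add: continuous_on_eq_continuous_at)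
    then have "(\<lambda>n. clip (g n t)) \<longlonglongrightarrow> clip (u t)"
      by (rule isCont_tendsto_compose) (rule g(2)[OF that(1)])
    then have "(\<lambda>n. v n t) \<longlonglongrightarrow> 1 *\<^sub>R clip (u t)"
      unfolding v_def by (intro tendsto_scaleR cut_lim that)
    then show ?thesis using clip_id[OF B1(2)] by simp
  qed
  show ?thesis
  proof (rule trig_approximable_limit[OF u v_meas])
    show "trig_approximable (v n)" for n
      by (rule trig_approximable_continuous[OF v_cont]) (simp add: v_def cut01)
    have "(\<lambda>n. \<integral>\<^sup>+ t. ennreal ((cmod (u t - v n t))\<^sup>2) \<partial>unit_interval) \<longlonglongrightarrow> (\<integral>\<^sup>+ t. 0 \<partial>unit_interval)"
    proof (rule nn_integral_dominated_convergence)
      show "(\<integral>\<^sup>+ t. ennreal ((2 * B1)\<^sup>2) \<partial>unit_interval) < \<infinity>"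
        using emeasure_unit_interval by simp
      show "AE t in unit_interval. ennreal ((cmod (u t - v n t))\<^sup>2) \<le> ennreal ((2 * B1)\<^sup>2)" for n
      proof (rule AE_I2)
        fix t
        have "cmod (u t - v n t) \<le> 2 * B1"
          using norm_triangle_ineq4[of "u t" "v n t"] B1(2)[of t] v_le[of n t] by linarith
        then show "ennreal ((cmod (u t - v n t))\<^sup>2) \<le> ennreal ((2 * B1)\<^sup>2)"
          by (intro ennreal_leI power_mono) auto
      qed
      have "AE t in lebesgue. t \<notin> N \<union> {0, 1}"
        by (rule AE_not_in) (use N in \<open>auto simp: negligible_iff_null_sets intro!: null_sets.Un null_sets_completionI\<close>)
      then have "AE t in lborel. t \<notin> N \<union> {0, 1}" by (simp add: AE_completion_iff)
      then have "AE t in unit_interval. t \<notin> N \<and> 0 < t \<and> t < 1"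
        by (subst AE_restrict_space_iff) (simp, elim eventually_mono, force)
      then show "AE t in unit_interval. (\<lambda>n. ennreal ((cmod (u t - v n t))\<^sup>2)) \<longlonglongrightarrow> 0"
      proof eventually_elim
        case (elim t)
        have "(\<lambda>n. ennreal ((cmod (u t - v n t))\<^sup>2)) \<longlonglongrightarrow> ennreal ((cmod (u t - u t))\<^sup>2)"
          by (intro tendsto_intros v_lim tendsto_ennrealI) (use elim in auto)
        then show ?case by simp
      qed
    qed (auto intro!: borel_measurable_unit_interval)
    then show "(\<lambda>n. \<integral>\<^sup>+ t. ennreal ((cmod (u t - v n t))\<^sup>2) \<partial>unit_interval) \<longlonglongrightarrow> 0" by simp
  qed
qed

lemma trig_approximable_L2:
  assumes f [measurable]: "f \<in> borel_measurable borel"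
    and fin: "(\<integral>\<^sup>+ t. ennreal ((cmod (f t))\<^sup>2) \<partial>unit_interval) < \<infinity>"
  shows "trig_approximable f"
proof -
  define g where "g = (\<lambda>n t. if cmod (f t) \<le> real n then f t else 0)"
  have g [measurable]: "g n \<in> borel_measurable borel" for n unfolding g_def by measurable
  show ?thesis
  proof (rule trig_approximable_limit[OF f g])
    show "trig_approximable (g n)" for n
      by (rule trig_approximable_bounded[OF g, of _ "real n"]) (simp add: g_def)
    have "(\<lambda>n. \<integral>\<^sup>+ t. ennreal ((cmod (f t - g n t))\<^sup>2) \<partial>unit_interval) \<longlonglongrightarrow> (\<integral>\<^sup>+ t. 0 \<partial>unit_interval)"
    proof (rule nn_integral_dominated_convergence[OF _ _ _ _ fin])
      show "AE t in unit_interval. ennreal ((cmod (f t - g n t))\<^sup>2) \<le> ennreal ((cmod (f t))\<^sup>2)" for n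
        by (auto simp: g_def)
      show "AE t in unit_interval. (\<lambda>n. ennreal ((cmod (f t - g n t))\<^sup>2)) \<longlonglongrightarrow> 0"
      proof (rule AE_I2)
        fix t
        have "\<forall>\<^sub>F n in sequentially. ennreal ((cmod (f t - g n t))\<^sup>2) = 0"
          unfolding eventually_sequentially
          by (intro exI[of _ "nat \<lceil>cmod (f t)\<rceil>"]) (auto simp: g_def)
        then show "(\<lambda>n. ennreal ((cmod (f t - g n t))\<^sup>2)) \<longlonglongrightarrow> 0" by (rule tendsto_eventually)
      qed
    qed (auto intro!: borel_measurable_unit_interval)
    then show "(\<lambda>n. \<integral>\<^sup>+ t. ennreal ((cmod (f t - g n t))\<^sup>2) \<partial>unit_interval) \<longlonglongrightarrow> 0" by simp
  qed
qed

lemma integral_cis_unit_interval: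
  "(LINT t|unit_interval. cis (2 * pi * (of_int m * t))) = (if m = 0 then 1 else 0)"
proof (cases "m = 0")
  case True
  then show ?thesis using emeasure_unit_interval by (simp add: measure_def)
next
  case False
  define F where "F = (\<lambda>t. cis (2 * pi * (of_int m * t)) / (2 * pi * of_int m * \<i>))"
  have "(LINT t|lborel. indicator {0..1} t *\<^sub>R cis (2 * pi * (of_int m * t))) = F 1 - F 0"
  proof (rule integral_FTC_Icc)
    fix t :: real
    define a where "a = 2 * of_real pi * of_int m * \<i>"
    have a: "a \<noteq> 0" "cis (2 * pi * (of_int m * s)) = exp (a * of_real s)" for s
      using False by (auto simp: a_def cis_conv_exp mult_ac)
    have "((\<lambda>z. exp (a * z) / a) has_field_derivative exp (a * of_real t)) (at (of_real t))"
      using a(1) by (auto intro!: derivative_eq_intros)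
    from has_vector_derivative_real_field[OF this, of "{0..1}"]
    show "(F has_vector_derivative cis (2 * pi * (of_int m * t))) (at t within {0..1})"
      unfolding F_def a(2) by (simp add: a_def)
  next
    show "continuous_on {0..1} (\<lambda>t. cis (2 * pi * (of_int m * t)))" by (intro continuous_intros)
  qed simp
  moreover have "cis (2 * pi * of_int m) = 1" by (simp add: cis_multiple_2pi)
  ultimately show ?thesis using False by (simp add: integral_restrict_space F_def)
qed

lemma integrable_bounded_unit_interval:
  fixes f :: "real \<Rightarrow> 'a::{banach, second_countable_topology}"
  assumes "f \<in> borel_measurable borel" "\<And>t. norm (f t) \<le> B"
  shows "integrable unit_interval f"
  by (rule finite_measure.integrable_const_bound[OF finite_measure_unit_interval, of _ B])
     (use assms in \<open>auto intro: borel_measurable_unit_interval\<close>)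

lemma integrable_L2_unit_interval:
  assumes f [measurable]: "f \<in> borel_measurable borel"
    and fin: "(\<integral>\<^sup>+ t. ennreal ((cmod (f t))\<^sup>2) \<partial>unit_interval) < \<infinity>"
  shows "integrable unit_interval (\<lambda>t. (cmod (f t))\<^sup>2)" "integrable unit_interval f"
proof -
  show 1: "integrable unit_interval (\<lambda>t. (cmod (f t))\<^sup>2)"
    by (rule integrableI_bounded) (use fin in \<open>auto intro: borel_measurable_unit_interval\<close>)
  have "integrable unit_interval (\<lambda>t. 1 + (cmod (f t))\<^sup>2)"
    by (intro Bochner_Integration.integrable_add 1 integrable_bounded_unit_interval[of _ 1]) auto
  then show "integrable unit_interval f"
  proof (rule Bochner_Integration.integrable_bound)
    show "AE t in unit_interval. norm (f t) \<le> norm (1 + (cmod (f t))\<^sup>2)"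
    proof (rule AE_I2)
      fix t
      have "2 * cmod (f t) \<le> 1 + (cmod (f t))\<^sup>2"
        using zero_le_power2[of "cmod (f t) - 1"] by (simp add: power2_eq_square algebra_simps)
      then have "cmod (f t) \<le> 1 + (cmod (f t))\<^sup>2" using norm_ge_zero[of "f t"] by linarith
      then show "norm (f t) \<le> norm (1 + (cmod (f t))\<^sup>2)" by simp
    qed
  qed (auto intro: borel_measurable_unit_interval)
qed

lemma integrable_mult_cis_unit_interval:
  assumes "integrable unit_interval f"
  shows "integrable unit_interval (\<lambda>t. f t * cis (a * t))"
proof (rule Bochner_Integration.integrable_bound[OF assms])
  have "(\<lambda>t. cis (a * t)) \<in> borel_measurable unit_interval"
    by (rule borel_measurable_unit_interval) measurable
  then show "(\<lambda>t. f t * cis (a * t)) \<in> borel_measurable unit_interval"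
    using borel_measurable_integrable[OF assms] by simp
qed (simp add: norm_mult)

lemma integral_mult_cnj_trig_sum:
  assumes "integrable unit_interval f"
  shows "integrable unit_interval (\<lambda>t. f t * cnj (trig_sum S c t))"
    "(LINT t|unit_interval. f t * cnj (trig_sum S c t)) = (\<Sum>m\<in>S. cnj (c m) * fourier_coeff f m)"
proof -
  have int: "integrable unit_interval (\<lambda>t. cnj (c m) * (f t * cis (- (2 * pi * (of_int m * t)))))" for m
    using integrable_mult_cis_unit_interval[OF assms, of "- (2 * pi * of_int m)"]
    by (intro integrable_mult_right) (simp add: mult_ac)
  have eq: "(\<lambda>t. f t * cnj (trig_sum S c t)) = (\<lambda>t. \<Sum>m\<in>S. cnj (c m) * (f t * cis (- (2 * pi * (of_int m * t)))))"
    by (rule ext) (simp add: trig_sum_def cis_cnj sum_distrib_left mult_ac)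
  show "integrable unit_interval (\<lambda>t. f t * cnj (trig_sum S c t))"
    unfolding eq by (intro Bochner_Integration.integrable_sum int)
  show "(LINT t|unit_interval. f t * cnj (trig_sum S c t)) = (\<Sum>m\<in>S. cnj (c m) * fourier_coeff f m)"
    unfolding eq by (subst Bochner_Integration.integral_sum[OF int]) (simp add: fourier_coeff_def)
qed

lemma trig_sum_bound: "cmod (trig_sum S c t) \<le> (\<Sum>m\<in>S. cmod (c m))"
  unfolding trig_sum_def by (rule order.trans[OF norm_sum]) (simp add: norm_mult)

lemma fourier_coeff_trig_sum:
  assumes "finite S" shows "fourier_coeff (trig_sum S c) m = (if m \<in> S then c m else 0)"
proof -
  have int: "integrable unit_interval (\<lambda>t. c j * cis (2 * pi * (of_int (j - m) * t)))" for j
    by (rule integrable_bounded_unit_interval[of _ "cmod (c j)"]) (auto simp: norm_mult)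
  have "fourier_coeff (trig_sum S c) m = (LINT t|unit_interval. (\<Sum>j\<in>S. c j * cis (2 * pi * (of_int (j - m) * t))))"
    unfolding fourier_coeff_def
  proof (rule Bochner_Integration.integral_cong)
    fix t
    have "cis (2 * pi * (of_int j * t)) * cis (- (2 * pi * (of_int m * t))) = cis (2 * pi * (of_int (j - m) * t))" for j
      by (simp add: cis_mult algebra_simps)
    then show "trig_sum S c t * cis (- (2 * pi * (of_int m * t))) = (\<Sum>j\<in>S. c j * cis (2 * pi * (of_int (j - m) * t)))"
      by (simp add: trig_sum_def sum_distrib_right mult.assoc)
  qed simp
  also have "\<dots> = (\<Sum>j\<in>S. c j * (if j = m then 1 else 0))"
    by (subst Bochner_Integration.integral_sum[OF int]) (simp add: integral_cis_unit_interval del: of_int_diff)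
  also have "\<dots> = (if m \<in> S then c m else 0)"
    using assms by (simp add: if_distrib cong: if_cong)
  finally show ?thesis .
qed

lemma fourier_coeff_diff:
  assumes "integrable unit_interval f" "integrable unit_interval g"
  shows "fourier_coeff (\<lambda>t. f t - g t) m = fourier_coeff f m - fourier_coeff g m"
proof -
  have int: "integrable unit_interval (\<lambda>t. u t * cis (- (2 * pi * (of_int m * t))))" if "integrable unit_interval u" for u
    using integrable_mult_cis_unit_interval[OF that, of "- (2 * pi * of_int m)"] by (simp add: mult_ac)
  show ?thesis
    unfolding fourier_coeff_def left_diff_distrib
    by (rule Bochner_Integration.integral_diff[OF int int]) (rule assms)+
qed

text \<open>Pythagoras: among all sums over \<open>S\<close> the one with the Fourier coefficients is closest, which yields both
inequalities of Parseval's identity.\<close>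

lemma L2_distance_trig_sum:
  assumes f [measurable]: "f \<in> borel_measurable borel"
    and fin: "(\<integral>\<^sup>+ t. ennreal ((cmod (f t))\<^sup>2) \<partial>unit_interval) < \<infinity>" and S: "finite S"
  shows "(LINT t|unit_interval. (cmod (f t - trig_sum S c t))\<^sup>2)
     = (LINT t|unit_interval. (cmod (f t))\<^sup>2) - (\<Sum>m\<in>S. (cmod (fourier_coeff f m))\<^sup>2)
        + (\<Sum>m\<in>S. (cmod (fourier_coeff f m - c m))\<^sup>2)"
    "integrable unit_interval (\<lambda>t. (cmod (f t - trig_sum S c t))\<^sup>2)"
proof -
  let ?Q = "trig_sum S c"
  note intf = integrable_L2_unit_interval[OF f fin]
  have intQ: "integrable unit_interval ?Q"
    by (rule integrable_bounded_unit_interval[OF _ trig_sum_bound]) simp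
  note fQ = integral_mult_cnj_trig_sum[OF intf(2), of S c]
  note QQ = integral_mult_cnj_trig_sum[OF intQ, of S c]
  have eq: "(\<lambda>t. (cmod (f t - ?Q t))\<^sup>2) = (\<lambda>t. (cmod (f t))\<^sup>2 - 2 * Re (f t * cnj (?Q t)) + Re (?Q t * cnj (?Q t)))"
    by (rule ext) (rule cmod_diff_square)
  show "integrable unit_interval (\<lambda>t. (cmod (f t - ?Q t))\<^sup>2)"
    unfolding eq by (intro Bochner_Integration.integrable_add Bochner_Integration.integrable_diff integrable_mult_right integrable_Re intf fQ QQ)
  have "(LINT t|unit_interval. (cmod (f t - ?Q t))\<^sup>2)
     = (LINT t|unit_interval. (cmod (f t))\<^sup>2) - 2 * Re (LINT t|unit_interval. f t * cnj (?Q t)) + Re (LINT t|unit_interval. ?Q t * cnj (?Q t))"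
    unfolding eq
    by (subst Bochner_Integration.integral_add)
       (simp_all only: Bochner_Integration.integral_diff Bochner_Integration.integrable_diff integral_mult_right_zero
          integrable_mult_right integrable_Re integral_Re intf fQ(1) QQ(1) simp_thms if_True)
  also have "\<dots> = (LINT t|unit_interval. (cmod (f t))\<^sup>2) - 2 * Re (\<Sum>m\<in>S. cnj (c m) * fourier_coeff f m) + Re (\<Sum>m\<in>S. cnj (c m) * c m)"
    unfolding fQ(2) QQ(2) using S by (simp add: fourier_coeff_trig_sum)
  also have "\<dots> = (LINT t|unit_interval. (cmod (f t))\<^sup>2) + (\<Sum>m\<in>S. - 2 * Re (cnj (c m) * fourier_coeff f m) + Re (cnj (c m) * c m))"
    by (simp only: Re_sum sum.distrib sum_distrib_left[symmetric])
  also have "\<dots> = (LINT t|unit_interval. (cmod (f t))\<^sup>2) + (\<Sum>m\<in>S. (cmod (fourier_coeff f m - c m))\<^sup>2 - (cmod (fourier_coeff f m))\<^sup>2)"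
    by (rule arg_cong2[of _ _ _ _ "(+)"], simp, rule sum.cong, simp)
       (subst cmod_diff_square, simp add: cmod_power2 power2_eq_square algebra_simps)
  finally show "(LINT t|unit_interval. (cmod (f t - ?Q t))\<^sup>2)
     = (LINT t|unit_interval. (cmod (f t))\<^sup>2) - (\<Sum>m\<in>S. (cmod (fourier_coeff f m))\<^sup>2)
        + (\<Sum>m\<in>S. (cmod (fourier_coeff f m - c m))\<^sup>2)"
    by (simp add: sum_subtractf)
qed

theorem parseval:
  assumes f [measurable]: "f \<in> borel_measurable borel"
    and fin: "(\<integral>\<^sup>+ t. ennreal ((cmod (f t))\<^sup>2) \<partial>unit_interval) < \<infinity>"
  shows "(\<integral>\<^sup>+ t. ennreal ((cmod (f t))\<^sup>2) \<partial>unit_interval) = (\<integral>\<^sup>+ m. ennreal ((cmod (fourier_coeff f m))\<^sup>2) \<partial>count_space UNIV)"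
proof (rule antisym)
  let ?\<gamma> = "fourier_coeff f"
  let ?I = "LINT t|unit_interval. (cmod (f t))\<^sup>2"
  have I: "(\<integral>\<^sup>+ t. ennreal ((cmod (f t))\<^sup>2) \<partial>unit_interval) = ennreal ?I"
    by (rule nn_integral_eq_integral[OF integrable_L2_unit_interval(1)[OF f fin]]) simp
  have fin_le: "(\<Sum>m\<in>S. ennreal ((cmod (?\<gamma> m))\<^sup>2)) \<le> (\<integral>\<^sup>+ m. ennreal ((cmod (?\<gamma> m))\<^sup>2) \<partial>count_space UNIV)" if "finite S" for S
  proof -
    have "(\<Sum>m\<in>S. ennreal ((cmod (?\<gamma> m))\<^sup>2)) = (\<integral>\<^sup>+ m. ennreal ((cmod (?\<gamma> m))\<^sup>2) * indicator S m \<partial>count_space UNIV)"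
      using that by (subst nn_integral_count_space'[of S]) auto
    also have "\<dots> \<le> (\<integral>\<^sup>+ m. ennreal ((cmod (?\<gamma> m))\<^sup>2) \<partial>count_space UNIV)"
      by (rule nn_integral_mono) (auto simp: indicator_def)
    finally show ?thesis .
  qed
  show "(\<integral>\<^sup>+ t. ennreal ((cmod (f t))\<^sup>2) \<partial>unit_interval) \<le> (\<integral>\<^sup>+ m. ennreal ((cmod (?\<gamma> m))\<^sup>2) \<partial>count_space UNIV)"
  proof (rule ennreal_le_epsilon)
    fix e :: real assume e: "e > 0"
    obtain S c where S: "finite S" and Sc: "(\<integral>\<^sup>+ t. ennreal ((cmod (f t - trig_sum S c t))\<^sup>2) \<partial>unit_interval) \<le> ennreal e"
      using trig_approximable_L2[OF f fin] e unfolding trig_approximable_def by blast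
    note d = L2_distance_trig_sum[OF f fin S, of c]
    have "ennreal (LINT t|unit_interval. (cmod (f t - trig_sum S c t))\<^sup>2) \<le> ennreal e"
      using Sc by (subst (asm) nn_integral_eq_integral[OF d(2)]) auto
    then have "(LINT t|unit_interval. (cmod (f t - trig_sum S c t))\<^sup>2) \<le> e" using e by simp
    moreover have "(\<Sum>m\<in>S. (cmod (?\<gamma> m - c m))\<^sup>2) \<ge> 0" by (intro sum_nonneg) auto
    ultimately have "?I \<le> (\<Sum>m\<in>S. (cmod (?\<gamma> m))\<^sup>2) + e" using d(1) by linarith
    then have "ennreal ?I \<le> ennreal ((\<Sum>m\<in>S. (cmod (?\<gamma> m))\<^sup>2) + e)" by (rule ennreal_leI)
    also have "\<dots> = (\<Sum>m\<in>S. ennreal ((cmod (?\<gamma> m))\<^sup>2)) + ennreal e"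
      using e by (simp add: ennreal_plus sum_nonneg sum_ennreal)
    also have "\<dots> \<le> (\<integral>\<^sup>+ m. ennreal ((cmod (?\<gamma> m))\<^sup>2) \<partial>count_space UNIV) + ennreal e"
      by (intro add_mono fin_le S) simp
    finally show "(\<integral>\<^sup>+ t. ennreal ((cmod (f t))\<^sup>2) \<partial>unit_interval)
       \<le> (\<integral>\<^sup>+ m. ennreal ((cmod (?\<gamma> m))\<^sup>2) \<partial>count_space UNIV) + ennreal e" unfolding I .
  qed
  show "(\<integral>\<^sup>+ m. ennreal ((cmod (?\<gamma> m))\<^sup>2) \<partial>count_space UNIV) \<le> (\<integral>\<^sup>+ t. ennreal ((cmod (f t))\<^sup>2) \<partial>unit_interval)"
  proof -
    let ?g = "\<lambda>m. ennreal ((cmod (?\<gamma> m))\<^sup>2)"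
    have "(\<integral>\<^sup>+ m. ?g m \<partial>count_space UNIV) = (\<integral>\<^sup>+ m. (SUP n. ?g m * indicator {- int n..int n} m) \<partial>count_space UNIV)"
    proof (rule nn_integral_cong)
      fix m :: int
      show "?g m = (SUP n. ?g m * indicator {- int n..int n} m)"
      proof (rule antisym)
        show "?g m \<le> (SUP n. ?g m * indicator {- int n..int n} m)"
          by (rule SUP_upper2[of "nat \<bar>m\<bar>"]) (auto simp: indicator_def)
        show "(SUP n. ?g m * indicator {- int n..int n} m) \<le> ?g m"
          by (rule SUP_least) (auto simp: indicator_def)
      qed
    qed
    also have "\<dots> = (SUP n. \<integral>\<^sup>+ m. ?g m * indicator {- int n..int n} m \<partial>count_space UNIV)"
      by (rule nn_integral_monotone_convergence_SUP) (auto simp: incseq_def le_fun_def indicator_def)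
    also have "\<dots> \<le> ennreal ?I"
    proof (rule SUP_least)
      fix n
      have "(\<integral>\<^sup>+ m. ?g m * indicator {- int n..int n} m \<partial>count_space UNIV) = (\<Sum>m\<in>{- int n..int n}. ?g m)"
        by (subst nn_integral_count_space'[of "{- int n..int n}"]) auto
      also have "\<dots> = ennreal (\<Sum>m\<in>{- int n..int n}. (cmod (?\<gamma> m))\<^sup>2)" by (simp add: sum_ennreal)
      also have "\<dots> \<le> ennreal ?I"
      proof (rule ennreal_leI)
        have "0 \<le> (LINT t|unit_interval. (cmod (f t - trig_sum {- int n..int n} ?\<gamma> t))\<^sup>2)"
          by (rule Bochner_Integration.integral_nonneg) simp
        then show "(\<Sum>m\<in>{- int n..int n}. (cmod (?\<gamma> m))\<^sup>2) \<le> ?I"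
          by (subst (asm) L2_distance_trig_sum(1)[OF f fin]) auto
      qed
      finally show "(\<integral>\<^sup>+ m. ?g m * indicator {- int n..int n} m \<partial>count_space UNIV) \<le> ennreal ?I" .
    qed
    finally show ?thesis unfolding I .
  qed
qed

text \<open>Write \<open>f = Q + R\<close>, where \<open>Q\<close> collects the frequencies in \<open>S\<close>. On \<open>E\<close> one has \<open>|Q| = |R|\<close>, hence the
\<open>L\<^sup>2\<close> norm of \<open>Q\<close> on \<open>E\<close> is at most that of \<open>R\<close> on the whole circle, which Parseval's identity
computes; a single coefficient of \<open>Q\<close> is bounded by the former.\<close>

lemma circle_zero_set_estimate:
  assumes f [measurable]: "f \<in> borel_measurable borel"
    and fin: "(\<integral>\<^sup>+ t. ennreal ((cmod (f t))\<^sup>2) \<partial>unit_interval) < \<infinity>"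
    and S: "finite S" "m \<in> S"
    and E: "E \<in> sets borel" "E \<subseteq> {0..1}" "ennreal (1 / 2) \<le> emeasure lborel E" "\<And>t. t \<in> E \<Longrightarrow> f t = 0"
  shows "ennreal ((cmod (fourier_coeff f m))\<^sup>2) \<le> ennreal (4 * 256 ^ card S) *
     (\<integral>\<^sup>+ j\<in>- S. ennreal ((cmod (fourier_coeff f j))\<^sup>2) \<partial>count_space UNIV)"
proof -
  let ?Q = "trig_sum S (fourier_coeff f)"
  have intf: "integrable unit_interval f" by (rule integrable_L2_unit_interval[OF f fin])
  have intQ: "integrable unit_interval ?Q"
    by (rule integrable_bounded_unit_interval[OF _ trig_sum_bound]) simp
  define g where "g = (\<lambda>t. f t - ?Q t)"
  have g [measurable]: "g \<in> borel_measurable borel" unfolding g_def by measurable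
  have fin_g: "(\<integral>\<^sup>+ t. ennreal ((cmod (g t))\<^sup>2) \<partial>unit_interval) < \<infinity>"
    unfolding g_def
    by (subst nn_integral_eq_integral[OF L2_distance_trig_sum(2)[OF f fin S(1)]]) auto
  have coeff_g: "fourier_coeff g j = (if j \<in> S then 0 else fourier_coeff f j)" for j
    unfolding g_def fourier_coeff_diff[OF intf intQ] by (simp add: fourier_coeff_trig_sum[OF S(1)])
  have "(\<integral>\<^sup>+ t\<in>E. ennreal ((cmod (?Q t))\<^sup>2) \<partial>lborel) \<le> (\<integral>\<^sup>+ t. ennreal ((cmod (g t))\<^sup>2) * indicator {0..1} t \<partial>lborel)"
    by (rule nn_integral_mono) (use E in \<open>auto simp: indicator_def g_def\<close>)
  also have "\<dots> = (\<integral>\<^sup>+ t. ennreal ((cmod (g t))\<^sup>2) \<partial>unit_interval)"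
    by (subst nn_integral_restrict_space) auto
  also have "\<dots> = (\<integral>\<^sup>+ j. ennreal ((cmod (fourier_coeff g j))\<^sup>2) \<partial>count_space UNIV)"
    by (rule parseval[OF g fin_g])
  also have "\<dots> = (\<integral>\<^sup>+ j\<in>- S. ennreal ((cmod (fourier_coeff f j))\<^sup>2) \<partial>count_space UNIV)"
    by (rule nn_integral_cong) (auto simp: coeff_g)
  finally have "(\<integral>\<^sup>+ t\<in>E. ennreal ((cmod (?Q t))\<^sup>2) \<partial>lborel)
     \<le> (\<integral>\<^sup>+ j\<in>- S. ennreal ((cmod (fourier_coeff f j))\<^sup>2) \<partial>count_space UNIV)" .
  from order.trans[OF turan_large_set[OF S E(1-3), of "fourier_coeff f"] mult_left_mono[OF this[unfolded trig_sum_def]]]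
  show ?thesis by simp
qed

section \<open>The Fourier transform and periodization\<close>

definition fourier :: "(real \<Rightarrow> complex) \<Rightarrow> real \<Rightarrow> complex" where
  "fourier h x = (LINT t|lborel. h t * cis (- (2 * pi * (x * t))))"

lemma borel_measurable_fourier [measurable]:
  assumes [measurable]: "h \<in> borel_measurable borel"
  shows "fourier h \<in> borel_measurable borel"
  unfolding fourier_def by measurable

lemma integrable_mult_cis:
  assumes "integrable lborel h" and [measurable]: "f \<in> borel_measurable borel"
  shows "integrable lborel (\<lambda>t. h t * cis (f t))"
  by (rule Bochner_Integration.integrable_bound[OF assms(1)])
     (use borel_measurable_integrable[OF assms(1)] in \<open>auto simp: norm_mult\<close>)

lemma fourier_modulate:
  "fourier (\<lambda>t. h t * cis (- (2 * pi * (\<xi> * t)))) x = fourier h (x + \<xi>)"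
  unfolding fourier_def by (simp add: mult.assoc cis_mult algebra_simps)

lemma fourier_affine:
  assumes "\<rho> > 0"
  shows "fourier (\<lambda>t. h (\<rho> * t + b)) x = of_real (1 / \<rho>) * cis (2 * pi * (x * b / \<rho>)) * fourier h (x / \<rho>)"
proof -
  have "fourier h (x / \<rho>) = \<rho> *\<^sub>R (LINT t|lborel. h (b + \<rho> * t) * cis (- (2 * pi * (x / \<rho> * (b + \<rho> * t)))))"
    unfolding fourier_def using assms
    by (subst lborel_integral_real_affine[of \<rho> _ b]) auto
  also have "(\<lambda>t. h (b + \<rho> * t) * cis (- (2 * pi * (x / \<rho> * (b + \<rho> * t)))))
      = (\<lambda>t. cis (- (2 * pi * (x * b / \<rho>))) * (h (\<rho> * t + b) * cis (- (2 * pi * (x * t)))))"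
  proof
    fix t
    have "- (2 * pi * (x / \<rho> * (b + \<rho> * t))) = - (2 * pi * (x * b / \<rho>)) + - (2 * pi * (x * t))"
      using assms by (simp add: field_simps)
    then have "cis (- (2 * pi * (x / \<rho> * (b + \<rho> * t)))) = cis (- (2 * pi * (x * b / \<rho>))) * cis (- (2 * pi * (x * t)))"
      by (simp only: cis_mult)
    then show "h (b + \<rho> * t) * cis (- (2 * pi * (x / \<rho> * (b + \<rho> * t))))
       = cis (- (2 * pi * (x * b / \<rho>))) * (h (\<rho> * t + b) * cis (- (2 * pi * (x * t))))"
      by (simp add: add.commute mult_ac)
  qed
  finally have "fourier h (x / \<rho>) = \<rho> *\<^sub>R (cis (- (2 * pi * (x * b / \<rho>))) * fourier (\<lambda>t. h (\<rho> * t + b)) x)"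
    by (simp add: fourier_def)
  moreover have "cis (2 * pi * (x * b / \<rho>)) * cis (- (2 * pi * (x * b / \<rho>))) = 1"
    by (simp add: cis_mult)
  ultimately show ?thesis using assms by (simp add: scaleR_conv_of_real mult.assoc mult.left_commute)
qed

lemma nn_integral_periodize:
  fixes F :: "real \<Rightarrow> ennreal"
  assumes [measurable]: "F \<in> borel_measurable borel"
  shows "(\<integral>\<^sup>+ x. F x \<partial>lborel) = (\<integral>\<^sup>+ m. (\<integral>\<^sup>+ t. F (t + of_int m) \<partial>unit_interval) \<partial>count_space UNIV)"
proof -
  have "F x = (\<integral>\<^sup>+ m. F x * indicator {of_int m..<of_int m + 1} x \<partial>count_space UNIV)" for x
  proof -
    have "(\<integral>\<^sup>+ m. F x * indicator {of_int m..<of_int m + 1} x \<partial>count_space UNIV)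
       = (\<Sum>m\<in>{\<lfloor>x\<rfloor>}. F x * indicator {of_int m..<of_int m + 1} x)"
      by (rule nn_integral_count_space') (auto simp: indicator_def intro: floor_unique[symmetric])
    also have "\<dots> = F x" by (simp add: indicator_def)
    finally show ?thesis by simp
  qed
  then have "(\<integral>\<^sup>+ x. F x \<partial>lborel) = (\<integral>\<^sup>+ x. (\<integral>\<^sup>+ m. F x * indicator {of_int m..<of_int m + 1} x \<partial>count_space UNIV) \<partial>lborel)"
    by presburger
  also have "\<dots> = (\<integral>\<^sup>+ m. (\<integral>\<^sup>+ x. F x * indicator {of_int m..<of_int m + 1} x \<partial>lborel) \<partial>count_space UNIV)"
    by (rule nn_integral_count_space_nn_integral) auto
  also have "\<dots> = (\<integral>\<^sup>+ m. (\<integral>\<^sup>+ t. F (t + of_int m) \<partial>unit_interval) \<partial>count_space UNIV)"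
  proof (rule nn_integral_cong)
    fix m :: int
    have "(\<integral>\<^sup>+ x. F x * indicator {of_int m..<of_int m + 1} x \<partial>lborel)
       = (\<integral>\<^sup>+ t. F (of_int m + t) * indicator {of_int m..<of_int m + 1} (of_int m + t) \<partial>lborel)"
      using nn_integral_real_affine[of "\<lambda>x. F x * indicator {of_int m..<of_int m + 1} x" 1 "of_int m"] by simp
    also have "\<dots> = (\<integral>\<^sup>+ t. F (t + of_int m) * indicator {0..1} t \<partial>lborel)"
    proof (rule nn_integral_cong_AE)
      have "AE t in lborel. t \<noteq> (1::real)" by (rule AE_lborel_singleton)
      then show "AE t in lborel. F (of_int m + t) * indicator {of_int m..<of_int m + 1} (of_int m + t)
         = F (t + of_int m) * indicator {0..1} t"
        by eventually_elim (auto simp: indicator_def add.commute)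
    qed
    also have "\<dots> = (\<integral>\<^sup>+ t. F (t + of_int m) \<partial>unit_interval)"
      by (subst nn_integral_restrict_space) auto
    finally show "(\<integral>\<^sup>+ x. F x * indicator {of_int m..<of_int m + 1} x \<partial>lborel)
       = (\<integral>\<^sup>+ t. F (t + of_int m) \<partial>unit_interval)" .
  qed
  finally show ?thesis .
qed

lemma integral_periodize:
  fixes F :: "real \<Rightarrow> complex"
  assumes int: "integrable lborel F" and supp: "\<And>x. x \<notin> {- of_int K..<of_int K} \<Longrightarrow> F x = 0"
  shows "(LINT x|lborel. F x) = (LINT t|unit_interval. (\<Sum>k\<in>{-K..<K}. F (t + of_int k)))"
    "integrable unit_interval (\<lambda>t. \<Sum>k\<in>{-K..<K}. F (t + of_int k))"
proof -
  let ?I = "\<lambda>k::int. {of_int k..<of_int k + 1 :: real}"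
  have [measurable]: "F \<in> borel_measurable borel" using borel_measurable_integrable[OF int] by simp
  have int_shift: "integrable lborel (\<lambda>t. F (t + of_int k))" for k :: int
    using lborel_integrable_real_affine[OF int, of 1 "of_int k"] by (simp add: add.commute)
  then have int_unit: "integrable unit_interval (\<lambda>t. F (t + of_int k))" for k :: int
    by (subst integrable_restrict_space) (auto intro!: integrable_mult_indicator)
  then show "integrable unit_interval (\<lambda>t. \<Sum>k\<in>{-K..<K}. F (t + of_int k))"
    by (intro Bochner_Integration.integrable_sum)
  have "F x = (\<Sum>k\<in>{-K..<K}. indicator (?I k) x *\<^sub>R F x)" for x
  proof (cases "x \<in> {- of_int K..<of_int K}")
    case True
    then have "\<lfloor>x\<rfloor> \<in> {-K..<K}" by (auto simp: le_floor_iff floor_less_iff)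
    moreover have "x \<in> ?I k \<longleftrightarrow> k = \<lfloor>x\<rfloor>" for k using floor_eq_iff[of x k] by auto
    ultimately show ?thesis
      by (subst sum.remove[of _ "\<lfloor>x\<rfloor>"]) (auto intro!: sum.neutral simp: indicator_def)
  next
    case False
    then show ?thesis using supp by simp
  qed
  then have "(LINT x|lborel. F x) = (LINT x|lborel. (\<Sum>k\<in>{-K..<K}. indicator (?I k) x *\<^sub>R F x))" by presburger
  also have "\<dots> = (\<Sum>k\<in>{-K..<K}. (LINT x|lborel. indicator (?I k) x *\<^sub>R F x))"
    by (rule Bochner_Integration.integral_sum) (auto intro!: integrable_mult_indicator int)
  also have "\<dots> = (\<Sum>k\<in>{-K..<K}. (LINT t|unit_interval. F (t + of_int k)))"
  proof (rule sum.cong)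
    fix k :: int
    have "(LINT x|lborel. indicator (?I k) x *\<^sub>R F x) = (LINT t|lborel. indicator (?I k) (of_int k + t) *\<^sub>R F (of_int k + t))"
      using lborel_integral_real_affine[of 1 "\<lambda>x. indicator (?I k) x *\<^sub>R F x" "of_int k"] by simp
    also have "\<dots> = (LINT t|lborel. indicator {0..1} t *\<^sub>R F (t + of_int k))"
    proof (rule integral_cong_AE)
      have "AE t in lborel. t \<noteq> (1::real)" by (rule AE_lborel_singleton)
      then show "AE t in lborel. indicator (?I k) (of_int k + t) *\<^sub>R F (of_int k + t) = indicator {0..1} t *\<^sub>R F (t + of_int k)"
        by eventually_elim (auto simp: indicator_def add.commute)
    qed auto
    also have "\<dots> = (LINT t|unit_interval. F (t + of_int k))"
      by (subst integral_restrict_space) auto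
    finally show "(LINT x|lborel. indicator (?I k) x *\<^sub>R F x) = (LINT t|unit_interval. F (t + of_int k))" .
  qed simp
  also have "\<dots> = (LINT t|unit_interval. (\<Sum>k\<in>{-K..<K}. F (t + of_int k)))"
    by (rule Bochner_Integration.integral_sum[symmetric]) (rule int_unit)
  finally show "(LINT x|lborel. F x) = (LINT t|unit_interval. (\<Sum>k\<in>{-K..<K}. F (t + of_int k)))" .
qed

text \<open>The characters \<open>t \<mapsto> cis (2 * pi * (m * t))\<close> have period 1, so summing the translates of \<open>G\<close> folds the
integral over the line into one over the unit interval.\<close>

lemma fourier_coeff_periodization:
  assumes int: "integrable lborel G" and supp: "\<And>x. x \<notin> {- of_int K..<of_int K} \<Longrightarrow> G x = 0"
  shows "fourier_coeff (\<lambda>t. \<Sum>k\<in>{-K..<K}. G (t + of_int k)) m = fourier G (of_int m)"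
proof -
  have per: "cis (- (2 * pi * (of_int m * (t + of_int k)))) = cis (- (2 * pi * (of_int m * t)))" for k t
  proof -
    have "cis (- (2 * pi * (of_int m * (t + of_int k)))) = cis (- (2 * pi * (of_int m * t))) * cis (2 * pi * of_int (- (m * k)))"
      by (simp add: cis_mult algebra_simps)
    then show ?thesis using cis_multiple_2pi[of "of_int (- (m * k))"] by simp
  qed
  have "fourier G (of_int m) = (LINT t|unit_interval. (\<Sum>k\<in>{-K..<K}. G (t + of_int k) * cis (- (2 * pi * (of_int m * (t + of_int k))))))"
    unfolding fourier_def
    by (rule integral_periodize(1)) (use supp in \<open>auto intro: integrable_mult_cis[OF int]\<close>)
  also have "\<dots> = fourier_coeff (\<lambda>t. \<Sum>k\<in>{-K..<K}. G (t + of_int k)) m"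
    unfolding fourier_coeff_def per by (simp add: sum_distrib_right)
  finally show ?thesis by simp
qed

lemma L2_periodization:
  assumes [measurable]: "G \<in> borel_measurable borel"
    and fin: "(\<integral>\<^sup>+ t. ennreal ((cmod (G t))\<^sup>2) \<partial>lborel) < \<infinity>"
  shows "(\<integral>\<^sup>+ t. ennreal ((cmod (\<Sum>k\<in>{-K..<K::int}. G (t + of_int k)))\<^sup>2) \<partial>unit_interval) < \<infinity>"
proof -
  let ?A = "{-K..<K}"
  have "(\<integral>\<^sup>+ t. ennreal ((cmod (\<Sum>k\<in>?A. G (t + of_int k)))\<^sup>2) \<partial>unit_interval)
    \<le> (\<integral>\<^sup>+ t. (\<Sum>k\<in>?A. ennreal (card ?A) * ennreal ((cmod (G (t + of_int k)))\<^sup>2)) \<partial>lborel)"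
  proof (subst nn_integral_restrict_space, simp, rule nn_integral_mono)
    fix t :: real
    have "(cmod (\<Sum>k\<in>?A. G (t + of_int k)))\<^sup>2 \<le> (\<Sum>k\<in>?A. cmod (G (t + of_int k)))\<^sup>2"
      by (intro power_mono norm_sum) auto
    also have "\<dots> \<le> (\<Sum>k\<in>?A. (cmod (G (t + of_int k)))\<^sup>2) * card ?A"
      by (rule sum_squared_le_sum_of_squares)
    also have "\<dots> = (\<Sum>k\<in>?A. card ?A * (cmod (G (t + of_int k)))\<^sup>2)"
      by (simp add: sum_distrib_right sum_distrib_left mult.commute)
    finally have "ennreal ((cmod (\<Sum>k\<in>?A. G (t + of_int k)))\<^sup>2) \<le> ennreal (\<Sum>k\<in>?A. card ?A * (cmod (G (t + of_int k)))\<^sup>2)"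
      by (rule ennreal_leI)
    also have "\<dots> = (\<Sum>k\<in>?A. ennreal (card ?A) * ennreal ((cmod (G (t + of_int k)))\<^sup>2))"
      by (subst sum_ennreal[symmetric]) (simp_all add: ennreal_mult')
    finally show "ennreal ((cmod (\<Sum>k\<in>?A. G (t + of_int k)))\<^sup>2) * indicator {0..1} t
       \<le> (\<Sum>k\<in>?A. ennreal (card ?A) * ennreal ((cmod (G (t + of_int k)))\<^sup>2))"
      by (cases "t \<in> {0..1}") auto
  qed
  also have "\<dots> = (\<Sum>k\<in>?A. ennreal (card ?A) * (\<integral>\<^sup>+ t. ennreal ((cmod (G t))\<^sup>2) \<partial>lborel))"
  proof (subst nn_integral_sum, simp, rule sum.cong, simp)
    fix k :: int
    show "(\<integral>\<^sup>+ t. ennreal (card ?A) * ennreal ((cmod (G (t + of_int k)))\<^sup>2) \<partial>lborel)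
       = ennreal (card ?A) * (\<integral>\<^sup>+ t. ennreal ((cmod (G t))\<^sup>2) \<partial>lborel)"
      using nn_integral_real_affine[of "\<lambda>t. ennreal ((cmod (G t))\<^sup>2)" 1 "of_int k"]
      by (simp add: nn_integral_cmult add.commute)
  qed
  also have "\<dots> < \<infinity>" using fin by (auto simp: ennreal_mult_less_top of_nat_less_top)
  finally show ?thesis .
qed

section \<open>Averaging over dilations\<close>

text \<open>For a fixed \<open>x\<close> only integers \<open>m\<close> with the sign of \<open>x\<close> and \<open>a |x| \<le> |m| \<le> 2 a |x|\<close> contribute. There are at most \<open>2 a |x|\<close> of
them, and each contributes at most \<open>1 / (a |x|)\<close>.\<close>

lemma sum_inverse_dilations:
  fixes a x :: real
  assumes a: "a > 0"
  shows "(\<integral>\<^sup>+ m\<in>- {0::int}. ennreal (1 / \<bar>of_int m\<bar>) * indicator {1 / (2 * a)..1 / a} (x / of_int m) \<partial>count_space UNIV) \<le> 2"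
proof -
  define A where "A = {m::int. m \<noteq> 0 \<and> x / of_int m \<in> {1 / (2 * a)..1 / a}}"
  have A: "0 < x / of_int m" "a * \<bar>x\<bar> \<le> \<bar>of_int m\<bar>" "\<bar>of_int m\<bar> \<le> 2 * a * \<bar>x\<bar>" if "m \<in> A" for m
  proof -
    have m: "m \<noteq> 0" "1 / (2 * a) \<le> x / of_int m" "x / of_int m \<le> 1 / a" using that by (auto simp: A_def)
    show pos: "0 < x / of_int m" using m(2) a by (smt (verit) divide_pos_pos)
    have eq: "x / of_int m = \<bar>x\<bar> / \<bar>of_int m\<bar>" using pos by (metis abs_divide abs_of_pos)
    have m0: "\<bar>of_int m :: real\<bar> > 0" using m by simp
    show "a * \<bar>x\<bar> \<le> \<bar>of_int m\<bar>" using m(3) a m0 unfolding eq by (simp add: field_simps)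
    show "\<bar>of_int m\<bar> \<le> 2 * a * \<bar>x\<bar>" using m(2) a m0 unfolding eq by (simp add: field_simps)
  qed
  have inj: "inj_on abs A"
  proof (rule inj_onI)
    fix m n assume mn: "m \<in> A" "n \<in> A" "\<bar>m\<bar> = \<bar>n\<bar>"
    have "sgn (of_int m :: real) = sgn x" "sgn (of_int n :: real) = sgn x"
      using A(1)[OF mn(1)] A(1)[OF mn(2)] by (auto simp: zero_less_divide_iff sgn_if)
    then show "m = n" using mn(3) by (auto simp: sgn_if split: if_splits)
  qed
  have sub: "abs ` A \<subseteq> {1..\<lfloor>2 * a * \<bar>x\<bar>\<rfloor>}"
    using A(3) by (auto simp: le_floor_iff A_def)
  have fin: "finite A" using finite_imageD[OF finite_subset[OF sub] inj] by simp
  have card: "real (card A) \<le> 2 * a * \<bar>x\<bar>"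
  proof -
    have "card A = card (abs ` A)" by (rule card_image[OF inj, symmetric])
    also have "\<dots> \<le> card {1..\<lfloor>2 * a * \<bar>x\<bar>\<rfloor>}" by (rule card_mono[OF _ sub]) simp
    also have "\<dots> = nat \<lfloor>2 * a * \<bar>x\<bar>\<rfloor>" by simp
    finally have "real (card A) \<le> real (nat \<lfloor>2 * a * \<bar>x\<bar>\<rfloor>)" by simp
    also have "\<dots> \<le> 2 * a * \<bar>x\<bar>" using a by (simp add: of_nat_nat)
    finally show ?thesis .
  qed
  have "(\<integral>\<^sup>+ m\<in>- {0}. ennreal (1 / \<bar>of_int m\<bar>) * indicator {1 / (2 * a)..1 / a} (x / of_int m) \<partial>count_space UNIV)
     = (\<Sum>m\<in>A. ennreal (1 / \<bar>of_int m\<bar>) * indicator {1 / (2 * a)..1 / a} (x / of_int m) * indicator (- {0}) m)"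
    by (rule nn_integral_count_space'[OF fin]) (auto simp: A_def indicator_def)
  also have "\<dots> \<le> (\<Sum>m\<in>A. ennreal (1 / (a * \<bar>x\<bar>)))"
  proof (rule sum_mono)
    fix m assume m: "m \<in> A"
    have "x \<noteq> 0" using A(1)[OF m] by auto
    then have "1 / \<bar>of_int m :: real\<bar> \<le> 1 / (a * \<bar>x\<bar>)"
      using A(2)[OF m] a m by (intro divide_left_mono mult_pos_pos) (auto simp: A_def)
    then show "ennreal (1 / \<bar>of_int m\<bar>) * indicator {1 / (2 * a)..1 / a} (x / of_int m) * indicator (- {0}) m \<le> ennreal (1 / (a * \<bar>x\<bar>))"
      by (auto simp: indicator_def intro: ennreal_leI)
  qed
  also have "\<dots> = ennreal (card A * (1 / (a * \<bar>x\<bar>)))"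
    using a by (subst sum_ennreal) auto
  also have "\<dots> \<le> ennreal 2"
  proof (rule ennreal_leI, cases "x = 0")
    case False
    then have "a * \<bar>x\<bar> > 0" using a by simp
    then show "card A * (1 / (a * \<bar>x\<bar>)) \<le> 2" using card by (simp add: field_simps)
  qed simp
  finally show ?thesis by simp
qed

text \<open>Substituting \<open>x = m w\<close> in the \<open>m\<close>-th summand produces the weight \<open>1 / |m|\<close>. The point 0, which belongs to
every dilate \<open>w \<int>\<close>, has to be excluded: no averaging takes place there.\<close>

lemma dilation_average:
  fixes \<phi> :: "real \<Rightarrow> ennreal"
  assumes a: "a > 0" and [measurable]: "\<phi> \<in> borel_measurable borel"
  shows "(\<integral>\<^sup>+ w\<in>{1 / (2 * a)..1 / a}. (\<integral>\<^sup>+ m\<in>- {0::int}. \<phi> (of_int m * w) \<partial>count_space UNIV) \<partial>lborel) \<le> 2 * (\<integral>\<^sup>+ x. \<phi> x \<partial>lborel)"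
proof -
  let ?I = "{1 / (2 * a)..1 / a}"
  have "(\<integral>\<^sup>+ w\<in>?I. (\<integral>\<^sup>+ m\<in>- {0::int}. \<phi> (of_int m * w) \<partial>count_space UNIV) \<partial>lborel)
     = (\<integral>\<^sup>+ w. (\<integral>\<^sup>+ m. \<phi> (of_int m * w) * indicator ?I w * indicator (- {0::int}) m \<partial>count_space UNIV) \<partial>lborel)"
    by (subst nn_integral_multc[symmetric]) (auto simp: mult_ac intro!: nn_integral_cong)
  also have "\<dots> = (\<integral>\<^sup>+ m. (\<integral>\<^sup>+ w. \<phi> (of_int m * w) * indicator ?I w * indicator (- {0::int}) m \<partial>lborel) \<partial>count_space UNIV)"
    by (rule nn_integral_count_space_nn_integral) auto
  also have "\<dots> = (\<integral>\<^sup>+ m. (\<integral>\<^sup>+ x. \<phi> x * (ennreal (1 / \<bar>of_int m\<bar>) * indicator ?I (x / of_int m) * indicator (- {0::int}) m) \<partial>lborel) \<partial>count_space UNIV)"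
  proof (rule nn_integral_cong)
    fix m :: int
    show "(\<integral>\<^sup>+ w. \<phi> (of_int m * w) * indicator ?I w * indicator (- {0::int}) m \<partial>lborel)
       = (\<integral>\<^sup>+ x. \<phi> x * (ennreal (1 / \<bar>of_int m\<bar>) * indicator ?I (x / of_int m) * indicator (- {0::int}) m) \<partial>lborel)"
    proof (cases "m = 0")
      case False
      have "(\<integral>\<^sup>+ w. \<phi> (of_int m * w) * indicator ?I w \<partial>lborel)
         = ennreal (1 / \<bar>of_int m\<bar>) * (\<integral>\<^sup>+ x. \<phi> (of_int m * (x / of_int m)) * indicator ?I (x / of_int m) \<partial>lborel)"
        using nn_integral_real_affine[of "\<lambda>w. \<phi> (of_int m * w) * indicator ?I w" "1 / of_int m" 0] False
        by simp
      also have "\<dots> = (\<integral>\<^sup>+ x. \<phi> x * (ennreal (1 / \<bar>of_int m\<bar>) * indicator ?I (x / of_int m)) \<partial>lborel)"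
        using False by (subst nn_integral_cmult[symmetric]) (auto simp: mult_ac)
      finally show ?thesis using False by simp
    qed simp
  qed
  also have "\<dots> = (\<integral>\<^sup>+ x. (\<integral>\<^sup>+ m. \<phi> x * (ennreal (1 / \<bar>of_int m\<bar>) * indicator ?I (x / of_int m) * indicator (- {0::int}) m) \<partial>count_space UNIV) \<partial>lborel)"
    by (rule nn_integral_count_space_nn_integral[symmetric]) auto
  also have "\<dots> = (\<integral>\<^sup>+ x. \<phi> x * (\<integral>\<^sup>+ m\<in>- {0::int}. ennreal (1 / \<bar>of_int m\<bar>) * indicator ?I (x / of_int m) \<partial>count_space UNIV) \<partial>lborel)"
    by (subst nn_integral_cmult) auto
  also have "\<dots> \<le> (\<integral>\<^sup>+ x. \<phi> x * 2 \<partial>lborel)"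
    by (intro nn_integral_mono mult_left_mono sum_inverse_dilations[OF a]) simp
  also have "\<dots> = 2 * (\<integral>\<^sup>+ x. \<phi> x \<partial>lborel)"
    by (subst nn_integral_multc) (auto simp: mult.commute)
  finally show ?thesis .
qed

text \<open>The interval of dilations has length \<open>1 / (2 * a)\<close>, so by \<open>dilation_average\<close> the mean
over it is at most \<open>4 a \<integral>\<phi>\<close>.\<close>

lemma exists_good_dilation:
  fixes \<phi> :: "real \<Rightarrow> ennreal"
  assumes a: "a > 0" and [measurable]: "\<phi> \<in> borel_measurable borel"
    and c: "(\<integral>\<^sup>+ x. \<phi> x \<partial>lborel) < ennreal (c / (4 * a))"
  obtains w where "w \<in> {1 / (2 * a)..1 / a}" "(\<integral>\<^sup>+ m\<in>- {0::int}. \<phi> (of_int m * w) \<partial>count_space UNIV) \<le> ennreal c"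
proof (rule ccontr)
  let ?I = "{1 / (2 * a)..1 / a}"
  assume no: "\<not> thesis"
  note good = that
  have gt: "ennreal c \<le> (\<integral>\<^sup>+ m\<in>- {0::int}. \<phi> (of_int m * w) \<partial>count_space UNIV)" if "w \<in> ?I" for w
    using good[OF that] no by (meson le_cases)
  have c0: "c > 0"
  proof (rule ccontr)
    assume "\<not> c > 0"
    then have "c / (4 * a) \<le> 0" using a by (simp add: divide_le_0_iff)
    then show False using c by (simp add: ennreal_neg)
  qed
  have "2 * ennreal (c / (4 * a)) = ennreal c * ennreal (1 / a - 1 / (2 * a))"
  proof -
    have "2 * ennreal (c / (4 * a)) = ennreal (2 * (c / (4 * a)))" by (subst ennreal_mult') auto
    also have "\<dots> = ennreal (c * (1 / a - 1 / (2 * a)))" using a by (simp add: field_simps)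
    also have "\<dots> = ennreal c * ennreal (1 / a - 1 / (2 * a))" using c0 by (intro ennreal_mult') simp
    finally show ?thesis .
  qed
  also have "\<dots> = (\<integral>\<^sup>+ w. ennreal c * indicator ?I w \<partial>lborel)"
    using a by (subst nn_integral_cmult_indicator) (auto simp: field_simps)
  also have "\<dots> \<le> (\<integral>\<^sup>+ w\<in>?I. (\<integral>\<^sup>+ m\<in>- {0::int}. \<phi> (of_int m * w) \<partial>count_space UNIV) \<partial>lborel)"
    by (rule nn_integral_mono) (use gt in \<open>auto simp: indicator_def\<close>)
  also have "\<dots> \<le> 2 * (\<integral>\<^sup>+ x. \<phi> x \<partial>lborel)" by (rule dilation_average[OF a]) simp
  finally have "ennreal (c / (4 * a)) \<le> (\<integral>\<^sup>+ x. \<phi> x \<partial>lborel)"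
    by (subst (asm) ennreal_mult_le_mult_iff) auto
  with c show False by simp
qed

section \<open>Concentration of the Fourier transform\<close>

text \<open>With \<open>B = 4 a u + 4\<close> this is the constant \<open>4 * 256 ^ k * B * a\<close>, where \<open>k = B + 1\<close> bounds the number of
frequencies and \<open>B * a\<close> comes from the choice of the dilation.\<close>

definition decay_const :: "real \<Rightarrow> real \<Rightarrow> real" where
  "decay_const a u = 4 * 256 powr (4 * a * u + 5) * (4 * a * u + 4) * a"

lemma decay_const_pos: "a > 0 \<Longrightarrow> u \<ge> 0 \<Longrightarrow> decay_const a u > 0"
  unfolding decay_const_def by (intro mult_pos_pos add_nonneg_pos mult_nonneg_nonneg) auto

text \<open>The core of the argument. The weight \<open>\<phi>\<close> combines the indicator of \<open>U\<close> with \<open>\<beta>\<close> times the energy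
outside \<open>U\<close>, where \<open>\<beta>\<close> is chosen such that both parts are controlled by the same good dilation \<open>w\<close>. The
number \<open>e > 0\<close> keeps \<open>\<beta>\<close> finite if there is no energy outside \<open>U\<close>, and tends to 0 in the end.\<close>

lemma fourier_0_estimate:
  assumes [measurable]: "h \<in> borel_measurable borel" and int: "integrable lborel h"
    and L2: "(\<integral>\<^sup>+ t. ennreal ((cmod (h t))\<^sup>2) \<partial>lborel) < \<infinity>"
    and a: "a > 0" and T [measurable]: "T \<in> sets borel" and Ta: "emeasure lborel T \<le> ennreal (a / 2)"
    and TR: "T \<subseteq> {-R..R}" and supp: "\<And>t. t \<notin> T \<Longrightarrow> h t = 0"
    and U [measurable]: "U \<in> sets borel" and u: "u \<ge> 0" "emeasure lborel U \<le> ennreal u"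
  shows "ennreal ((cmod (fourier h 0))\<^sup>2) \<le> ennreal (decay_const a u) * (\<integral>\<^sup>+ x\<in>- U. ennreal ((cmod (fourier h x))\<^sup>2) \<partial>lborel)"
proof -
  define I where "I = (\<integral>\<^sup>+ x\<in>- U. ennreal ((cmod (fourier h x))\<^sup>2) \<partial>lborel)"
  define B where "B = 4 * a * u + 4"
  have B: "B > 0" unfolding B_def using a u by (intro add_nonneg_pos mult_nonneg_nonneg) auto
  show ?thesis
  proof (cases "I = \<infinity>")
    case True
    then show ?thesis unfolding I_def[symmetric] using decay_const_pos[OF a u(1)]
      by (simp add: ennreal_mult_top ennreal_eq_0_iff not_le)
  next
    case False
    then obtain i where i: "I = ennreal i" "i \<ge> 0" by (cases I) auto
    have main: "(cmod (fourier h 0))\<^sup>2 \<le> decay_const a u * (i + e)" if e: "e > 0" for e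
    proof -
      define \<beta> where "\<beta> = 1 / (a * (i + e))"
      have \<beta>: "\<beta> > 0" "\<beta> * i < 1 / a"
      proof -
        have "i + e > 0" using i e by simp
        then show "\<beta> > 0" "\<beta> * i < 1 / a" unfolding \<beta>_def using a e by (auto simp: divide_simps)
      qed
      define \<phi> where "\<phi> = (\<lambda>x. indicator U x + ennreal \<beta> * (ennreal ((cmod (fourier h x))\<^sup>2) * indicator (- U) x))"
      have [measurable]: "\<phi> \<in> borel_measurable borel" unfolding \<phi>_def by measurable
      have "(\<integral>\<^sup>+ x. \<phi> x \<partial>lborel) = emeasure lborel U + ennreal \<beta> * I"
        unfolding \<phi>_def I_def by (subst nn_integral_add) (auto simp: nn_integral_cmult)
      also have "\<dots> \<le> ennreal u + ennreal \<beta> * I" by (rule add_right_mono[OF u(2)])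
      also have "\<dots> = ennreal (u + \<beta> * i)"
        using \<beta> i u by (simp add: ennreal_mult'' ennreal_plus)
      also have "\<dots> < ennreal (B / (4 * a))"
      proof -
        have "B / (4 * a) = u + 1 / a" using a by (simp add: B_def field_simps)
        moreover have "u + 1 / a > 0" using u a by (intro add_nonneg_pos) auto
        ultimately show ?thesis using \<beta> by (intro ennreal_lessI) auto
      qed
      finally obtain w where w: "w \<in> {1 / (2 * a)..1 / a}"
        and \<phi>w: "(\<integral>\<^sup>+ m\<in>- {0::int}. \<phi> (of_int m * w) \<partial>count_space UNIV) \<le> ennreal B"
        by (rule exists_good_dilation[OF a, rotated]) auto
      have w0: "w > 0" using w a by (smt (verit) atLeastAtMost_iff divide_pos_pos)
      define S where "S = {m::int. m \<noteq> 0 \<and> of_int m * w \<in> U}"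
      have "emeasure (count_space UNIV) S = (\<integral>\<^sup>+ m. indicator S m \<partial>count_space UNIV)" by simp
      also have "\<dots> \<le> (\<integral>\<^sup>+ m\<in>- {0::int}. \<phi> (of_int m * w) \<partial>count_space UNIV)"
        by (rule nn_integral_mono) (auto simp: S_def \<phi>_def indicator_def)
      also note \<phi>w
      finally have S_le: "emeasure (count_space UNIV) S \<le> ennreal B" .
      have finS: "finite S"
      proof (rule ccontr)
        assume "infinite S"
        then show False using S_le by (simp add: top_unique)
      qed
      then have cardS: "real (card S) \<le> B" using S_le B by (simp add: emeasure_count_space_finite ennreal_of_nat_eq_real_of_nat)
      define S0 where "S0 = insert 0 S"
      have S0: "finite S0" "0 \<in> S0" using finS by (auto simp: S0_def)
      have cardS0: "real (card S0) \<le> B + 1"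
        using cardS finS by (simp add: S0_def S_def)
      define P where "P = (\<integral>\<^sup>+ m\<in>- S0. ennreal ((cmod (fourier h (of_int m * w)))\<^sup>2) \<partial>count_space UNIV)"
      have "ennreal \<beta> * P \<le> (\<integral>\<^sup>+ m\<in>- {0::int}. \<phi> (of_int m * w) \<partial>count_space UNIV)"
        unfolding P_def
        by (subst nn_integral_cmult[symmetric], simp, rule nn_integral_mono) (auto simp: S0_def S_def \<phi>_def indicator_def)
      also note \<phi>w
      also have "ennreal B = ennreal \<beta> * ennreal (B / \<beta>)" using \<beta> B by (simp flip: ennreal_mult'')
      finally have P: "P \<le> ennreal (B / \<beta>)"
        by (subst (asm) ennreal_mult_le_mult_iff) (use \<beta> in \<open>auto simp: ennreal_eq_0_iff\<close>)

      define G where "G = (\<lambda>t. h (1 / w * t + 0))"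
      have G_meas [measurable]: "G \<in> borel_measurable borel" unfolding G_def by measurable
      have fourier_G: "fourier G x = of_real w * fourier h (x * w)" for x
        unfolding G_def using fourier_affine[of "1 / w" h 0 x] w0 by simp
      have G_int: "integrable lborel G"
        unfolding G_def using lborel_integrable_real_affine[OF int, of "1 / w" 0] w0 by (simp add: add.commute)
      define K where "K = \<lceil>R * w\<rceil> + 1"
      have G_supp: "G x = 0" if x: "x \<notin> {- of_int K..<of_int K}" for x
      proof -
        have "x / w \<notin> T"
        proof
          assume "x / w \<in> T"
          then have "- R \<le> x / w" "x / w \<le> R" using TR by auto
          then have "- (R * w) \<le> x" "x \<le> R * w" using w0 by (auto simp: field_simps)
          moreover have "R * w < of_int K" unfolding K_def by linarith
          ultimately show False using x by auto
        qed
        then show ?thesis unfolding G_def using supp by simp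
      qed
      \<comment> \<open>Since \<open>w \<le> 1 / a\<close>, the support of \<open>G\<close> has measure at most \<open>1 / 2\<close>, and so has that of its periodization.\<close>
      define \<Gamma> where "\<Gamma> = (\<lambda>t. \<Sum>k\<in>{-K..<K}. G (t + of_int k))"
      have \<Gamma>_meas [measurable]: "\<Gamma> \<in> borel_measurable borel" unfolding \<Gamma>_def by measurable
      have "(\<integral>\<^sup>+ t. ennreal ((cmod (h t))\<^sup>2) \<partial>lborel) = ennreal (1 / w) * (\<integral>\<^sup>+ t. ennreal ((cmod (G t))\<^sup>2) \<partial>lborel)"
        using nn_integral_real_affine[of "\<lambda>t. ennreal ((cmod (h t))\<^sup>2)" "1 / w" 0] w0 by (simp add: G_def)
      then have "(\<integral>\<^sup>+ t. ennreal ((cmod (G t))\<^sup>2) \<partial>lborel) < \<infinity>"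
        using L2 w0 by (auto simp: ennreal_mult_less_top ennreal_eq_0_iff)
      then have \<Gamma>_fin: "(\<integral>\<^sup>+ t. ennreal ((cmod (\<Gamma> t))\<^sup>2) \<partial>unit_interval) < \<infinity>"
        unfolding \<Gamma>_def by (rule L2_periodization[OF G_meas])
      have coeff: "fourier_coeff \<Gamma> m = of_real w * fourier h (of_int m * w)" for m
        unfolding \<Gamma>_def by (subst fourier_coeff_periodization[OF G_int G_supp]) (auto simp: fourier_G)

      define E where "E = {t \<in> {0..1}. \<Gamma> t = 0}"
      define N where "N = {t \<in> {0..1}. \<Gamma> t \<noteq> 0}"
      have E_meas [measurable]: "E \<in> sets borel" and N_meas [measurable]: "N \<in> sets borel"
        unfolding E_def N_def by measurable
      define F where "F = (\<lambda>x. indicator T (1 / w * x + 0) :: ennreal)"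
      have F_meas [measurable]: "F \<in> borel_measurable borel" unfolding F_def by measurable
      have "emeasure lborel T = ennreal (1 / w) * (\<integral>\<^sup>+ x. F x \<partial>lborel)"
        using nn_integral_real_affine[of "indicator T" "1 / w" 0] w0 by (simp add: F_def)
      then have "ennreal w * emeasure lborel T = (\<integral>\<^sup>+ x. F x \<partial>lborel)"
        using w0 by (simp add: mult.assoc[symmetric] ennreal_mult''[symmetric])
      moreover have "ennreal w * emeasure lborel T \<le> ennreal (1 / a) * ennreal (a / 2)"
        using w by (intro mult_mono Ta ennreal_leI) auto
      ultimately have F_le: "(\<integral>\<^sup>+ x. F x \<partial>lborel) \<le> ennreal (1 / 2)"
        using a by (simp add: ennreal_mult''[symmetric])
      have "emeasure lborel N = (\<integral>\<^sup>+ t. indicator N t \<partial>lborel)" by simp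
      also have "\<dots> = (\<integral>\<^sup>+ t. indicator N t * indicator {0..1} t \<partial>lborel)"
        by (rule nn_integral_cong) (auto simp: indicator_def N_def)
      also have "\<dots> = (\<integral>\<^sup>+ t. indicator N t \<partial>unit_interval)"
        by (subst nn_integral_restrict_space) auto
      also have "\<dots> \<le> (\<integral>\<^sup>+ t. (\<integral>\<^sup>+ k. F (t + of_int k) \<partial>count_space UNIV) \<partial>unit_interval)"
      proof (rule nn_integral_mono)
        fix t
        show "indicator N t \<le> (\<integral>\<^sup>+ k. F (t + of_int k) \<partial>count_space UNIV)"
        proof (cases "t \<in> N")
          case True
          then obtain k where "k \<in> {-K..<K}" "G (t + of_int k) \<noteq> 0"
            unfolding N_def \<Gamma>_def by (auto elim: sum.not_neutral_contains_not_neutral)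
          then have "F (t + of_int k) = 1" using supp unfolding F_def G_def by (auto simp: indicator_def)
          then show ?thesis
            using nn_integral_ge_point[of k UNIV "\<lambda>k. F (t + of_int k)"] by (simp add: indicator_def)
        qed simp
      qed
      also have "\<dots> = (\<integral>\<^sup>+ k. (\<integral>\<^sup>+ t. F (t + of_int k) \<partial>unit_interval) \<partial>count_space UNIV)"
        by (rule nn_integral_count_space_nn_integral) (auto intro!: borel_measurable_unit_interval)
      also have "\<dots> = (\<integral>\<^sup>+ x. F x \<partial>lborel)" by (rule nn_integral_periodize[symmetric]) simp
      also note F_le
      finally have N_le: "emeasure lborel N \<le> ennreal (1 / 2)" .
      have "ennreal (1 / 2) + ennreal (1 / 2) = ennreal 1" by (subst ennreal_plus[symmetric]) auto
      also have "\<dots> = emeasure lborel {0..1::real}" by simp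
      also have "{0..1} = E \<union> N" by (auto simp: E_def N_def)
      also have "emeasure lborel (E \<union> N) \<le> emeasure lborel E + emeasure lborel N"
        by (rule emeasure_subadditive) auto
      also have "\<dots> \<le> emeasure lborel E + ennreal (1 / 2)" by (rule add_left_mono[OF N_le])
      finally have E_ge: "ennreal (1 / 2) \<le> emeasure lborel E"
        by (simp add: ennreal_add_left_cancel_le add.commute)

      have "ennreal (w\<^sup>2 * (cmod (fourier h 0))\<^sup>2) = ennreal ((cmod (fourier_coeff \<Gamma> 0))\<^sup>2)"
        using w0 by (simp add: coeff norm_mult power_mult_distrib)
      also have "\<dots> \<le> ennreal (4 * 256 ^ card S0) * (\<integral>\<^sup>+ j\<in>- S0. ennreal ((cmod (fourier_coeff \<Gamma> j))\<^sup>2) \<partial>count_space UNIV)"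
        by (rule circle_zero_set_estimate[OF \<Gamma>_meas \<Gamma>_fin S0 E_meas _ E_ge]) (auto simp: E_def)
      also have "(\<integral>\<^sup>+ j\<in>- S0. ennreal ((cmod (fourier_coeff \<Gamma> j))\<^sup>2) \<partial>count_space UNIV) = ennreal (w\<^sup>2) * P"
        unfolding P_def using w0
        by (subst nn_integral_cmult[symmetric]) (auto simp: coeff norm_mult power_mult_distrib ennreal_mult'' mult.assoc intro!: nn_integral_cong)
      also have "ennreal (4 * 256 ^ card S0) * (ennreal (w\<^sup>2) * P) \<le> ennreal (4 * 256 powr (B + 1)) * (ennreal (w\<^sup>2) * ennreal (B / \<beta>))"
      proof -
        have "(256::real) ^ card S0 = 256 powr real (card S0)" by (simp add: powr_realpow)
        also have "\<dots> \<le> 256 powr (B + 1)" by (rule powr_mono[OF cardS0]) simp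
        finally have "4 * 256 ^ card S0 \<le> 4 * (256::real) powr (B + 1)" by simp
        from mult_mono[OF ennreal_leI[OF this] mult_left_mono[OF P]] show ?thesis by simp
      qed
      also have "\<dots> = ennreal (w\<^sup>2 * (4 * 256 powr (B + 1) * (B / \<beta>)))"
        using B \<beta> by (simp add: ennreal_mult''[symmetric] mult_ac)
      finally have "w\<^sup>2 * (cmod (fourier h 0))\<^sup>2 \<le> w\<^sup>2 * (4 * 256 powr (B + 1) * (B / \<beta>))"
        using B \<beta> by (subst (asm) ennreal_le_iff) auto
      then have "(cmod (fourier h 0))\<^sup>2 \<le> 4 * 256 powr (B + 1) * (B / \<beta>)"
        using w0 by (subst (asm) mult_le_cancel_left_pos) auto
      also have "\<dots> = decay_const a u * (i + e)"
        by (simp add: decay_const_def B_def \<beta>_def algebra_simps)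
      finally show ?thesis .
    qed
    have "(cmod (fourier h 0))\<^sup>2 \<le> decay_const a u * i"
    proof (rule field_le_epsilon)
      fix e :: real assume e: "e > 0"
      have "(cmod (fourier h 0))\<^sup>2 \<le> decay_const a u * (i + e / decay_const a u)"
        by (rule main) (use e decay_const_pos[OF a u(1)] in simp)
      also have "\<dots> = decay_const a u * i + e" using decay_const_pos[OF a u(1)] by (simp add: field_simps)
      finally show "(cmod (fourier h 0))\<^sup>2 \<le> decay_const a u * i + e" .
    qed
    then show ?thesis unfolding I_def[symmetric] i(1)
      using i(2) decay_const_pos[OF a u(1)] by (simp add: ennreal_mult''[symmetric] ennreal_leI)
  qed
qed

lemma L2_integrable_bounded_support:
  fixes h :: "real \<Rightarrow> complex"
  assumes [measurable]: "h \<in> borel_measurable borel"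
    and L2: "(\<integral>\<^sup>+ t. ennreal ((cmod (h t))\<^sup>2) \<partial>lborel) < \<infinity>"
    and supp: "\<And>t. t \<notin> {-R..R} \<Longrightarrow> h t = 0"
  shows "integrable lborel h"
proof (rule Bochner_Integration.integrable_bound)
  have "integrable lborel (\<lambda>t. (cmod (h t))\<^sup>2)"
    by (rule integrableI_bounded) (use L2 in auto)
  then show "integrable lborel (\<lambda>t. indicator {-R..R} t + (cmod (h t))\<^sup>2)"
    by (intro Bochner_Integration.integrable_add integrable_real_indicator) (simp_all add: emeasure_lborel_Icc_eq)
  show "AE t in lborel. norm (h t) \<le> norm (indicator {-R..R} t + (cmod (h t))\<^sup>2)"
  proof (rule AE_I2)
    fix t
    have "2 * cmod (h t) \<le> 1 + (cmod (h t))\<^sup>2"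
      using zero_le_power2[of "cmod (h t) - 1"] by (simp add: power2_eq_square algebra_simps)
    then have "cmod (h t) \<le> 1 + (cmod (h t))\<^sup>2" using norm_ge_zero[of "h t"] by linarith
    then show "norm (h t) \<le> norm (indicator {-R..R} t + (cmod (h t))\<^sup>2)"
      using supp[of t] by (cases "t \<in> {-R..R}") auto
  qed
qed simp

text \<open>Modulation by \<open>\<xi>\<close> moves the frequency \<open>\<xi>\<close> to 0 and translates \<open>U\<close>, which changes neither its
measure nor the support of \<open>h\<close>.\<close>

lemma fourier_pointwise_estimate:
  assumes [measurable]: "h \<in> borel_measurable borel"
    and L2: "(\<integral>\<^sup>+ t. ennreal ((cmod (h t))\<^sup>2) \<partial>lborel) < \<infinity>"
    and a: "a > 0" and T: "T \<in> sets borel" "emeasure lborel T \<le> ennreal (a / 2)"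
    and TR: "T \<subseteq> {-R..R}" and supp: "\<And>t. t \<notin> T \<Longrightarrow> h t = 0"
    and U [measurable]: "U \<in> sets borel" and u: "u \<ge> 0" "emeasure lborel U \<le> ennreal u"
  shows "ennreal ((cmod (fourier h \<xi>))\<^sup>2) \<le> ennreal (decay_const a u) * (\<integral>\<^sup>+ x\<in>- U. ennreal ((cmod (fourier h x))\<^sup>2) \<partial>lborel)"
proof -
  define g where "g = (\<lambda>t. h t * cis (- (2 * pi * (\<xi> * t))))"
  define V where "V = {x. x + \<xi> \<in> U}"
  have [measurable]: "g \<in> borel_measurable borel" unfolding g_def by measurable
  have V: "V \<in> sets borel" unfolding V_def by measurable
  have g: "fourier g x = fourier h (x + \<xi>)" for x unfolding g_def by (rule fourier_modulate)
  have "ennreal ((cmod (fourier g 0))\<^sup>2) \<le> ennreal (decay_const a u) * (\<integral>\<^sup>+ x\<in>- V. ennreal ((cmod (fourier g x))\<^sup>2) \<partial>lborel)"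
  proof (rule fourier_0_estimate[OF _ _ _ a T TR _ V u(1)])
    show "integrable lborel g" unfolding g_def
    proof (rule integrable_mult_cis[OF L2_integrable_bounded_support[OF _ L2, of R]])
      show "h t = 0" if "t \<notin> {-R..R}" for t using that TR supp by blast
    qed auto
    show "(\<integral>\<^sup>+ t. ennreal ((cmod (g t))\<^sup>2) \<partial>lborel) < \<infinity>" using L2 by (simp add: g_def norm_mult)
    show "g t = 0" if "t \<notin> T" for t using supp[OF that] by (simp add: g_def)
    have "emeasure lborel V = (\<integral>\<^sup>+ x. indicator V x \<partial>lborel)" using V by simp
    also have "\<dots> = (\<integral>\<^sup>+ x. indicator U (\<xi> + 1 * x) \<partial>lborel)"
      by (rule nn_integral_cong) (auto simp: V_def indicator_def add.commute)
    also have "\<dots> = emeasure lborel U" using nn_integral_real_affine[of "indicator U" 1 \<xi>] by simp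
    finally show "emeasure lborel V \<le> ennreal u" using u by simp
  qed simp
  also have "(\<integral>\<^sup>+ x\<in>- V. ennreal ((cmod (fourier g x))\<^sup>2) \<partial>lborel) = (\<integral>\<^sup>+ x\<in>- U. ennreal ((cmod (fourier h x))\<^sup>2) \<partial>lborel)"
    using nn_integral_real_affine[of "\<lambda>x. ennreal ((cmod (fourier h x))\<^sup>2) * indicator (- U) x" 1 \<xi>]
    by (simp add: g V_def add.commute indicator_def)
  finally show ?thesis by (simp add: g)
qed

lemma fourier_L2_estimate:
  assumes [measurable]: "h \<in> borel_measurable borel"
    and L2: "(\<integral>\<^sup>+ t. ennreal ((cmod (h t))\<^sup>2) \<partial>lborel) < \<infinity>"
    and a: "a > 0" and T: "T \<in> sets borel" "emeasure lborel T \<le> ennreal (a / 2)"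
    and TR: "T \<subseteq> {-R..R}" and supp: "\<And>t. t \<notin> T \<Longrightarrow> h t = 0"
    and U [measurable]: "U \<in> sets borel" and u: "u \<ge> 0" "emeasure lborel U \<le> ennreal u"
  shows "(\<integral>\<^sup>+ x. ennreal ((cmod (fourier h x))\<^sup>2) \<partial>lborel)
     \<le> ennreal (1 + u * decay_const a u) * (\<integral>\<^sup>+ x\<in>- U. ennreal ((cmod (fourier h x))\<^sup>2) \<partial>lborel)"
proof -
  let ?f = "\<lambda>x. ennreal ((cmod (fourier h x))\<^sup>2)"
  let ?I = "\<integral>\<^sup>+ x\<in>- U. ?f x \<partial>lborel"
  have "(\<integral>\<^sup>+ x. ?f x \<partial>lborel) = (\<integral>\<^sup>+ x. ?f x * indicator (- U) x + ?f x * indicator U x \<partial>lborel)"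
    by (rule nn_integral_cong) (auto simp: indicator_def)
  also have "\<dots> = ?I + (\<integral>\<^sup>+ x\<in>U. ?f x \<partial>lborel)" by (rule nn_integral_add) auto
  also have "(\<integral>\<^sup>+ x\<in>U. ?f x \<partial>lborel) \<le> (\<integral>\<^sup>+ x. (ennreal (decay_const a u) * ?I) * indicator U x \<partial>lborel)"
    by (intro nn_integral_mono mult_right_mono fourier_pointwise_estimate[OF assms(1) L2 a T TR supp U u]) auto
  also have "\<dots> = ennreal (decay_const a u) * ?I * emeasure lborel U"
    by (subst nn_integral_cmult_indicator) auto
  also have "\<dots> \<le> ennreal (decay_const a u) * ?I * ennreal u" by (intro mult_left_mono u) simp
  also have "?I + ennreal (decay_const a u) * ?I * ennreal u = (1 + ennreal (u * decay_const a u)) * ?I"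
    using u decay_const_pos[OF a u(1)] by (simp add: distrib_right ennreal_mult' mult_ac)
  also have "1 + ennreal (u * decay_const a u) = ennreal (1 + u * decay_const a u)"
    using u decay_const_pos[OF a u(1)] by (simp add: ennreal_plus mult_nonneg_nonneg flip: ennreal_1)
  finally show ?thesis by (simp add: add_left_mono)
qed

section \<open>Plancherel's theorem\<close>

text \<open>Parseval's identity for \<open>G(t) cis (- 2\<pi>st)\<close> gives \<open>\<Sum>\<^sub>m |fourier G (s + m)|\<^sup>2 = \<parallel>G\<parallel>\<^sup>2\<close> for each \<open>s\<close>;
integrating over a unit interval of shifts \<open>s\<close> assembles the integral over the line.\<close>

lemma plancherel_unit_interval:
  assumes [measurable]: "G \<in> borel_measurable borel"
    and L2: "(\<integral>\<^sup>+ t. ennreal ((cmod (G t))\<^sup>2) \<partial>lborel) < \<infinity>"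
    and supp: "\<And>t. t \<notin> {0..1} \<Longrightarrow> G t = 0"
  shows "(\<integral>\<^sup>+ x. ennreal ((cmod (fourier G x))\<^sup>2) \<partial>lborel) = (\<integral>\<^sup>+ t. ennreal ((cmod (G t))\<^sup>2) \<partial>lborel)"
proof -
  have unit: "(\<integral>\<^sup>+ t. ennreal ((cmod (G t))\<^sup>2) \<partial>lborel) = (\<integral>\<^sup>+ t. ennreal ((cmod (G t))\<^sup>2) \<partial>unit_interval)"
    by (subst nn_integral_restrict_space) (use supp in \<open>auto intro!: nn_integral_cong simp: indicator_def\<close>)
  have pars: "(\<integral>\<^sup>+ m. ennreal ((cmod (fourier G (s + of_int m)))\<^sup>2) \<partial>count_space UNIV) = (\<integral>\<^sup>+ t. ennreal ((cmod (G t))\<^sup>2) \<partial>lborel)" for s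
  proof -
    define g where "g = (\<lambda>t. G t * cis (- (2 * pi * (s * t))))"
    have g [measurable]: "g \<in> borel_measurable borel" unfolding g_def by measurable
    have norm_g: "cmod (g t) = cmod (G t)" for t by (simp add: g_def norm_mult)
    have "fourier_coeff g m = fourier g (of_int m)" for m
      unfolding fourier_coeff_def fourier_def
      by (subst integral_restrict_space) (use supp in \<open>auto intro!: Bochner_Integration.integral_cong simp: indicator_def g_def\<close>)
    then have "fourier_coeff g m = fourier G (s + of_int m)" for m
      unfolding g_def fourier_modulate by (simp add: add.commute)
    then show ?thesis
      using parseval[OF g] L2 unfolding unit by (simp add: norm_g)
  qed
  have "(\<integral>\<^sup>+ x. ennreal ((cmod (fourier G x))\<^sup>2) \<partial>lborel)
     = (\<integral>\<^sup>+ m. (\<integral>\<^sup>+ s. ennreal ((cmod (fourier G (s + of_int m)))\<^sup>2) \<partial>unit_interval) \<partial>count_space UNIV)"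
    by (rule nn_integral_periodize) simp
  also have "\<dots> = (\<integral>\<^sup>+ s. (\<integral>\<^sup>+ m. ennreal ((cmod (fourier G (s + of_int m)))\<^sup>2) \<partial>count_space UNIV) \<partial>unit_interval)"
    by (rule nn_integral_count_space_nn_integral[symmetric]) (auto intro!: borel_measurable_unit_interval)
  also have "\<dots> = (\<integral>\<^sup>+ t. ennreal ((cmod (G t))\<^sup>2) \<partial>lborel)"
    unfolding pars using emeasure_unit_interval by simp
  finally show ?thesis .
qed

lemma plancherel_bounded_support:
  assumes [measurable]: "h \<in> borel_measurable borel"
    and L2: "(\<integral>\<^sup>+ t. ennreal ((cmod (h t))\<^sup>2) \<partial>lborel) < \<infinity>"
    and R: "R > 0" and supp: "\<And>t. t \<notin> {-R..R} \<Longrightarrow> h t = 0"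
  shows "(\<integral>\<^sup>+ x. ennreal ((cmod (fourier h x))\<^sup>2) \<partial>lborel) = (\<integral>\<^sup>+ t. ennreal ((cmod (h t))\<^sup>2) \<partial>lborel)"
proof -
  define \<rho> where "\<rho> = 2 * R"
  have \<rho>: "\<rho> > 0" using R by (simp add: \<rho>_def)
  define G where "G = (\<lambda>t. h (\<rho> * t + - R))"
  have [measurable]: "G \<in> borel_measurable borel" unfolding G_def by measurable
  have hG: "(\<integral>\<^sup>+ t. ennreal ((cmod (h t))\<^sup>2) \<partial>lborel) = ennreal \<rho> * (\<integral>\<^sup>+ t. ennreal ((cmod (G t))\<^sup>2) \<partial>lborel)"
    using nn_integral_real_affine[of "\<lambda>t. ennreal ((cmod (h t))\<^sup>2)" \<rho> "- R"] \<rho> by (simp add: G_def add.commute)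
  have supp_G: "G t = 0" if "t \<notin> {0..1}" for t
  proof -
    have "\<rho> * t + - R \<notin> {-R..R}" using that R \<rho> by (auto simp: \<rho>_def zero_le_mult_iff)
    then show ?thesis unfolding G_def by (rule supp)
  qed
  have norm_G: "(cmod (fourier G x))\<^sup>2 = (1 / \<rho>)\<^sup>2 * (cmod (fourier h (1 / \<rho> * x)))\<^sup>2" for x
    unfolding G_def using \<rho> by (subst fourier_affine) (auto simp: norm_mult norm_divide power_mult_distrib power_divide)
  have "(\<integral>\<^sup>+ x. ennreal ((cmod (fourier h x))\<^sup>2) \<partial>lborel) = ennreal (1 / \<rho>) * (\<integral>\<^sup>+ x. ennreal ((cmod (fourier h (1 / \<rho> * x)))\<^sup>2) \<partial>lborel)"
    using nn_integral_real_affine[of "\<lambda>t. ennreal ((cmod (fourier h t))\<^sup>2)" "1 / \<rho>" 0] \<rho> by simp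
  also have "\<dots> = ennreal \<rho> * (\<integral>\<^sup>+ x. ennreal ((cmod (fourier G x))\<^sup>2) \<partial>lborel)"
  proof -
    have "ennreal \<rho> * ennreal ((1 / \<rho>)\<^sup>2) = ennreal (1 / \<rho>)"
      using \<rho> by (simp add: ennreal_mult''[symmetric] power2_eq_square)
    then show ?thesis
      unfolding norm_G using \<rho> by (simp add: ennreal_mult' nn_integral_cmult mult.assoc[symmetric])
  qed
  also have "(\<integral>\<^sup>+ x. ennreal ((cmod (fourier G x))\<^sup>2) \<partial>lborel) = (\<integral>\<^sup>+ t. ennreal ((cmod (G t))\<^sup>2) \<partial>lborel)"
  proof (rule plancherel_unit_interval[OF _ _ supp_G])
    show "(\<integral>\<^sup>+ t. ennreal ((cmod (G t))\<^sup>2) \<partial>lborel) < \<infinity>"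
      using L2 \<rho> unfolding hG by (auto simp: ennreal_mult_less_top ennreal_eq_0_iff)
  qed auto
  finally show ?thesis using hG by simp
qed

text \<open>Truncation to bounded intervals converges in \<open>L\<^sup>1\<close>, hence pointwise on the Fourier side, and Fatou's lemma keeps
one inequality of Plancherel's theorem.\<close>

lemma fourier_L2_le:
  assumes [measurable]: "h \<in> borel_measurable borel" and int: "integrable lborel h"
    and L2: "(\<integral>\<^sup>+ t. ennreal ((cmod (h t))\<^sup>2) \<partial>lborel) < \<infinity>"
  shows "(\<integral>\<^sup>+ x. ennreal ((cmod (fourier h x))\<^sup>2) \<partial>lborel) \<le> (\<integral>\<^sup>+ t. ennreal ((cmod (h t))\<^sup>2) \<partial>lborel)"
proof -
  define g where "g = (\<lambda>n t. if \<bar>t\<bar> \<le> real (Suc n) then h t else 0)"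
  have [measurable]: "g n \<in> borel_measurable borel" for n unfolding g_def by measurable
  have g_le: "(\<integral>\<^sup>+ t. ennreal ((cmod (g n t))\<^sup>2) \<partial>lborel) \<le> (\<integral>\<^sup>+ t. ennreal ((cmod (h t))\<^sup>2) \<partial>lborel)" for n
    by (rule nn_integral_mono) (auto simp: g_def)
  have planch: "(\<integral>\<^sup>+ x. ennreal ((cmod (fourier (g n) x))\<^sup>2) \<partial>lborel) = (\<integral>\<^sup>+ t. ennreal ((cmod (g n t))\<^sup>2) \<partial>lborel)" for n
    by (rule plancherel_bounded_support[of _ "real (Suc n)"])
       (use order.strict_trans1[OF g_le L2] in \<open>auto simp: g_def abs_le_iff\<close>)
  have lim: "(\<lambda>n. fourier (g n) x) \<longlonglongrightarrow> fourier h x" for x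
    unfolding fourier_def
  proof (rule integral_dominated_convergence)
    show "integrable lborel (\<lambda>t. cmod (h t))" using int by (rule integrable_norm)
    show "AE t in lborel. (\<lambda>n. g n t * cis (- (2 * pi * (x * t)))) \<longlonglongrightarrow> h t * cis (- (2 * pi * (x * t)))"
    proof (rule AE_I2)
      fix t
      have "\<forall>\<^sub>F n in sequentially. g n t * cis (- (2 * pi * (x * t))) = h t * cis (- (2 * pi * (x * t)))"
        unfolding eventually_sequentially g_def by (intro exI[of _ "nat \<lceil>\<bar>t\<bar>\<rceil>"]) auto
      then show "(\<lambda>n. g n t * cis (- (2 * pi * (x * t)))) \<longlonglongrightarrow> h t * cis (- (2 * pi * (x * t)))"
        by (rule tendsto_eventually)
    qed
  qed (auto simp: g_def norm_mult)
  have "(\<integral>\<^sup>+ x. ennreal ((cmod (fourier h x))\<^sup>2) \<partial>lborel) = (\<integral>\<^sup>+ x. liminf (\<lambda>n. ennreal ((cmod (fourier (g n) x))\<^sup>2)) \<partial>lborel)"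
  proof (rule nn_integral_cong)
    fix x
    have "(\<lambda>n. ennreal ((cmod (fourier (g n) x))\<^sup>2)) \<longlonglongrightarrow> ennreal ((cmod (fourier h x))\<^sup>2)"
      by (intro tendsto_ennrealI tendsto_intros lim)
    then show "ennreal ((cmod (fourier h x))\<^sup>2) = liminf (\<lambda>n. ennreal ((cmod (fourier (g n) x))\<^sup>2))"
      by (rule lim_imp_Liminf[symmetric, rotated]) simp
  qed
  also have "\<dots> \<le> liminf (\<lambda>n. \<integral>\<^sup>+ x. ennreal ((cmod (fourier (g n) x))\<^sup>2) \<partial>lborel)"
    by (rule nn_integral_liminf) simp
  also have "\<dots> \<le> liminf (\<lambda>n::nat. \<integral>\<^sup>+ t. ennreal ((cmod (h t))\<^sup>2) \<partial>lborel)"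
    unfolding planch by (intro Liminf_mono always_eventually allI g_le)
  also have "\<dots> = (\<integral>\<^sup>+ t. ennreal ((cmod (h t))\<^sup>2) \<partial>lborel)" by (simp add: Liminf_const)
  finally show ?thesis .
qed

section \<open>Nazarov's uncertainty principle\<close>

lemma fourier_diff:
  assumes "integrable lborel f" "integrable lborel g"
  shows "fourier (\<lambda>t. f t - g t) x = fourier f x - fourier g x"
  unfolding fourier_def left_diff_distrib
  by (rule Bochner_Integration.integral_diff) (intro integrable_mult_cis assms; measurable)+

text \<open>The part \<open>g1\<close> of \<open>g\<close> on the bounded set \<open>T \<inter> {-R..R}\<close> obeys the concentration estimate. The transform of
\<open>g1\<close> outside \<open>U\<close> differs from that of \<open>g\<close> by the transform of the rest \<open>g2\<close>, whose norm is at most the norm of \<open>g\<close>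
outside \<open>T \<inter> {-R..R}\<close>. Letting \<open>R\<close> grow removes the truncation.\<close>

theorem nazarov_uncertainty_scale:
  assumes [measurable]: "g \<in> borel_measurable borel" and int: "integrable lborel g"
    and L2: "(\<integral>\<^sup>+ t. ennreal ((cmod (g t))\<^sup>2) \<partial>lborel) < \<infinity>"
    and a: "a > 0" and T [measurable]: "T \<in> sets borel" and Ta: "emeasure lborel T \<le> ennreal (a / 2)"
    and U [measurable]: "U \<in> sets borel" and u: "u \<ge> 0" "emeasure lborel U \<le> ennreal u"
  shows "(\<integral>\<^sup>+ t. ennreal ((cmod (g t))\<^sup>2) \<partial>lborel) \<le> ennreal (3 + 2 * u * decay_const a u) *
    ((\<integral>\<^sup>+ t\<in>- T. ennreal ((cmod (g t))\<^sup>2) \<partial>lborel) + (\<integral>\<^sup>+ x\<in>- U. ennreal ((cmod (fourier g x))\<^sup>2) \<partial>lborel))"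
proof -
  define D where "D = 1 + u * decay_const a u"
  define M where "M = 3 + 2 * u * decay_const a u"
  have D: "D > 0" "M > 0" "M = 2 * D + 1"
    using u decay_const_pos[OF a u(1)] by (auto simp: D_def M_def intro!: add_pos_nonneg mult_nonneg_nonneg)
  let ?n = "\<lambda>f A. \<integral>\<^sup>+ t\<in>A. ennreal ((cmod (f t))\<^sup>2) \<partial>lborel"
  have split: "?n f UNIV = ?n f A + ?n f (- A)" if [measurable]: "f \<in> borel_measurable borel" "A \<in> sets borel" for f :: "real \<Rightarrow> complex" and A
    by (subst nn_integral_add[symmetric]) (auto intro!: nn_integral_cong simp: indicator_def)
  have bound: "?n g UNIV \<le> ennreal M * ((?n g (- T) + ?n g (- {-R..R})) + ?n (fourier g) (- U))" if R: "R > 0" for R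
  proof -
    define A where "A = T \<inter> {-R..R}"
    define g1 where "g1 = (\<lambda>t. if t \<in> A then g t else 0)"
    define g2 where "g2 = (\<lambda>t. if t \<in> A then 0 else g t)"
    have [measurable]: "A \<in> sets borel" unfolding A_def by measurable
    have [measurable]: "g1 \<in> borel_measurable borel" "g2 \<in> borel_measurable borel" unfolding g1_def g2_def by measurable
    have int1: "integrable lborel g1" and int2: "integrable lborel g2"
      by (rule Bochner_Integration.integrable_bound[OF int]; simp add: g1_def g2_def)+
    have n1: "?n g1 UNIV = ?n g A" and n2: "?n g2 UNIV = ?n g (- A)"
      by (auto intro!: nn_integral_cong simp: g1_def g2_def indicator_def)
    have fin1: "?n g1 UNIV < \<infinity>" and fin2: "?n g2 UNIV < \<infinity>"
      using L2 split[of g A] unfolding n1 n2 by (auto simp: less_top)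
    have g1: "g1 = (\<lambda>t. g t - g2 t)" by (auto simp: g1_def g2_def)
    have "?n g1 UNIV = ?n (fourier g1) UNIV"
    proof -
      have "(\<integral>\<^sup>+ x. ennreal ((cmod (fourier g1 x))\<^sup>2) \<partial>lborel) = (\<integral>\<^sup>+ t. ennreal ((cmod (g1 t))\<^sup>2) \<partial>lborel)"
      proof (rule plancherel_bounded_support[OF _ _ R])
        show "g1 t = 0" if "t \<notin> {-R..R}" for t using that by (auto simp: g1_def A_def)
      qed (use fin1 in auto)
      then show ?thesis by simp
    qed
    also have "\<dots> \<le> ennreal D * ?n (fourier g1) (- U)"
      unfolding D_def
    proof -
      have "(\<integral>\<^sup>+ x. ennreal ((cmod (fourier g1 x))\<^sup>2) \<partial>lborel) \<le> ennreal (1 + u * decay_const a u) * ?n (fourier g1) (- U)"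
      proof (rule fourier_L2_estimate[OF _ _ a _ _ _ _ U u])
        show "emeasure lborel A \<le> ennreal (a / 2)"
          by (rule order.trans[OF emeasure_mono Ta]) (auto simp: A_def)
        show "A \<subseteq> {-R..R}" by (auto simp: A_def)
        show "g1 t = 0" if "t \<notin> A" for t using that by (auto simp: g1_def)
      qed (use fin1 in auto)
      then show "?n (fourier g1) UNIV \<le> ennreal (1 + u * decay_const a u) * ?n (fourier g1) (- U)" by simp
    qed
    also have "?n (fourier g1) (- U) \<le> (\<integral>\<^sup>+ x. 2 * (ennreal ((cmod (fourier g x))\<^sup>2) * indicator (- U) x) + 2 * ennreal ((cmod (fourier g2 x))\<^sup>2) \<partial>lborel)"
    proof (rule nn_integral_mono)
      fix x
      have "fourier g1 x = fourier g x + - fourier g2 x" unfolding g1 fourier_diff[OF int int2] by simp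
      then have "(cmod (fourier g1 x))\<^sup>2 \<le> 2 * (cmod (fourier g x))\<^sup>2 + 2 * (cmod (fourier g2 x))\<^sup>2"
        using cmod_add_square_le[of "fourier g x" "- fourier g2 x"] by simp
      then have "ennreal ((cmod (fourier g1 x))\<^sup>2) \<le> ennreal (2 * (cmod (fourier g x))\<^sup>2 + 2 * (cmod (fourier g2 x))\<^sup>2)"
        by (rule ennreal_leI)
      also have "\<dots> = 2 * ennreal ((cmod (fourier g x))\<^sup>2) + 2 * ennreal ((cmod (fourier g2 x))\<^sup>2)"
        by (simp add: ennreal_mult)
      finally show "ennreal ((cmod (fourier g1 x))\<^sup>2) * indicator (- U) x
        \<le> 2 * (ennreal ((cmod (fourier g x))\<^sup>2) * indicator (- U) x) + 2 * ennreal ((cmod (fourier g2 x))\<^sup>2)"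
        by (auto simp: indicator_def)
    qed
    also have "\<dots> = 2 * ?n (fourier g) (- U) + 2 * ?n (fourier g2) UNIV"
      by (simp add: nn_integral_add nn_integral_cmult)
    also have "\<dots> \<le> 2 * ?n (fourier g) (- U) + 2 * ?n g (- A)"
      using fourier_L2_le[of g2] fin2 int2 n2 by (intro add_mono mult_left_mono) auto
    finally have b1: "?n g A \<le> ennreal D * (2 * ?n (fourier g) (- U) + 2 * ?n g (- A))"
      unfolding n1 by (simp add: mult_left_mono)
    have nA: "?n g (- A) \<le> ?n g (- T) + ?n g (- {-R..R})"
      by (subst nn_integral_add[symmetric]) (auto intro!: nn_integral_mono simp: A_def indicator_def)
    have "?n g UNIV = ?n g A + ?n g (- A)" by (rule split) auto
    also have "\<dots> \<le> ennreal D * (2 * ?n (fourier g) (- U) + 2 * ?n g (- A)) + ?n g (- A)"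
      by (rule add_right_mono[OF b1])
    also have "\<dots> \<le> ennreal M * (?n g (- A) + ?n (fourier g) (- U))"
    proof -
      have "ennreal M = 2 * ennreal D + 1" using D by (simp add: ennreal_plus ennreal_mult')
      then have "ennreal M * (?n g (- A) + ?n (fourier g) (- U))
        = ennreal D * (2 * ?n (fourier g) (- U) + 2 * ?n g (- A)) + ?n g (- A) + ?n (fourier g) (- U)"
        by (simp add: distrib_left distrib_right mult_ac add_ac)
      then show ?thesis by simp
    qed
    also have "\<dots> \<le> ennreal M * ((?n g (- T) + ?n g (- {-R..R})) + ?n (fourier g) (- U))"
      by (intro mult_left_mono add_right_mono nA) simp
    finally show ?thesis .
  qed
  have "(\<lambda>n. ?n g (- {- real n..real n})) \<longlonglongrightarrow> (\<integral>\<^sup>+ t. 0 \<partial>(lborel :: real measure))"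
  proof (rule nn_integral_dominated_convergence[where w = "\<lambda>t. ennreal ((cmod (g t))\<^sup>2)"])
    show "(\<integral>\<^sup>+ t. ennreal ((cmod (g t))\<^sup>2) \<partial>lborel) < \<infinity>" by (rule L2)
    show "AE t in lborel. ennreal ((cmod (g t))\<^sup>2) * indicator (- {- real n..real n}) t \<le> ennreal ((cmod (g t))\<^sup>2)" for n
      by (auto simp: indicator_def)
    show "AE t in lborel. (\<lambda>n. ennreal ((cmod (g t))\<^sup>2) * indicator (- {- real n..real n}) t) \<longlonglongrightarrow> 0"
    proof (rule AE_I2)
      fix t
      have "\<forall>\<^sub>F n in sequentially. ennreal ((cmod (g t))\<^sup>2) * indicator (- {- real n..real n}) t = 0"
        unfolding eventually_sequentially by (intro exI[of _ "nat \<lceil>\<bar>t\<bar>\<rceil>"]) (auto simp: indicator_def)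
      then show "(\<lambda>n. ennreal ((cmod (g t))\<^sup>2) * indicator (- {- real n..real n}) t) \<longlonglongrightarrow> 0"
        by (rule tendsto_eventually)
    qed
  qed auto
  then have tail: "(\<lambda>n. ?n g (- {- real n..real n})) \<longlonglongrightarrow> 0" by simp
  have "?n g UNIV \<le> ennreal M * (?n g (- T) + ?n (fourier g) (- U))"
  proof (rule ennreal_le_epsilon)
    fix e :: real assume e: "e > 0"
    have "\<forall>\<^sub>F n in sequentially. ?n g (- {- real n..real n}) < ennreal (e / M)"
      by (rule order_tendstoD[OF tail]) (use e D in simp)
    moreover have "\<forall>\<^sub>F n in sequentially. n > (0::nat)" by (rule eventually_gt_at_top)
    ultimately have "\<forall>\<^sub>F n in sequentially. n > 0 \<and> ?n g (- {- real n..real n}) < ennreal (e / M)"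
      by eventually_elim simp
    then obtain n where n: "n > 0" "?n g (- {- real n..real n}) < ennreal (e / M)"
      by (metis (mono_tags, lifting) eventually_sequentially order_refl)
    have "?n g UNIV \<le> ennreal M * ((?n g (- T) + ?n g (- {- real n..real n})) + ?n (fourier g) (- U))"
      by (rule bound) (use n in simp)
    also have "\<dots> \<le> ennreal M * ((?n g (- T) + ennreal (e / M)) + ?n (fourier g) (- U))"
      by (intro mult_left_mono add_mono order_refl less_imp_le[OF n(2)]) simp
    also have "\<dots> = ennreal M * (?n g (- T) + ?n (fourier g) (- U)) + ennreal M * ennreal (e / M)"
      by (simp add: distrib_left add_ac)
    also have "ennreal M * ennreal (e / M) = ennreal e"
      using D(2) e by (subst ennreal_mult''[symmetric]) auto
    finally show "?n g UNIV \<le> ennreal M * (?n g (- T) + ?n (fourier g) (- U)) + ennreal e" .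
  qed
  then show ?thesis by (simp add: M_def)
qed

text \<open>With \<open>x = 8 \<tau> u + 4\<close>, the estimates \<open>256 \<le> exp 8\<close> and \<open>x\<^sup>2 \<le> 2 exp x\<close> bound the left-hand side by
\<open>7 exp (9 x + 8) = 7 exp 44 exp (72 \<tau> u)\<close>, and \<open>72 \<le> 7 exp 44\<close>.\<close>

lemma decay_const_le_exp:
  assumes "\<tau> > 0" "u \<ge> 0"
  shows "3 + 2 * u * decay_const (2 * \<tau>) u \<le> 7 * exp 44 * exp (7 * exp 44 * \<tau> * u)"
proof -
  define x where "x = 8 * \<tau> * u + 4"
  have x: "x \<ge> 4" unfolding x_def using assms by simp
  have e1: "(2::real) \<le> exp 1" using exp_ge_add_one_self[of 1] by simp
  have "(256::real) powr (x + 1) = (2 powr 8) powr (x + 1)" by simp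
  also have "\<dots> = 2 powr (8 * (x + 1))" by (simp only: powr_powr)
  also have "\<dots> \<le> exp 1 powr (8 * (x + 1))" by (rule powr_mono2) (use e1 x in auto)
  also have "\<dots> = exp (8 * (x + 1))" by (simp add: exp_powr_real)
  finally have p: "256 powr (x + 1) \<le> exp (8 * (x + 1))" .
  have x2: "x\<^sup>2 \<le> 2 * exp x"
    using exp_lower_Taylor_quadratic[of x] x by simp
  have "2 * u * decay_const (2 * \<tau>) u = 4 * (256 powr (x + 1) * x * (4 * \<tau> * u))"
    by (simp add: decay_const_def x_def algebra_simps)
  also have "\<dots> \<le> 4 * (256 powr (x + 1) * x * (x / 2))"
    using x assms by (intro mult_left_mono) (auto simp: x_def)
  also have "\<dots> = 2 * (256 powr (x + 1) * x\<^sup>2)" by (simp add: power2_eq_square)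
  also have "\<dots> \<le> 2 * (exp (8 * (x + 1)) * (2 * exp x))"
    by (intro mult_left_mono mult_mono p x2) auto
  also have "\<dots> = 4 * exp (9 * x + 8)" by (simp add: exp_add[symmetric] algebra_simps)
  finally have "2 * u * decay_const (2 * \<tau>) u \<le> 4 * exp (9 * x + 8)" .
  moreover have "1 \<le> exp (9 * x + 8)" using x by simp
  ultimately have "3 + 2 * u * decay_const (2 * \<tau>) u \<le> 7 * exp (9 * x + 8)" by linarith
  also have "exp (9 * x + 8) = exp 44 * exp (72 * (\<tau> * u))"
    by (simp add: x_def exp_add[symmetric] algebra_simps)
  also have "\<dots> \<le> exp 44 * exp (7 * exp 44 * (\<tau> * u))"
  proof -
    have "72 \<le> 7 * exp (44::real)" using exp_ge_add_one_self[of 44] by simp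
    then show ?thesis using assms by (simp add: mult_right_mono)
  qed
  finally show ?thesis by (simp add: mult.assoc)
qed

text \<open>The scale \<open>a = 2 \<tau>\<close> turns \<open>a u\<close> into a multiple of the product \<open>\<tau> u\<close>, while periodizations of functions on \<open>T\<close>
still vanish on half of the circle. A null set \<open>T\<close> has no such scale, but then the first integral on the right is everything.\<close>

theorem nazarov_uncertainty:
  assumes g [measurable]: "g \<in> borel_measurable borel" and int: "integrable lborel g"
    and L2: "(\<integral>\<^sup>+ t. ennreal ((cmod (g t))\<^sup>2) \<partial>lborel) < \<infinity>"
    and T [measurable]: "T \<in> sets borel" and \<tau>: "\<tau> \<ge> 0" "emeasure lborel T \<le> ennreal \<tau>"
    and U [measurable]: "U \<in> sets borel" and u: "u \<ge> 0" "emeasure lborel U \<le> ennreal u"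
  shows "(\<integral>\<^sup>+ t. ennreal ((cmod (g t))\<^sup>2) \<partial>lborel) \<le> ennreal (7 * exp 44 * exp (7 * exp 44 * \<tau> * u)) *
    ((\<integral>\<^sup>+ t\<in>- T. ennreal ((cmod (g t))\<^sup>2) \<partial>lborel) + (\<integral>\<^sup>+ x\<in>- U. ennreal ((cmod (fourier g x))\<^sup>2) \<partial>lborel))"
    (is "?L \<le> ennreal ?C * (?A + ?B)")
proof (cases "\<tau> = 0")
  case True
  then have "T \<in> null_sets lborel" using \<tau> by (auto simp: null_sets_def)
  then have "AE t in lborel. t \<notin> T" by (rule AE_not_in)
  then have "?L = ?A" by (intro nn_integral_cong_AE) (auto elim: eventually_mono)
  also have "?A \<le> ?A + ?B" by simp
  also have "\<dots> = ennreal 1 * (?A + ?B)" by simp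
  also have "\<dots> \<le> ennreal ?C * (?A + ?B)"
  proof (intro mult_right_mono ennreal_leI)
    have "1 \<le> exp (44::real)" by simp
    then have "1 \<le> 7 * exp (44::real)" by linarith
    then show "1 \<le> ?C" using True by simp
  qed simp
  finally show ?thesis .
next
  case False
  then have "\<tau> > 0" using \<tau> by simp
  have "?L \<le> ennreal (3 + 2 * u * decay_const (2 * \<tau>) u) * (?A + ?B)"
    by (rule nazarov_uncertainty_scale[OF g int L2 _ T _ U u]) (use \<tau> \<open>\<tau> > 0\<close> in auto)
  also have "\<dots> \<le> ennreal ?C * (?A + ?B)"
    by (intro mult_right_mono ennreal_leI decay_const_le_exp u) (use \<open>\<tau> > 0\<close> in auto)
  finally show ?thesis .
qed

section \<open>The windowed offset linear canonical transform\<close>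

text \<open>The chirp carries the factors of the kernel that depend on \<open>t\<close> alone. What remains is the Fourier kernel and a
factor that depends only on the frequency.\<close>

definition chirp_product :: "real \<Rightarrow> real \<Rightarrow> real \<Rightarrow> (real \<Rightarrow> complex) \<Rightarrow> (real \<Rightarrow> complex) \<Rightarrow> real \<Rightarrow> real \<Rightarrow> complex" where
  "chirp_product a b u0 f \<phi> w t = f t * cnj (\<phi> (t - w)) * cis (a / (2 * b) * t\<^sup>2 + t * u0 / b)"

lemma olct_kernel_eq:
  assumes b: "b \<noteq> 0"
  obtains \<kappa> where "\<And>t. olct_kernel (a, b, c, d, u0, w0) t (2 * pi * b * x)
     = \<kappa> * (cis (a / (2 * b) * t\<^sup>2 + t * u0 / b) * cis (- (2 * pi * (x * t))))"
    "(cmod \<kappa>)\<^sup>2 = 1 / (2 * pi * \<bar>b\<bar>)"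
proof
  define v where "v = 2 * pi * b * x"
  define r where "r = d / (2 * b) * (v\<^sup>2 + u0\<^sup>2) - 1 / b * v * (d * u0 - b * w0)"
  define k where "k = 1 / csqrt (\<i> * of_real (2 * pi * b))"
  show "olct_kernel (a, b, c, d, u0, w0) t (2 * pi * b * x)
     = (k * cis r) * (cis (a / (2 * b) * t\<^sup>2 + t * u0 / b) * cis (- (2 * pi * (x * t))))" for t
  proof -
    have "olct_kernel (a, b, c, d, u0, w0) t v = k * exp (\<i> * of_real (a / (2 * b) * t\<^sup>2 - 1 / b * t * (v - u0)
        - 1 / b * v * (d * u0 - b * w0) + d / (2 * b) * (v\<^sup>2 + u0\<^sup>2)))"
      unfolding olct_kernel.simps k_def by (simp only: of_real_add of_real_diff ring_distribs)
    also have "a / (2 * b) * t\<^sup>2 - 1 / b * t * (v - u0) - 1 / b * v * (d * u0 - b * w0) + d / (2 * b) * (v\<^sup>2 + u0\<^sup>2)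
        = r + ((a / (2 * b) * t\<^sup>2 + t * u0 / b) + - (2 * pi * (x * t)))"
    proof -
      have "1 / b * t * (v - u0) = 2 * pi * (x * t) - t * u0 / b" using b by (simp add: v_def field_simps)
      then show ?thesis by (simp add: r_def)
    qed
    finally show ?thesis
      by (simp only: cis_conv_exp[symmetric] cis_mult[symmetric] v_def mult.assoc)
  qed
  have "(cmod (csqrt (\<i> * of_real (2 * pi * b))))\<^sup>2 = cmod (\<i> * of_real (2 * pi * b))"
    by (metis norm_power power2_csqrt)
  then have "(cmod (csqrt (\<i> * of_real (2 * pi * b))))\<^sup>2 = 2 * pi * \<bar>b\<bar>"
    by (simp add: norm_mult abs_mult)
  then show "(cmod (k * cis r))\<^sup>2 = 1 / (2 * pi * \<bar>b\<bar>)"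
    by (simp add: k_def norm_mult norm_divide power_divide)
qed

lemma borel_measurable_chirp_product [measurable]:
  assumes [measurable]: "f \<in> borel_measurable borel" "\<phi> \<in> borel_measurable borel"
  shows "(\<lambda>p. chirp_product a b u0 f \<phi> (fst p) (snd p)) \<in> borel_measurable (borel \<Otimes>\<^sub>M borel)"
    "chirp_product a b u0 f \<phi> w \<in> borel_measurable borel"
  unfolding chirp_product_def by measurable

lemma cmod_wolct:
  assumes [measurable]: "f \<in> borel_measurable borel" "\<phi> \<in> borel_measurable borel" and b: "b \<noteq> 0"
  shows "(cmod (wolct (a, b, c, d, u0, w0) \<phi> f (2 * pi * b * x) w))\<^sup>2
     = 1 / (2 * pi * \<bar>b\<bar>) * (cmod (fourier (chirp_product a b u0 f \<phi> w) x))\<^sup>2"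
proof -
  obtain \<kappa> where \<kappa>: "\<And>t. olct_kernel (a, b, c, d, u0, w0) t (2 * pi * b * x)
     = \<kappa> * (cis (a / (2 * b) * t\<^sup>2 + t * u0 / b) * cis (- (2 * pi * (x * t))))"
    "(cmod \<kappa>)\<^sup>2 = 1 / (2 * pi * \<bar>b\<bar>)"
    using olct_kernel_eq[OF b] by blast
  have eq: "f t * cnj (\<phi> (t - w)) * olct_kernel (a, b, c, d, u0, w0) t (2 * pi * b * x)
     = \<kappa> * (chirp_product a b u0 f \<phi> w t * cis (- (2 * pi * (x * t))))" for t
    unfolding \<kappa>(1) chirp_product_def by (simp add: mult_ac)
  have "wolct (a, b, c, d, u0, w0) \<phi> f (2 * pi * b * x) w
     = (LINT t|lborel. \<kappa> * (chirp_product a b u0 f \<phi> w t * cis (- (2 * pi * (x * t)))))"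
    unfolding wolct_def eq by (rule integral_completion) measurable
  also have "\<dots> = \<kappa> * fourier (chirp_product a b u0 f \<phi> w) x"
    by (simp add: fourier_def)
  finally show ?thesis by (simp add: norm_mult power_mult_distrib \<kappa>(2))
qed

lemma integrable_chirp_product:
  assumes [measurable]: "f \<in> borel_measurable borel" "\<phi> \<in> borel_measurable borel"
    and "(\<integral>\<^sup>+ t. ennreal ((cmod (f t))\<^sup>2) \<partial>lborel) < \<infinity>" "(\<integral>\<^sup>+ t. ennreal ((cmod (\<phi> t))\<^sup>2) \<partial>lborel) < \<infinity>"
  shows "integrable lborel (chirp_product a b u0 f \<phi> w)"
proof (rule Bochner_Integration.integrable_bound)
  have f: "integrable lborel (\<lambda>t. (cmod (f t))\<^sup>2)" and \<phi>: "integrable lborel (\<lambda>t. (cmod (\<phi> t))\<^sup>2)"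
    using assms by (auto intro!: integrableI_bounded)
  have "integrable lborel (\<lambda>t. (cmod (\<phi> (- w + 1 * t)))\<^sup>2)"
    by (rule lborel_integrable_real_affine[OF \<phi>]) simp
  then show "integrable lborel (\<lambda>t. (cmod (f t))\<^sup>2 + (cmod (\<phi> (t - w)))\<^sup>2)"
    using f by (intro Bochner_Integration.integrable_add) (auto simp: algebra_simps)
  show "AE t in lborel. norm (chirp_product a b u0 f \<phi> w t) \<le> norm ((cmod (f t))\<^sup>2 + (cmod (\<phi> (t - w)))\<^sup>2)"
  proof (rule AE_I2)
    fix t
    have "2 * (cmod (f t) * cmod (\<phi> (t - w))) \<le> (cmod (f t))\<^sup>2 + (cmod (\<phi> (t - w)))\<^sup>2"
      using sum_squares_bound[of "cmod (f t)" "cmod (\<phi> (t - w))"] by (simp add: mult.assoc)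
    moreover have "0 \<le> cmod (f t) * cmod (\<phi> (t - w))" by simp
    ultimately have "cmod (f t) * cmod (\<phi> (t - w)) \<le> (cmod (f t))\<^sup>2 + (cmod (\<phi> (t - w)))\<^sup>2" by linarith
    then show "norm (chirp_product a b u0 f \<phi> w t) \<le> norm ((cmod (f t))\<^sup>2 + (cmod (\<phi> (t - w)))\<^sup>2)"
      by (simp add: chirp_product_def norm_mult)
  qed
qed simp

lemma nn_integral_chirp_product:
  assumes [measurable]: "f \<in> borel_measurable borel" "\<phi> \<in> borel_measurable borel" "S \<in> sets borel"
  shows "(\<integral>\<^sup>+ w. (\<integral>\<^sup>+ t\<in>S. ennreal ((cmod (chirp_product a b u0 f \<phi> w t))\<^sup>2) \<partial>lborel) \<partial>lborel)
     = (\<integral>\<^sup>+ t. ennreal ((cmod (\<phi> t))\<^sup>2) \<partial>lborel) * (\<integral>\<^sup>+ t\<in>S. ennreal ((cmod (f t))\<^sup>2) \<partial>lborel)"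
proof -
  let ?\<Phi> = "\<integral>\<^sup>+ t. ennreal ((cmod (\<phi> t))\<^sup>2) \<partial>lborel"
  have "(\<integral>\<^sup>+ w. (\<integral>\<^sup>+ t\<in>S. ennreal ((cmod (chirp_product a b u0 f \<phi> w t))\<^sup>2) \<partial>lborel) \<partial>lborel)
     = (\<integral>\<^sup>+ w. (\<integral>\<^sup>+ t. (ennreal ((cmod (f t))\<^sup>2) * indicator S t) * ennreal ((cmod (\<phi> (t - w)))\<^sup>2) \<partial>lborel) \<partial>lborel)"
    by (intro nn_integral_cong) (simp add: chirp_product_def norm_mult power_mult_distrib ennreal_mult mult_ac)
  also have "\<dots> = (\<integral>\<^sup>+ t. (\<integral>\<^sup>+ w. (ennreal ((cmod (f t))\<^sup>2) * indicator S t) * ennreal ((cmod (\<phi> (t - w)))\<^sup>2) \<partial>lborel) \<partial>lborel)"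
    by (rule lborel_pair.Fubini') measurable
  also have "\<dots> = (\<integral>\<^sup>+ t. ?\<Phi> * (ennreal ((cmod (f t))\<^sup>2) * indicator S t) \<partial>lborel)"
  proof (rule nn_integral_cong)
    fix t
    have "(\<integral>\<^sup>+ w. ennreal ((cmod (\<phi> (t - w)))\<^sup>2) \<partial>lborel) = ?\<Phi>"
      using nn_integral_real_affine[of "\<lambda>x. ennreal ((cmod (\<phi> x))\<^sup>2)" "- 1" t] by simp
    then show "(\<integral>\<^sup>+ w. (ennreal ((cmod (f t))\<^sup>2) * indicator S t) * ennreal ((cmod (\<phi> (t - w)))\<^sup>2) \<partial>lborel)
       = ?\<Phi> * (ennreal ((cmod (f t))\<^sup>2) * indicator S t)"
      by (subst nn_integral_cmult) (auto simp: mult.commute)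
  qed
  also have "\<dots> = ?\<Phi> * (\<integral>\<^sup>+ t\<in>S. ennreal ((cmod (f t))\<^sup>2) \<partial>lborel)"
    by (rule nn_integral_cmult) measurable
  finally show ?thesis .
qed

lemma lebesgue_measurable_complex_ex_borel:
  fixes f :: "real \<Rightarrow> complex"
  assumes [measurable]: "f \<in> borel_measurable lebesgue"
  obtains g where "g \<in> borel_measurable borel" "AE t in lborel. f t = g t"
proof -
  have "(\<lambda>t. Re (f t)) \<in> borel_measurable lebesgue" "(\<lambda>t. Im (f t)) \<in> borel_measurable lebesgue"
    by measurable
  then obtain p q where p: "p \<in> borel_measurable lborel" "AE t in lborel. Re (f t) = p t"
    and q: "q \<in> borel_measurable lborel" "AE t in lborel. Im (f t) = q t"
    using completion_ex_borel_measurable_real by metis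
  show thesis
  proof
    show "(\<lambda>t. Complex (p t) (q t)) \<in> borel_measurable borel"
      using p(1) q(1) unfolding Complex_eq by simp
    show "AE t in lborel. f t = Complex (p t) (q t)"
      using p(2) q(2) by eventually_elim (simp add: complex_eq_iff)
  qed
qed

lemma AE_translate:
  fixes P :: "real \<Rightarrow> bool"
  assumes "AE t in lborel. P t" shows "AE t in lborel. P (t - w)"
proof -
  obtain N where N: "N \<in> null_sets lborel" "{t \<in> space lborel. \<not> P t} \<subseteq> N"
    using assms by (rule AE_E3) auto
  have [measurable]: "N \<in> sets borel" using N(1) by auto
  have "AE t in lborel. (- w) + 1 * t \<notin> N"
    by (rule AE_borel_affine[where P = "\<lambda>t. t \<notin> N"]) (use AE_not_in[OF N(1)] in auto)
  then show ?thesis by eventually_elim (use N(2) in auto)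
qed

text \<open>Lebesgue measurable data may be replaced by Borel measurable ones, for which Tonelli's theorem on the plane is
available; the transform does not change at any point.\<close>

lemma wolct_cong_AE:
  assumes f: "f \<in> borel_measurable lebesgue" "AE t in lborel. f t = f' t" "f' \<in> borel_measurable borel"
    and \<phi>: "\<phi> \<in> borel_measurable lebesgue" "AE t in lborel. \<phi> t = \<phi>' t" "\<phi>' \<in> borel_measurable borel"
  shows "wolct (a, b, c, d, u0, w0) \<phi> f u w = wolct (a, b, c, d, u0, w0) \<phi>' f' u w"
  unfolding wolct_def
proof (rule integral_cong_AE)
  have tr: "(\<lambda>t. t - w) \<in> lebesgue \<rightarrow>\<^sub>M lebesgue"
    using lebesgue_affine_measurable[of "\<lambda>_::real. 1" "- w"] by simp
  have [measurable]: "(\<lambda>t. \<phi> (t - w)) \<in> borel_measurable lebesgue"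
    by (rule measurable_compose[OF tr \<phi>(1)])
  have [measurable]: "(\<lambda>t. olct_kernel (a, b, c, d, u0, w0) t u) \<in> borel_measurable lebesgue"
  proof (rule measurable_completion)
    have "(\<lambda>t. olct_kernel (a, b, c, d, u0, w0) t u) \<in> borel_measurable borel"
      unfolding olct_kernel.simps by (intro borel_measurable_continuous_onI continuous_intros) 
    then show "(\<lambda>t. olct_kernel (a, b, c, d, u0, w0) t u) \<in> borel_measurable lborel" by simp
  qed
  note [measurable] = f(1)
  show "(\<lambda>t. f t * cnj (\<phi> (t - w)) * olct_kernel (a, b, c, d, u0, w0) t u) \<in> borel_measurable lebesgue"
    by measurable
  have [measurable]: "f' \<in> borel_measurable lebesgue" "(\<lambda>t. \<phi>' (t - w)) \<in> borel_measurable lebesgue"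
    using f(3) \<phi>(3) by (auto intro!: measurable_completion)
  show "(\<lambda>t. f' t * cnj (\<phi>' (t - w)) * olct_kernel (a, b, c, d, u0, w0) t u) \<in> borel_measurable lebesgue"
    by measurable
  show "AE t in lebesgue. f t * cnj (\<phi> (t - w)) * olct_kernel (a, b, c, d, u0, w0) t u
     = f' t * cnj (\<phi>' (t - w)) * olct_kernel (a, b, c, d, u0, w0) t u"
  proof (rule AE_completion)
    show "AE t in lborel. f t * cnj (\<phi> (t - w)) * olct_kernel (a, b, c, d, u0, w0) t u
     = f' t * cnj (\<phi>' (t - w)) * olct_kernel (a, b, c, d, u0, w0) t u"
      using f(2) AE_translate[OF \<phi>(2), of w] by eventually_elim simp
  qed
qed

text \<open>The substitution \<open>u = 2\<pi>b x\<close>, whose Jacobian cancels the factor of the kernel. The set \<open>W\<close>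
stands for a Borel version of \<open>U / (2\<pi>)\<close>.\<close>

lemma wolct_frequency_integral:
  assumes [measurable]: "f \<in> borel_measurable borel" "\<phi> \<in> borel_measurable borel" and b: "b \<noteq> 0"
    and U [measurable]: "U \<in> sets lebesgue" and [measurable]: "W \<in> sets borel" and W: "AE x in lborel. x \<in> W \<longleftrightarrow> 2 * pi * x \<in> U"
  shows "(\<integral>\<^sup>+ u \<in> - ((\<lambda>u. u * b) ` U). ennreal ((cmod (wolct (a, b, c, d, u0, w0) \<phi> f u w))\<^sup>2) \<partial>lebesgue)
     = (\<integral>\<^sup>+ x\<in>- W. ennreal ((cmod (fourier (chirp_product a b u0 f \<phi> w) x))\<^sup>2) \<partial>lborel)"
proof -
  let ?V = "\<lambda>u. wolct (a, b, c, d, u0, w0) \<phi> f u w"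
  let ?F = "fourier (chirp_product a b u0 f \<phi> w)"
  define \<rho> where "\<rho> = 2 * pi * b"
  have \<rho>: "\<rho> \<noteq> 0" "\<bar>\<rho>\<bar> = 2 * pi * \<bar>b\<bar>" using b by (auto simp: \<rho>_def abs_mult)
  have V: "(cmod (?V u))\<^sup>2 = 1 / \<bar>\<rho>\<bar> * (cmod (?F (u / \<rho>)))\<^sup>2" for u
  proof -
    have "2 * pi * b * (u / \<rho>) = u" using b by (simp add: \<rho>_def)
    then show ?thesis using cmod_wolct[OF assms(1,2) b, of a c d u0 w0 "u / \<rho>" w] \<rho>(2) by simp
  qed
  have img: "(\<lambda>u. u * b) ` U = (\<lambda>u. u / b) -` U"
    using b by (force simp: image_iff)
  have "(\<lambda>u. (1 / b) *\<^sub>R u) \<in> lebesgue \<rightarrow>\<^sub>M (lebesgue :: real measure)" by (rule lebesgue_measurable_scaling)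
  from measurable_sets[OF this U] have [measurable]: "(\<lambda>u. u * b) ` U \<in> sets lebesgue"
    unfolding img by simp
  have [measurable]: "(\<lambda>u. ennreal ((cmod (?V u))\<^sup>2)) \<in> borel_measurable lebesgue"
    unfolding V by (rule measurable_completion) measurable
  have mem: "\<rho> * x \<in> (\<lambda>u. u * b) ` U \<longleftrightarrow> 2 * pi * x \<in> U" for x
    unfolding img using b by (simp add: \<rho>_def mult.assoc)
  have "(\<integral>\<^sup>+ u \<in> - ((\<lambda>u. u * b) ` U). ennreal ((cmod (?V u))\<^sup>2) \<partial>lebesgue)
     = ennreal \<bar>\<rho>\<bar> * (\<integral>\<^sup>+ x. ennreal ((cmod (?V (0 + \<rho> * x)))\<^sup>2) * indicator (- ((\<lambda>u. u * b) ` U)) (0 + \<rho> * x) \<partial>lebesgue)"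
    by (rule nn_integral_real_affine_lebesgue) (measurable, rule \<rho>)
  also have "\<dots> = ennreal \<bar>\<rho>\<bar> * (\<integral>\<^sup>+ x. ennreal ((cmod (?V (0 + \<rho> * x)))\<^sup>2) * indicator (- ((\<lambda>u. u * b) ` U)) (0 + \<rho> * x) \<partial>lborel)"
    by (simp only: nn_integral_completion)
  also have "(\<integral>\<^sup>+ x. ennreal ((cmod (?V (0 + \<rho> * x)))\<^sup>2) * indicator (- ((\<lambda>u. u * b) ` U)) (0 + \<rho> * x) \<partial>lborel)
     = (\<integral>\<^sup>+ x. ennreal (1 / \<bar>\<rho>\<bar>) * (ennreal ((cmod (?F x))\<^sup>2) * indicator (- ((\<lambda>u. u * b) ` U)) (\<rho> * x)) \<partial>lborel)"
    unfolding V
  proof (rule nn_integral_cong)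
    fix x
    have "ennreal (1 / \<bar>\<rho>\<bar> * (cmod (?F ((0 + \<rho> * x) / \<rho>)))\<^sup>2) = ennreal (1 / \<bar>\<rho>\<bar>) * ennreal ((cmod (?F x))\<^sup>2)"
      using \<rho>(1) by (subst ennreal_mult') auto
    then show "ennreal (1 / \<bar>\<rho>\<bar> * (cmod (?F ((0 + \<rho> * x) / \<rho>)))\<^sup>2) * indicator (- ((\<lambda>u. u * b) ` U)) (0 + \<rho> * x)
       = ennreal (1 / \<bar>\<rho>\<bar>) * (ennreal ((cmod (?F x))\<^sup>2) * indicator (- ((\<lambda>u. u * b) ` U)) (\<rho> * x))"
      by (simp only: mult.assoc add_0)
  qed
  also have "\<dots> = (\<integral>\<^sup>+ x. ennreal (1 / \<bar>\<rho>\<bar>) * (ennreal ((cmod (?F x))\<^sup>2) * indicator (- {x. 2 * pi * x \<in> U}) x) \<partial>lborel)"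
    by (intro nn_integral_cong) (simp add: indicator_def mem)
  also have "\<dots> = (\<integral>\<^sup>+ x. ennreal (1 / \<bar>\<rho>\<bar>) * (ennreal ((cmod (?F x))\<^sup>2) * indicator (- W) x) \<partial>lborel)"
    by (rule nn_integral_cong_AE) (use W in \<open>auto elim!: eventually_mono simp: indicator_def\<close>)
  also have "ennreal \<bar>\<rho>\<bar> * \<dots> = (\<integral>\<^sup>+ x. ennreal \<bar>\<rho>\<bar> * (ennreal (1 / \<bar>\<rho>\<bar>) * (ennreal ((cmod (?F x))\<^sup>2) * indicator (- W) x)) \<partial>lborel)"
    by (rule nn_integral_cmult[symmetric]) measurable
  also have "\<dots> = (\<integral>\<^sup>+ x\<in>- W. ennreal ((cmod (?F x))\<^sup>2) \<partial>lborel)"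
    using \<rho>(1) by (intro nn_integral_cong) (simp add: mult.assoc[symmetric] ennreal_mult''[symmetric])
  finally show ?thesis .
qed

text \<open>The slices \<open>chirp_product a b u0 f \<phi> w\<close> are integrable for all \<open>w\<close>, but square integrable only for almost all
\<open>w\<close>, by Tonelli; there the uncertainty principle applies, with a constant that does not depend on \<open>w\<close>.\<close>

lemma wolct_uncertainty_borel:
  assumes f [measurable]: "f \<in> borel_measurable borel" and \<phi> [measurable]: "\<phi> \<in> borel_measurable borel"
    and L2: "(\<integral>\<^sup>+ t. ennreal ((cmod (f t))\<^sup>2) \<partial>lborel) < \<infinity>" "(\<integral>\<^sup>+ t. ennreal ((cmod (\<phi> t))\<^sup>2) \<partial>lborel) < \<infinity>"
    and T [measurable]: "T \<in> sets borel" and \<tau>: "\<tau> \<ge> 0" "emeasure lborel T \<le> ennreal \<tau>"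
    and W [measurable]: "W \<in> sets borel" and u: "u \<ge> 0" "emeasure lborel W \<le> ennreal u"
  shows "(\<integral>\<^sup>+ t. ennreal ((cmod (\<phi> t))\<^sup>2) \<partial>lborel) * (\<integral>\<^sup>+ t. ennreal ((cmod (f t))\<^sup>2) \<partial>lborel)
    \<le> ennreal (7 * exp 44 * exp (7 * exp 44 * \<tau> * u)) *
     ((\<integral>\<^sup>+ t. ennreal ((cmod (\<phi> t))\<^sup>2) \<partial>lborel) * (\<integral>\<^sup>+ t\<in>- T. ennreal ((cmod (f t))\<^sup>2) \<partial>lborel)
      + (\<integral>\<^sup>+ w. (\<integral>\<^sup>+ x\<in>- W. ennreal ((cmod (fourier (chirp_product a b u0 f \<phi> w) x))\<^sup>2) \<partial>lborel) \<partial>lborel))"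
proof -
  let ?C = "ennreal (7 * exp 44 * exp (7 * exp 44 * \<tau> * u))"
  let ?g = "chirp_product a b u0 f \<phi>"
  define K where "K = (\<lambda>S w. \<integral>\<^sup>+ t\<in>S. ennreal ((cmod (?g w t))\<^sup>2) \<partial>lborel)"
  define J where "J = (\<lambda>w. \<integral>\<^sup>+ x\<in>- W. ennreal ((cmod (fourier (?g w) x))\<^sup>2) \<partial>lborel)"
  have K [measurable]: "K S \<in> borel_measurable borel" if [measurable]: "S \<in> sets borel" for S
    unfolding K_def chirp_product_def by measurable
  have J [measurable]: "J \<in> borel_measurable borel"
    unfolding J_def fourier_def chirp_product_def by measurable
  have intK: "(\<integral>\<^sup>+ w. K S w \<partial>lborel) = (\<integral>\<^sup>+ t. ennreal ((cmod (\<phi> t))\<^sup>2) \<partial>lborel) * (\<integral>\<^sup>+ t\<in>S. ennreal ((cmod (f t))\<^sup>2) \<partial>lborel)"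
    if "S \<in> sets borel" for S
    unfolding K_def by (rule nn_integral_chirp_product[OF f \<phi> that])
  have "(\<integral>\<^sup>+ w. K UNIV w \<partial>lborel) \<noteq> \<infinity>"
    using L2 by (subst intK) (auto simp: ennreal_mult_eq_top_iff)
  then have "AE w in lborel. K UNIV w \<noteq> \<infinity>"
    by (intro nn_integral_PInf_AE) auto
  then have "AE w in lborel. K UNIV w \<le> ?C * (K (- T) w + J w)"
  proof eventually_elim
    case (elim w)
    have "(\<integral>\<^sup>+ t. ennreal ((cmod (?g w t))\<^sup>2) \<partial>lborel) < \<infinity>" using elim by (simp add: K_def less_top)
    from nazarov_uncertainty[OF _ integrable_chirp_product[OF f \<phi> L2] this T \<tau> W u]
    show ?case by (simp add: K_def J_def)
  qed
  then have "(\<integral>\<^sup>+ w. K UNIV w \<partial>lborel) \<le> (\<integral>\<^sup>+ w. ?C * (K (- T) w + J w) \<partial>lborel)"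
    by (rule nn_integral_mono_AE)
  also have "\<dots> = ?C * ((\<integral>\<^sup>+ w. K (- T) w \<partial>lborel) + (\<integral>\<^sup>+ w. J w \<partial>lborel))"
    by (subst nn_integral_cmult) (auto simp: nn_integral_add)
  finally show ?thesis by (simp add: intK J_def)
qed

theorem theorem7:
  shows "\<exists>C::real. C > 0 \<and>
    (\<forall>(a::real) (b::real) (c::real) (d::real) (u0::real) (w0::real)
       (\<phi>::real \<Rightarrow> complex) (f::real \<Rightarrow> complex) (T::real set) (U::real set).
       a * d - b * c = 1 \<longrightarrow> b \<noteq> 0 \<longrightarrow>
       square_integrable \<phi> \<longrightarrow> \<not> (AE t in lebesgue. \<phi> t = 0) \<longrightarrow>
       square_integrable f \<longrightarrow>
       T \<in> lmeasurable \<longrightarrow> U \<in> lmeasurable \<longrightarrow>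
       ennreal ((L2_norm \<phi>)\<^sup>2) * (\<integral>\<^sup>+ t. ennreal ((cmod (f t))\<^sup>2) \<partial>lebesgue)
       \<le> ennreal (C * exp (C * measure lebesgue T * measure lebesgue U)) *
         (ennreal ((L2_norm \<phi>)\<^sup>2) * (\<integral>\<^sup>+ t \<in> - T. ennreal ((cmod (f t))\<^sup>2) \<partial>lebesgue)
          + (\<integral>\<^sup>+ w. (\<integral>\<^sup>+ u \<in> - ((\<lambda>u. u * b) ` U).
               ennreal ((cmod (wolct (a, b, c, d, u0, w0) \<phi> f u w))\<^sup>2) \<partial>lebesgue) \<partial>lebesgue)))"
proof (intro exI[of _ "7 * exp 44"] conjI allI impI)
  fix a b c d u0 w0 :: real and \<phi> f :: "real \<Rightarrow> complex" and T U :: "real set"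
  assume b: "b \<noteq> 0" and \<phi>: "square_integrable \<phi>" and f: "square_integrable f"
    and T: "T \<in> lmeasurable" and U: "U \<in> lmeasurable"
  have \<phi>_meas: "\<phi> \<in> borel_measurable lebesgue" and f_meas: "f \<in> borel_measurable lebesgue"
    using \<phi> f by (auto simp: square_integrable_def)
  obtain \<phi>' where \<phi>': "\<phi>' \<in> borel_measurable borel" "AE t in lborel. \<phi> t = \<phi>' t"
    by (rule lebesgue_measurable_complex_ex_borel[OF \<phi>_meas])
  obtain f' where f': "f' \<in> borel_measurable borel" "AE t in lborel. f t = f' t"
    by (rule lebesgue_measurable_complex_ex_borel[OF f_meas])
  have norm_eq: "ennreal ((L2_norm g)\<^sup>2) = (\<integral>\<^sup>+ t. ennreal ((cmod (g t))\<^sup>2) \<partial>lborel)" if "square_integrable g" for g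
  proof -
    have "(\<integral>\<^sup>+ t. ennreal ((cmod (g t))\<^sup>2) \<partial>lebesgue) = ennreal (LINT t|lebesgue. (cmod (g t))\<^sup>2)"
      using that by (intro nn_integral_eq_integral) (auto simp: square_integrable_def)
    then show ?thesis
      by (simp add: L2_norm_def nn_integral_completion)
  qed
  have cong: "(\<integral>\<^sup>+ t\<in>S. ennreal ((cmod (g t))\<^sup>2) \<partial>lborel) = (\<integral>\<^sup>+ t\<in>S'. ennreal ((cmod (g' t))\<^sup>2) \<partial>lborel)"
    if "AE t in lborel. g t = g' t" "AE t in lborel. t \<in> S \<longleftrightarrow> t \<in> S'" for g g' :: "real \<Rightarrow> complex" and S S'
    by (rule nn_integral_cong_AE) (use that in \<open>eventually_elim, simp add: indicator_def\<close>)
  have \<phi>_norm: "ennreal ((L2_norm \<phi>)\<^sup>2) = (\<integral>\<^sup>+ t. ennreal ((cmod (\<phi>' t))\<^sup>2) \<partial>lborel)"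
    unfolding norm_eq[OF \<phi>] using cong[OF \<phi>'(2), of UNIV UNIV] by simp
  have f_norm: "(\<integral>\<^sup>+ t. ennreal ((cmod (f t))\<^sup>2) \<partial>lborel) = (\<integral>\<^sup>+ t. ennreal ((cmod (f' t))\<^sup>2) \<partial>lborel)"
    using cong[OF f'(2), of UNIV UNIV] by simp
  have L2: "(\<integral>\<^sup>+ t. ennreal ((cmod (f' t))\<^sup>2) \<partial>lborel) < \<infinity>" "(\<integral>\<^sup>+ t. ennreal ((cmod (\<phi>' t))\<^sup>2) \<partial>lborel) < \<infinity>"
    unfolding \<phi>_norm[symmetric] f_norm[symmetric] norm_eq[OF f, symmetric] by simp_all
  have T_sets: "T \<in> sets lebesgue" and U_sets: "U \<in> sets lebesgue" using T U by auto
  define T' where "T' = main_part lborel T"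
  have T': "T' \<in> sets borel" "AE t in lborel. t \<in> T' \<longleftrightarrow> t \<in> T" "emeasure lborel T' \<le> ennreal (measure lebesgue T)"
    using main_part_sets[OF T_sets] AE_in_main_part[OF T_sets] emeasure_completion[OF T_sets] emeasure_eq_measure2[OF T]
    by (simp_all add: T'_def)
  define V where "V = {x. 2 * pi * x \<in> U}"
  have V_eq: "V = (\<lambda>x. (2 * pi) *\<^sub>R x) -` U \<inter> space lebesgue" by (auto simp: V_def)
  have V: "V \<in> sets lebesgue"
    unfolding V_eq by (rule measurable_sets[OF lebesgue_measurable_scaling U_sets])
  define W where "W = main_part lborel V"
  have "emeasure lebesgue U = ennreal \<bar>2 * pi\<bar> * (\<integral>\<^sup>+ x. indicator U (0 + 2 * pi * x) \<partial>lebesgue)"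
    using nn_integral_real_affine_lebesgue[of "indicator U" "2 * pi" 0] U_sets by simp
  also have "(\<integral>\<^sup>+ x. indicator U (0 + 2 * pi * x) \<partial>lebesgue) = (\<integral>\<^sup>+ x. indicator V x \<partial>lebesgue)"
    by (rule nn_integral_cong) (simp add: V_def indicator_def)
  also have "\<dots> = emeasure lebesgue V" by (rule nn_integral_indicator[OF V])
  finally have eU: "emeasure lebesgue U = ennreal (2 * pi) * emeasure lebesgue V" by simp
  have "ennreal 1 * emeasure lebesgue V \<le> ennreal (2 * pi) * emeasure lebesgue V"
    by (intro mult_right_mono ennreal_leI) (use pi_ge_two in auto)
  then have "emeasure lebesgue V \<le> ennreal (measure lebesgue U)"
    using eU emeasure_eq_measure2[OF U] by simp
  then have W: "W \<in> sets borel" "AE x in lborel. x \<in> W \<longleftrightarrow> 2 * pi * x \<in> U" "emeasure lborel W \<le> ennreal (measure lebesgue U)"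
    using main_part_sets[OF V] AE_in_main_part[OF V] emeasure_completion[OF V]
    by (simp_all add: W_def V_def)
  have freq: "(\<integral>\<^sup>+ u \<in> - ((\<lambda>u. u * b) ` U). ennreal ((cmod (wolct (a, b, c, d, u0, w0) \<phi> f u w))\<^sup>2) \<partial>lebesgue)
     = (\<integral>\<^sup>+ x\<in>- W. ennreal ((cmod (fourier (chirp_product a b u0 f' \<phi>' w) x))\<^sup>2) \<partial>lborel)" for w
    unfolding wolct_cong_AE[OF f_meas f'(2,1) \<phi>_meas \<phi>'(2,1)]
    by (rule wolct_frequency_integral[OF f'(1) \<phi>'(1) b U_sets W(1,2)])
  have comp: "(\<integral>\<^sup>+ t \<in> - T. ennreal ((cmod (f t))\<^sup>2) \<partial>lborel) = (\<integral>\<^sup>+ t \<in> - T'. ennreal ((cmod (f' t))\<^sup>2) \<partial>lborel)"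
    by (rule cong[OF f'(2)]) (use T'(2) in \<open>auto elim: eventually_mono\<close>)
  show "ennreal ((L2_norm \<phi>)\<^sup>2) * (\<integral>\<^sup>+ t. ennreal ((cmod (f t))\<^sup>2) \<partial>lebesgue)
       \<le> ennreal (7 * exp 44 * exp (7 * exp 44 * measure lebesgue T * measure lebesgue U)) *
         (ennreal ((L2_norm \<phi>)\<^sup>2) * (\<integral>\<^sup>+ t \<in> - T. ennreal ((cmod (f t))\<^sup>2) \<partial>lebesgue)
          + (\<integral>\<^sup>+ w. (\<integral>\<^sup>+ u \<in> - ((\<lambda>u. u * b) ` U).
               ennreal ((cmod (wolct (a, b, c, d, u0, w0) \<phi> f u w))\<^sup>2) \<partial>lebesgue) \<partial>lebesgue))"
    unfolding freq unfolding nn_integral_completion \<phi>_norm f_norm comp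
    by (rule wolct_uncertainty_borel[OF f'(1) \<phi>'(1) L2 T'(1) _ T'(3) W(1) _ W(3)]) simp_all
qed simp

end
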